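(* Let $\mathcal{Q}_1$ be a set of prime powers with the following property: every $q\in\mathcal{Q}_1$ can be written as $q=r_1^{e_1}\cdots r_m^{e_m}+1$, where $r_1,\ldots,r_m$ are distinct primes and $e_1,\ldots,e_m\geq 1$, such that $r_1+\cdots+r_m=O(\mathrm{poly}(\log q))$, and such that for each $1\leq j\leq m$ a primitive $z_j$-th root of unity in $\mathbb{F}_q$ can be computed in time polynomial in $\log q$, where $z_j=4$ if $r_j=2$ and $z_j=r_j$ otherwise. Then for $q\in\mathcal{Q}_1$ there is a deterministic polynomial-time (in $\log q$) algorithm constructing a primitive element of $\mathbb{F}_q$, i.e. a generator of the cyclic group $\mathbb{F}_q^\times$.
   Context: $\mathbb{F}_q$ denotes the finite field with $q$ elements. Running times are measured in bit operations. *)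

theory Defs
  imports
    "HOL-Number_Theory.Number_Theory"
    "HOL-Algebra.Polynomial_Divisibility"
    "HOL-Library.Log_Nat"
begin

section \<open>Deterministic programs and the number of bit operations they take\<close>

text \<open>
  Programs are the terms of a small first-order language that operates on nested pairs of natural
  numbers. There are no variables: a program maps one value to one value.
  Every step is charged for reading its argument and writing its result; multiplication and
  division with remainder are charged the quadratic cost of the schoolbook methods. Hence running
  times agree, up to a polynomial, with those of a multitape Turing machine on the binary
  encodings. In particular a program cannot build a value that is larger than its running time,
  see \<open>runs_bits_le\<close> below.
\<close>

datatype val = Num nat | Pair val val

primrec bits :: "val \<Rightarrow> nat" where
  "bits (Num n) = Suc (floorlog 2 n)"
| "bits (Pair u v) = Suc (bits u + bits v)"

datatype binop = Plus | Minus | Times | Divide | Modulo | Less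

fun apply_op :: "binop \<Rightarrow> nat \<Rightarrow> nat \<Rightarrow> nat" where
  "apply_op Plus m n = m + n"
| "apply_op Minus m n = m - n"
| "apply_op Times m n = m * n"
| "apply_op Divide m n = m div n"
| "apply_op Modulo m n = m mod n"
| "apply_op Less m n = (if m < n then 1 else 0)"

fun op_cost :: "binop \<Rightarrow> nat \<Rightarrow> nat" where
  "op_cost Plus s = s"
| "op_cost Minus s = s"
| "op_cost Less s = s"
| "op_cost Times s = s\<^sup>2"
| "op_cost Divide s = s\<^sup>2"
| "op_cost Modulo s = s\<^sup>2"

datatype prog =
    Id
  | Fst
  | Snd
  | Const nat
  | Op binop
  | Seq prog prog
  | Fork prog prog
  | Cond prog prog prog
  | While prog prog

text \<open>
  \<open>runs P x y t\<close>: on input \<open>x\<close> the program \<open>P\<close> halts with output \<open>y\<close> after \<open>t\<close> bit operations.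
  In tests \<open>Num 0\<close> means false and every other value, pairs included, means true, so a list
  terminated by \<open>Num 0\<close> can be tested for emptiness. Steps applied to an argument of the
  wrong shape are stuck.
\<close>

inductive runs :: "prog \<Rightarrow> val \<Rightarrow> val \<Rightarrow> nat \<Rightarrow> bool" where
  Id: "runs Id x x (bits x)"
| Fst: "runs Fst (Pair u v) u (bits (Pair u v))"
| Snd: "runs Snd (Pair u v) v (bits (Pair u v))"
| Const: "runs (Const n) x (Num n) (bits x + bits (Num n))"
| Op: "runs (Op f) (Pair (Num m) (Num n)) (Num (apply_op f m n))
         (op_cost f (bits (Pair (Num m) (Num n))))"
| Seq: "runs P x y t \<Longrightarrow> runs Q y z u \<Longrightarrow> runs (Seq P Q) x z (t + u)"
| Fork: "runs P x y t \<Longrightarrow> runs Q x z u \<Longrightarrow>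
         runs (Fork P Q) x (Pair y z) (t + u + bits (Pair y z))"
| Cond_true: "runs B x v s \<Longrightarrow> v \<noteq> Num 0 \<Longrightarrow> runs P x y t \<Longrightarrow>
         runs (Cond B P Q) x y (s + t + bits x)"
| Cond_false: "runs B x (Num 0) s \<Longrightarrow> runs Q x y t \<Longrightarrow>
         runs (Cond B P Q) x y (s + t + bits x)"
| While_stop: "runs B x (Num 0) s \<Longrightarrow> runs (While B P) x x (s + bits x)"
| While_step: "runs B x v s \<Longrightarrow> v \<noteq> Num 0 \<Longrightarrow> runs P x y t \<Longrightarrow> runs (While B P) y z u \<Longrightarrow>
         runs (While B P) x z (s + t + u + bits x)"

inductive_cases runs_IdE: "runs Id x y t"
inductive_cases runs_FstE: "runs Fst x y t"
inductive_cases runs_SndE: "runs Snd x y t"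
inductive_cases runs_ConstE: "runs (Const n) x y t"
inductive_cases runs_OpE: "runs (Op f) x y t"
inductive_cases runs_SeqE: "runs (Seq P Q) x y t"
inductive_cases runs_ForkE: "runs (Fork P Q) x y t"
inductive_cases runs_CondE: "runs (Cond B P Q) x y t"
inductive_cases runs_WhileE: "runs (While B P) x y t"

lemma runs_deterministic:
  "runs P x y t \<Longrightarrow> runs P x y' t' \<Longrightarrow> y' = y \<and> t' = t"
proof (induction arbitrary: y' t' rule: runs.induct)
  case (Seq P x y t Q z u)
  from Seq.prems show ?case by (rule runs_SeqE) (use Seq.IH in metis)
next
  case (Fork P x y t Q z u)
  from Fork.prems show ?case by (rule runs_ForkE) (simp, use Fork.IH in metis)
next
  case (Cond_true B x v s P y t Q)
  from Cond_true.prems show ?case by (rule runs_CondE) (use Cond_true.IH Cond_true.hyps in metis)+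
next
  case (Cond_false B x s Q y t P)
  from Cond_false.prems show ?case by (rule runs_CondE) (use Cond_false.IH in metis)+
next
  case (While_stop B x s P)
  from While_stop.prems show ?case by (rule runs_WhileE) (use While_stop.IH in metis)+
next
  case (While_step B x v s P y t z u)
  from While_step.prems show ?case by (rule runs_WhileE) (use While_step.IH While_step.hyps in metis)+
qed (auto elim: runs_IdE runs_FstE runs_SndE runs_ConstE runs_OpE)

lemma floorlog_2_le_iff: "floorlog 2 n \<le> k \<longleftrightarrow> n < 2 ^ k"
  by (simp add: floorlog_le_iff)

lemma less_pow_floorlog: "n < 2 ^ floorlog 2 n"
  using floorlog_2_le_iff[of n "floorlog 2 n"] by simp

lemma floorlog_apply_op:
  "floorlog 2 (apply_op f m n) \<le> Suc (floorlog 2 m + floorlog 2 n)"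
proof -
  have m: "m < 2 ^ floorlog 2 m" and n: "n < 2 ^ floorlog 2 n"
    by (rule less_pow_floorlog)+
  define N :: nat where "N = 2 ^ (floorlog 2 m + floorlog 2 n)"
  have "m * n < N"
    unfolding N_def power_add using m n by (intro mult_strict_mono) auto
  moreover have "m < N"
    unfolding N_def by (rule less_le_trans[OF m]) (simp add: power_increasing)
  moreover have "n < N"
    unfolding N_def by (rule less_le_trans[OF n]) (simp add: power_increasing)
  moreover have "m div n \<le> m" "m mod n \<le> m" by simp_all
  ultimately have "apply_op f m n < 2 * N"
    by (cases f) (simp_all del: div_le_dividend mod_less_eq_dividend)
  then have "apply_op f m n < 2 ^ Suc (floorlog 2 m + floorlog 2 n)"
    by (simp add: N_def)
  then show ?thesis by (simp only: floorlog_2_le_iff)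
qed

lemma runs_bits_le: "runs P x y t \<Longrightarrow> bits y \<le> t"
proof (induction rule: runs.induct)
  case (Op f m n)
  have "bits (Num (apply_op f m n)) \<le> bits (Pair (Num m) (Num n))"
    using floorlog_apply_op[of f m n] by simp
  also have "\<dots> \<le> op_cost f (bits (Pair (Num m) (Num n)))"
    by (cases f) (simp_all add: power2_eq_square)
  finally show ?case .
qed simp_all

text \<open>
  A computational problem is a set of instances \<open>(q, x, Y)\<close>: the input \<open>x\<close>, the set \<open>Y\<close> of correct
  outputs, and the number \<open>q\<close> in whose logarithm the running time is measured. One program has
  to serve all instances. As \<open>log 2 q \<ge> 1\<close> for \<open>q \<ge> 2\<close>, bounds of the form \<open>c * (log 2 q) ^ d\<close>
  are equivalent to polynomial bounds in \<open>log q\<close>.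
\<close>

definition solvable_in_polylog_time :: "(nat \<times> val \<times> val set) set \<Rightarrow> bool" where
  "solvable_in_polylog_time I \<longleftrightarrow>
     (\<exists>P c d. \<forall>(q, x, Y) \<in> I. \<exists>y t. runs P x y t \<and> y \<in> Y \<and>
        real t \<le> real c * log 2 (real q) ^ d)"


section \<open>Finite fields as computational objects\<close>

text \<open>
  A field with \<open>q = p ^ n\<close> elements is given to a program as \<open>\<int>/p\<int>[X]/(f)\<close>, by the prime \<open>p\<close> and a
  monic irreducible polynomial \<open>f\<close> of degree \<open>n\<close>; its elements are given by their reduced
  representatives. Polynomials are the coefficient lists of HOL-Algebra, with the leading
  coefficient first and \<open>[]\<close> for zero.
\<close>

definition field_presentation :: "nat \<Rightarrow> nat \<Rightarrow> int list \<Rightarrow> bool" where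
  "field_presentation q p f \<longleftrightarrow>
     Factorial_Ring.prime p \<and>
     f \<in> carrier (poly_ring (residue_ring (int p))) \<and>
     lead_coeff f = \<one>\<^bsub>residue_ring (int p)\<^esub> \<and>
     pirreducible\<^bsub>residue_ring (int p)\<^esub> (carrier (residue_ring (int p))) f \<and>
     q = p ^ degree f"

definition presented_field :: "nat \<Rightarrow> int list \<Rightarrow> int list set ring" where
  "presented_field p f = Rupt\<^bsub>residue_ring (int p)\<^esub> (carrier (residue_ring (int p))) f"

definition reduced :: "nat \<Rightarrow> int list \<Rightarrow> int list \<Rightarrow> bool" where
  "reduced p f g \<longleftrightarrow>
     g \<in> carrier (poly_ring (residue_ring (int p))) \<and> length g < length f"

definition field_elem :: "nat \<Rightarrow> int list \<Rightarrow> int list \<Rightarrow> int list set" where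
  "field_elem p f g =
     PIdl\<^bsub>poly_ring (residue_ring (int p))\<^esub> f +>\<^bsub>poly_ring (residue_ring (int p))\<^esub> g"

definition primitive_root_of_unity :: "('a, 'b) ring_scheme \<Rightarrow> nat \<Rightarrow> 'a \<Rightarrow> bool" where
  "primitive_root_of_unity F z a \<longleftrightarrow>
     a \<in> carrier (mult_of F) \<and> group.ord (mult_of F) a = z"

definition primitive_element :: "('a, 'b) ring_scheme \<Rightarrow> 'a \<Rightarrow> bool" where
  "primitive_element F a \<longleftrightarrow>
     a \<in> carrier (mult_of F) \<and> generate (mult_of F) {a} = carrier (mult_of F)"

primrec enc_poly :: "int list \<Rightarrow> val" where
  "enc_poly [] = Num 0"
| "enc_poly (c # cs) = Pair (Num (nat c)) (enc_poly cs)"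

definition enc_field :: "nat \<Rightarrow> int list \<Rightarrow> val" where
  "enc_field p f = Pair (Num p) (enc_poly f)"

definition root_order :: "nat \<Rightarrow> nat" where
  "root_order r = (if r = 2 then 4 else r)"

text \<open>The second argument below is, for every \<open>q\<close>, a set of orders \<open>z\<close>; \<open>z\<close> is part of the input.\<close>

definition root_of_unity_problem ::
    "nat set \<Rightarrow> (nat \<Rightarrow> nat set) \<Rightarrow> (nat \<times> val \<times> val set) set" where
  "root_of_unity_problem Q Z =
     {(q, Pair (enc_field p f) (Num z),
       {enc_poly g | g. reduced p f g \<and>
          primitive_root_of_unity (presented_field p f) z (field_elem p f g)})
      | q p f z. q \<in> Q \<and> field_presentation q p f \<and> z \<in> Z q}"

definition primitive_element_problem :: "nat set \<Rightarrow> (nat \<times> val \<times> val set) set" where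
  "primitive_element_problem Q =
     {(q, enc_field p f,
       {enc_poly g | g. reduced p f g \<and>
          primitive_element (presented_field p f) (field_elem p f g)})
      | q p f. q \<in> Q \<and> field_presentation q p f}"

end

theory Submission
  imports Defs "HOL-Library.While_Combinator"
begin

text \<open>
  A primitive element is a product of elements of order \<open>r ^ t\<close>, one for every prime power \<open>r ^ t\<close> exactly dividing
  \<open>N = q - 1\<close>, and trial division finds the primes. So let \<open>b\<close> have order \<open>r ^ k\<close>, where \<open>r ^ (k + 1)\<close> divides \<open>N\<close>;
  an element of order \<open>r ^ (k + 1)\<close> is wanted. As \<open>b\<close> is an \<open>r\<close>-th power, \<open>R = K[X] / (X ^ r - b)\<close> is a product of \<open>r\<close> copies
  of \<open>K\<close>, the components of \<open>X\<close> are the \<open>r\<close>-th roots of \<open>b\<close>, and the automorphism \<open>X \<mapsto> rho X\<close>, where \<open>rho\<close> is a primitive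
  \<open>r\<close>-th root of unity, permutes the components cyclically. The quotient of \<open>1 + X\<close> by its conjugate is not constant and has
  norm 1. Raising it successively to the prime factors of \<open>N\<close> (with multiplicity) one ends at 1, so there is a last nonconstant
  power \<open>v\<close>, whose \<open>l\<close>-th power is constant for some prime \<open>l\<close>. Either the quotient of \<open>v\<close> by its conjugate is nonconstant with
  values in the \<open>l\<close>-th roots of unity, or \<open>l = r\<close> and, since \<open>v\<close> has norm 1, the values of \<open>v\<close> are \<open>l\<close>-th roots of unity (fourth
  roots if \<open>l = 2\<close>). Comparing such values with the known roots of unity yields a nontrivial idempotent of \<open>R\<close>, which selects
  \<open>i\<close> of the components of \<open>X\<close> with \<open>0 < i < r\<close>. The product of the selected roots of \<open>b\<close> lies in \<open>K\<close> and has order \<open>r ^ (k + 1)\<close>.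
\<close>

section \<open>Polynomial-time functions\<close>

text \<open>The \<open>r\<close>-th roots of \<open>b\<close> exist in \<open>K\<close>, but finding
  one is as hard as the task itself. So the algorithm computes with coefficient lists in
  \<open>R\<close>, while the proof evaluates these lists at the roots. The algorithm cannot see
  which power of the starting quotient is the last nonconstant one, nor which alternative holds
  there: it makes all comparisons in every round and checks each result by two powers in
  \<open>K\<close>; a success is never replaced by a failure. Roots of unity are needed for all
  primes \<open>l\<close> dividing \<open>N\<close>, since the chain of powers may end at any of
  them. Inverses are powers with exponent \<open>N - 1\<close>. The start is \<open>1 + X\<close>
  because the quotient of \<open>X\<close> by its conjugate is constant. Order 4 for the prime 2
  comes from the product of a geometric sequence of length \<open>r\<close>: the exponent
  \<open>r * (r - 1) div 2\<close> of the ratio is a multiple of \<open>r\<close> for odd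
  \<open>r\<close>, but 1 for \<open>r = 2\<close>. The bound on the sum of the primes enters three
  times: for the rank of \<open>R\<close>, for the number of roots of unity compared, and for trial
  division.\<close>

class enc =
  fixes enc :: "'a \<Rightarrow> val"

instantiation nat :: enc
begin
definition enc_nat :: "nat \<Rightarrow> val" where "enc_nat n = Num n"
instance ..
end

instantiation bool :: enc
begin
definition enc_bool :: "bool \<Rightarrow> val" where "enc_bool b = Num (of_bool b)"
instance ..
end

instantiation prod :: (enc, enc) enc
begin
definition enc_prod :: "'a \<times> 'b \<Rightarrow> val" where "enc_prod z = Pair (enc (fst z)) (enc (snd z))"
instance ..
end

text \<open>The empty list is encoded as in \<open>enc_poly\<close>, so a polynomial has the
  encoding of its list of coefficients as naturals, and emptiness can be tested by
  \<open>Cond\<close> and \<open>While\<close>.\<close>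

instantiation list :: (enc) enc
begin
primrec enc_list :: "'a list \<Rightarrow> val" where
  "enc_list [] = Num 0"
| "enc_list (x # xs) = Pair (enc x) (enc_list xs)"
instance ..
end

lemma enc_Pair [simp]: "enc (x, y) = Pair (enc x) (enc y)"
  by (simp add: enc_prod_def)

abbreviation bs :: "'a::enc \<Rightarrow> nat" where "bs x \<equiv> bits (enc x)"

lemma bits_pos: "bits v \<ge> 1"
  by (cases v) simp_all

lemma bs_pos: "bs x \<ge> 1"
  by (rule bits_pos)

text \<open>Domains are sets of pairs \<open>(n, x)\<close>: the argument \<open>x\<close> together with the parameter \<open>n\<close> in which
  bounds are polynomial. The base \<open>n + 2\<close> makes a single exponent suffice.\<close>

definition polyb :: "(nat \<times> 'a) set \<Rightarrow> (nat \<Rightarrow> 'a \<Rightarrow> nat) \<Rightarrow> bool" where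
  "polyb D T \<longleftrightarrow> (\<exists>k. \<forall>(n, x) \<in> D. T n x \<le> (n + 2) ^ k)"

text \<open>\<open>P\<close> is fixed before the parameter, which is not part of its input: one
  program serves all \<open>n\<close>. Only arguments in \<open>D\<close> are considered, so
  \<open>D\<close> also carries the preconditions of partial operations such as
  \<open>hd\<close>.\<close>

definition ptime :: "(nat \<times> 'a::enc) set \<Rightarrow> ('a \<Rightarrow> 'b::enc) \<Rightarrow> bool" where
  "ptime D f \<longleftrightarrow> (\<exists>P T. polyb D T \<and> (\<forall>(n, x) \<in> D. \<exists>t\<le>T n x. runs P (enc x) (enc (f x)) t))"

definition bdd :: "(nat \<times> 'a::enc) set \<Rightarrow> bool" where
  "bdd D \<longleftrightarrow> polyb D (\<lambda>n x. bs x)"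

section \<open>Closure properties of polynomial bounds\<close>

lemma polyb_const: "polyb D (\<lambda>n x. c)"
proof -
  have "c \<le> (n + 2) ^ c" for n :: nat
  proof -
    have "c \<le> 2 ^ c" by (simp add: less_imp_le)
    also have "\<dots> \<le> (n + 2) ^ c" by (rule power_mono) auto
    finally show ?thesis .
  qed
  then show ?thesis unfolding polyb_def by (intro exI[of _ c]) blast
qed

lemma polyb_size: "polyb D (\<lambda>n x. n)"
  unfolding polyb_def by (intro exI[of _ 1]) auto

lemma polyb_add:
  assumes "polyb D S" "polyb D T"
  shows "polyb D (\<lambda>n x. S n x + T n x)"
proof -
  obtain i j where i: "\<And>n x. (n, x) \<in> D \<Longrightarrow> S n x \<le> (n + 2) ^ i"
    and j: "\<And>n x. (n, x) \<in> D \<Longrightarrow> T n x \<le> (n + 2) ^ j"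
    using assms unfolding polyb_def by blast
  have "S n x + T n x \<le> (n + 2) ^ (i + j + 1)" if "(n, x) \<in> D" for n x
  proof -
    have "S n x + T n x \<le> (n + 2) ^ (i + j) + (n + 2) ^ (i + j)"
      using i[OF that] j[OF that]
      by (intro add_mono; elim order_trans) (auto intro: power_increasing)
    also have "\<dots> \<le> (n + 2) ^ (i + j + 1)" by simp
    finally show ?thesis .
  qed
  then show ?thesis unfolding polyb_def by blast
qed

lemma polyb_mult:
  assumes "polyb D S" "polyb D T"
  shows "polyb D (\<lambda>n x. S n x * T n x)"
proof -
  obtain i j where i: "\<And>n x. (n, x) \<in> D \<Longrightarrow> S n x \<le> (n + 2) ^ i"
    and j: "\<And>n x. (n, x) \<in> D \<Longrightarrow> T n x \<le> (n + 2) ^ j"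
    using assms unfolding polyb_def by blast
  have "S n x * T n x \<le> (n + 2) ^ (i + j)" if "(n, x) \<in> D" for n x
    unfolding power_add using i[OF that] j[OF that] by (rule mult_mono) auto
  then show ?thesis unfolding polyb_def by blast
qed

lemma polyb_power: "polyb D S \<Longrightarrow> polyb D (\<lambda>n x. S n x ^ k)"
  by (induction k) (auto intro: polyb_const polyb_mult)

lemma polyb_mono:
  assumes "polyb D T" "\<And>n x. (n, x) \<in> D \<Longrightarrow> S n x \<le> T n x"
  shows "polyb D S"
proof -
  obtain k where "\<And>n x. (n, x) \<in> D \<Longrightarrow> T n x \<le> (n + 2) ^ k"
    using assms(1) unfolding polyb_def by blast
  then show ?thesis
    unfolding polyb_def using assms(2) by (intro exI[of _ k]) (blast intro: order_trans)
qed

lemma polyb_reindex: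
  assumes "polyb E T" "\<And>n x. (n, x) \<in> D \<Longrightarrow> (n, f x) \<in> E"
  shows "polyb D (\<lambda>n x. T n (f x))"
  using assms unfolding polyb_def by blast

text \<open>The witness \<open>y\<close> may depend on \<open>n\<close> and \<open>x\<close>, but
  the parameter stays the same. Thus a loop state inherits its bound from the input it arose
  from.\<close>

lemma polyb_transfer:
  assumes "polyb E T" "\<And>n x. (n, x) \<in> D \<Longrightarrow> \<exists>y. (n, y) \<in> E \<and> S n x \<le> T n y"
  shows "polyb D S"
proof -
  obtain k where k: "\<And>n y. (n, y) \<in> E \<Longrightarrow> T n y \<le> (n + 2) ^ k"
    using assms(1) unfolding polyb_def by blast
  have "S n x \<le> (n + 2) ^ k" if x: "(n, x) \<in> D" for n x
  proof -
    obtain y where "(n, y) \<in> E" "S n x \<le> T n y" using assms(2)[OF x] by blast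
    then show ?thesis using k[of n y] by (rule_tac order_trans)
  qed
  then show ?thesis unfolding polyb_def by blast
qed

lemmas polyb_intros = polyb_const polyb_size polyb_add polyb_mult polyb_power

section \<open>Closure properties of polynomial-time functions\<close>

lemma ptimeI:
  assumes "\<And>n x. (n, x) \<in> D \<Longrightarrow> runs P (enc x) (enc (f x)) (T n x)" "polyb D T"
  shows "ptime D f"
  unfolding ptime_def using assms by (intro exI[of _ P] exI[of _ T]) fastforce

lemma ptimeE:
  assumes "ptime D f"
  obtains P T where "polyb D T" "\<And>n x. (n, x) \<in> D \<Longrightarrow> runs P (enc x) (enc (f x)) (T n x)"
proof -
  obtain P T where T: "polyb D T"
    and P: "\<And>n x. (n, x) \<in> D \<Longrightarrow> \<exists>t\<le>T n x. runs P (enc x) (enc (f x)) t"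
    using assms unfolding ptime_def by fast
  define S where "S n x = (SOME t. t \<le> T n x \<and> runs P (enc x) (enc (f x)) t)" for n x
  have S: "S n x \<le> T n x \<and> runs P (enc x) (enc (f x)) (S n x)" if "(n, x) \<in> D" for n x
    unfolding S_def using P[OF that] by (rule someI2_ex)
  show thesis
    by (rule that[of S P]) (use S polyb_mono[OF T] in auto)
qed

text \<open>Every instruction is charged for reading its argument. With \<open>runs_bits_le\<close>
  a polynomial running time bounds the sizes of both arguments and values.\<close>

lemma runs_bits_arg_le: "runs P x y t \<Longrightarrow> bits x \<le> t"
proof (induction rule: runs.induct)
  case (Op f m n)
  show ?case by (cases f) (simp_all add: power2_eq_square)
qed simp_all

lemma ptime_bdd: "ptime D f \<Longrightarrow> bdd D"
  unfolding bdd_def by (erule ptimeE, erule polyb_mono, rule runs_bits_arg_le)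

lemma ptime_bs_le: "ptime D f \<Longrightarrow> polyb D (\<lambda>n x. bs (f x))"
  by (erule ptimeE, erule polyb_mono, rule runs_bits_le)

lemma ptime_subset: "ptime E f \<Longrightarrow> D \<subseteq> E \<Longrightarrow> ptime D f"
  unfolding ptime_def polyb_def by (meson subsetD)

lemma ptime_cong:
  assumes "ptime D f" "\<And>n x. (n, x) \<in> D \<Longrightarrow> f x = g x"
  shows "ptime D g"
  using assms(1) by (rule ptimeE) (rule ptimeI; use assms(2) in auto)

lemma bdd_subset: "bdd E \<Longrightarrow> D \<subseteq> E \<Longrightarrow> bdd D"
  unfolding bdd_def polyb_def by blast

lemma ptime_comp:
  assumes f: "ptime D f" and g: "ptime E g" and "\<And>n x. (n, x) \<in> D \<Longrightarrow> (n, f x) \<in> E"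
  shows "ptime D (\<lambda>x. g (f x))"
proof -
  obtain P S where P: "polyb D S" "\<And>n x. (n, x) \<in> D \<Longrightarrow> runs P (enc x) (enc (f x)) (S n x)"
    using f by (rule ptimeE) blast
  obtain Q T where Q: "polyb E T" "\<And>n x. (n, x) \<in> E \<Longrightarrow> runs Q (enc x) (enc (g x)) (T n x)"
    using g by (rule ptimeE) blast
  show ?thesis
  proof (rule ptimeI[where P = "Seq P Q" and T = "\<lambda>n x. S n x + T n (f x)"])
    show "polyb D (\<lambda>n x. S n x + T n (f x))"
      by (intro polyb_add P(1) polyb_reindex[OF Q(1)] assms(3))
  qed (rule runs.Seq[OF P(2) Q(2)[OF assms(3)]])
qed

lemma ptime_id: "bdd D \<Longrightarrow> ptime D (\<lambda>x. x)"
  by (rule ptimeI[where P = Id and T = "\<lambda>n x. bs x"]) (auto simp: bdd_def intro: runs.Id)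

lemma ptime_Pair:
  assumes f: "ptime D f" and g: "ptime D g"
  shows "ptime D (\<lambda>x. (f x, g x))"
proof -
  obtain P S where P: "polyb D S" "\<And>n x. (n, x) \<in> D \<Longrightarrow> runs P (enc x) (enc (f x)) (S n x)"
    using f by (rule ptimeE) blast
  obtain Q T where Q: "polyb D T" "\<And>n x. (n, x) \<in> D \<Longrightarrow> runs Q (enc x) (enc (g x)) (T n x)"
    using g by (rule ptimeE) blast
  show ?thesis
  proof (rule ptimeI[where P = "Fork P Q" and T = "\<lambda>n x. S n x + T n x + (1 + (bs (f x) + bs (g x)))"])
    show "polyb D (\<lambda>n x. S n x + T n x + (1 + (bs (f x) + bs (g x))))"
      by (intro polyb_add polyb_const P(1) Q(1) ptime_bs_le f g)
  qed (use P(2) Q(2) runs.Fork[of P _ _ _ Q] in fastforce)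
qed

lemma ptime_const_aux:
  assumes "bdd D" "\<And>n x. (n, x) \<in> D \<Longrightarrow> enc (f x) = Num k"
  shows "ptime D f"
  by (rule ptimeI[where P = "Const k" and T = "\<lambda>n x. bs x + bits (Num k)"])
     (use assms runs.Const in \<open>auto intro!: polyb_add polyb_const simp: bdd_def simp del: bits.simps\<close>)

lemma ptime_nat: "bdd D \<Longrightarrow> ptime D (\<lambda>x. k::nat)"
  by (rule ptime_const_aux) (auto simp: enc_nat_def)

lemma ptime_bool: "bdd D \<Longrightarrow> ptime D (\<lambda>x. b::bool)"
  by (rule ptime_const_aux) (auto simp: enc_bool_def)

lemma ptime_Nil: "bdd D \<Longrightarrow> ptime D (\<lambda>x. [])"
  by (rule ptime_const_aux) auto

text \<open>This handles a single instruction applied after \<open>f\<close>. Its cost depends only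
  on the size of \<open>f x\<close>; the square is the schoolbook cost of multiplication and
  division, the dearest instructions.\<close>

lemma ptime_step:
  assumes f: "ptime D f"
    and P: "\<And>n x. (n, x) \<in> D \<Longrightarrow> runs P (enc (f x)) (enc (g x)) (T (bs (f x)))"
    and T: "\<And>m. T m \<le> m ^ 2"
  shows "ptime D g"
proof -
  obtain Q S where Q: "polyb D S" "\<And>n x. (n, x) \<in> D \<Longrightarrow> runs Q (enc x) (enc (f x)) (S n x)"
    using f by (rule ptimeE) blast
  have "polyb D (\<lambda>n x. T (bs (f x)))"
    by (rule polyb_mono[OF polyb_power[OF ptime_bs_le[OF f], of 2]]) (rule T)
  then have "polyb D (\<lambda>n x. S n x + T (bs (f x)))"
    by (intro polyb_add Q(1))
  then show ?thesis
    by (rule ptimeI[where P = "Seq Q P", rotated]) (rule runs.Seq[OF Q(2) P])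
qed

lemma le_square: "m \<le> m ^ 2" for m :: nat
  by (simp add: power2_eq_square)

lemma ptime_fst: "ptime D f \<Longrightarrow> ptime D (\<lambda>x. fst (f x))"
  by (erule ptime_step[where P = Fst and T = "\<lambda>m. m"])
     (auto simp: enc_prod_def le_square intro: runs.Fst[simplified])

lemma ptime_snd: "ptime D f \<Longrightarrow> ptime D (\<lambda>x. snd (f x))"
  by (erule ptime_step[where P = Snd and T = "\<lambda>m. m"])
     (auto simp: enc_prod_def le_square intro: runs.Snd[simplified])

lemma ptime_hd:
  assumes "ptime D f" "\<And>n x. (n, x) \<in> D \<Longrightarrow> f x \<noteq> []"
  shows "ptime D (\<lambda>x. hd (f x))"
proof (rule ptime_step[OF assms(1), where P = Fst and T = "\<lambda>m. m"])
  fix n x assume "(n, x) \<in> D"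
  then obtain y ys where "f x = y # ys" using assms(2) by (metis list.exhaust)
  then show "runs Fst (enc (f x)) (enc (hd (f x))) (bs (f x))"
    by (auto intro: runs.Fst[simplified])
qed (rule le_square)

lemma ptime_tl:
  assumes "ptime D f" "\<And>n x. (n, x) \<in> D \<Longrightarrow> f x \<noteq> []"
  shows "ptime D (\<lambda>x. tl (f x))"
proof (rule ptime_step[OF assms(1), where P = Snd and T = "\<lambda>m. m"])
  fix n x assume "(n, x) \<in> D"
  then obtain y ys where "f x = y # ys" using assms(2) by (metis list.exhaust)
  then show "runs Snd (enc (f x)) (enc (tl (f x))) (bs (f x))"
    by (auto intro: runs.Snd[simplified])
qed (rule le_square)

text \<open>A cons cell and a pair have the same encoding, so after pairing only \<open>Id\<close>
  remains.\<close>

lemma ptime_Cons: "ptime D f \<Longrightarrow> ptime D g \<Longrightarrow> ptime D (\<lambda>x. f x # g x)"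
  by (rule ptime_step[where f = "\<lambda>x. (f x, g x)" and P = Id and T = "\<lambda>m. m"])
     (auto simp: le_square intro: ptime_Pair runs.Id[of "Pair _ _", simplified])

lemma ptime_op:
  assumes "ptime D f" "ptime D g"
  shows "ptime D (\<lambda>x. apply_op p (f x) (g x))"
proof (rule ptime_step[OF ptime_Pair[OF assms], where P = "Op p" and T = "op_cost p"])
  show "op_cost p m \<le> m ^ 2" for m
    by (cases p) (auto simp: le_square)
qed (auto simp: enc_nat_def simp del: bits.simps intro: runs.Op)

lemma ptime_plus: "ptime D f \<Longrightarrow> ptime D g \<Longrightarrow> ptime D (\<lambda>x. f x + g x :: nat)"
  using ptime_op[of D f g Plus] by simp

lemma ptime_minus: "ptime D f \<Longrightarrow> ptime D g \<Longrightarrow> ptime D (\<lambda>x. f x - g x :: nat)"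
  using ptime_op[of D f g Minus] by simp

lemma ptime_times: "ptime D f \<Longrightarrow> ptime D g \<Longrightarrow> ptime D (\<lambda>x. f x * g x :: nat)"
  using ptime_op[of D f g Times] by simp

lemma ptime_div: "ptime D f \<Longrightarrow> ptime D g \<Longrightarrow> ptime D (\<lambda>x. f x div g x :: nat)"
  using ptime_op[of D f g Divide] by simp

lemma ptime_mod: "ptime D f \<Longrightarrow> ptime D g \<Longrightarrow> ptime D (\<lambda>x. f x mod g x :: nat)"
  using ptime_op[of D f g Modulo] by simp

lemma ptime_less:
  assumes "ptime D f" "ptime D g"
  shows "ptime D (\<lambda>x. f x < (g x :: nat))"
  by (rule ptime_step[OF ptime_op[OF assms, of Less], where P = Id and T = "\<lambda>m. m"])
     (auto simp: le_square enc_nat_def enc_bool_def intro: runs.Id[of "Num _", simplified])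

text \<open>The test is on encodings, so that truth values and lists are treated alike. Each branch
  has to be polynomial only where it is taken; this makes \<open>hd\<close> available under a test
  for emptiness.\<close>

lemma ptime_cond:
  assumes b: "ptime D b" and f: "ptime {(n, x) \<in> D. enc (b x) \<noteq> Num 0} f"
    and g: "ptime {(n, x) \<in> D. enc (b x) = Num 0} g"
  shows "ptime D (\<lambda>x. if enc (b x) \<noteq> Num 0 then f x else g x)"
proof -
  obtain B R where B: "polyb D R" "\<And>n x. (n, x) \<in> D \<Longrightarrow> runs B (enc x) (enc (b x)) (R n x)"
    using b by (rule ptimeE) blast
  obtain P S where P: "polyb {(n, x) \<in> D. enc (b x) \<noteq> Num 0} S"
    "\<And>n x. (n, x) \<in> {(n, x) \<in> D. enc (b x) \<noteq> Num 0} \<Longrightarrow> runs P (enc x) (enc (f x)) (S n x)"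
    using f by (rule ptimeE) blast
  obtain Q T where Q: "polyb {(n, x) \<in> D. enc (b x) = Num 0} T"
    "\<And>n x. (n, x) \<in> {(n, x) \<in> D. enc (b x) = Num 0} \<Longrightarrow> runs Q (enc x) (enc (g x)) (T n x)"
    using g by (rule ptimeE) blast
  define U where "U n x = (if enc (b x) \<noteq> Num 0 then S n x else T n x)" for n x
  obtain i j where "\<And>n x. (n, x) \<in> D \<Longrightarrow> enc (b x) \<noteq> Num 0 \<Longrightarrow> S n x \<le> (n + 2) ^ i"
    "\<And>n x. (n, x) \<in> D \<Longrightarrow> enc (b x) = Num 0 \<Longrightarrow> T n x \<le> (n + 2) ^ j"
    using P(1) Q(1) unfolding polyb_def by blast
  note * = this
  have "U n x \<le> (n + 2) ^ (i + j)" if "(n, x) \<in> D" for n x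
  proof -
    have "(n + 2) ^ i \<le> (n + 2) ^ (i + j)" "(n + 2) ^ j \<le> (n + 2) ^ (i + j)"
      by (rule power_increasing; simp)+
    with *(1)[OF that] *(2)[OF that] show ?thesis
      unfolding U_def by (cases "enc (b x) = Num 0"; simp del: add_2_eq_Suc'; linarith)
  qed
  then have U: "polyb D U" unfolding polyb_def by blast
  show ?thesis
  proof (rule ptimeI[where P = "Cond B P Q" and T = "\<lambda>n x. R n x + U n x + bs x"])
    show "polyb D (\<lambda>n x. R n x + U n x + bs x)"
      using B(1) U ptime_bdd[OF b] by (auto simp: bdd_def intro!: polyb_add)
    show "runs (Cond B P Q) (enc x) (enc (if enc (b x) \<noteq> Num 0 then f x else g x)) (R n x + U n x + bs x)"
      if "(n, x) \<in> D" for n x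
    proof (cases "enc (b x) = Num 0")
      case True
      then show ?thesis using B(2)[OF that] Q(2)[of n x] that by (auto simp: U_def intro!: runs.Cond_false)
    next
      case False
      then show ?thesis using B(2)[OF that] P(2)[of n x] that by (auto simp: U_def intro!: runs.Cond_true)
    qed
  qed
qed

lemma enc_bool_eq_0 [simp]: "enc b = Num 0 \<longleftrightarrow> \<not> b" "enc True \<noteq> Num 0" "enc False = Num 0"
  by (auto simp: enc_bool_def)

lemma ptime_if:
  assumes "ptime D b" "ptime {(n, x) \<in> D. b x} f" "ptime {(n, x) \<in> D. \<not> b x} g"
  shows "ptime D (\<lambda>x. if b x then f x else g x)"
  using ptime_cond[of D b f g] assms by simp

lemma ptime_not:
  assumes "ptime D b"
  shows "ptime D (\<lambda>x. \<not> b x)"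
proof -
  have "ptime D (\<lambda>x. if b x then False else True)"
    by (rule ptime_if) (auto intro!: assms ptime_bool bdd_subset[OF ptime_bdd[OF assms]])
  then show ?thesis by (rule ptime_cong) auto
qed

lemma ptime_conj:
  assumes "ptime D b" "ptime D c"
  shows "ptime D (\<lambda>x. b x \<and> c x)"
proof -
  have "ptime D (\<lambda>x. if b x then c x else False)"
    by (rule ptime_if) (auto intro!: assms ptime_bool bdd_subset[OF ptime_bdd[OF assms(1)]]
          ptime_subset[OF assms(2)])
  then show ?thesis by (rule ptime_cong) auto
qed

lemma ptime_eq_nat:
  assumes "ptime D f" "ptime D g"
  shows "ptime D (\<lambda>x. f x = (g x :: nat))"
  by (rule ptime_cong[OF ptime_conj[OF ptime_not ptime_not]], rule ptime_less, rule assms, rule assms,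
      rule ptime_less, rule assms, rule assms) auto

lemma ptime_eq_Nil:
  assumes "ptime D f"
  shows "ptime D (\<lambda>x. f x = [])"
proof -
  have *: "enc xs = Num 0 \<longleftrightarrow> xs = []" for xs :: "'b list"
    by (cases xs) auto
  have "ptime D (\<lambda>x. if enc (f x) \<noteq> Num 0 then False else True)"
    by (rule ptime_cond[OF assms]) (auto intro!: ptime_bool bdd_subset[OF ptime_bdd[OF assms]])
  then show ?thesis by (rule ptime_cong) (auto simp: *)
qed

text \<open>A polynomial number of rounds alone would not suffice, as repeated squaring shows. On
  the invariant set \<open>E\<close> one round costs at most a polynomial in \<open>n\<close>, which
  stays fixed during the loop; the total is this cost times the number of rounds.\<close>

lemma ptime_tailrec:
  assumes F: "\<And>n s. (n, s) \<in> E \<Longrightarrow> F s = (if b s then F (g s) else s)"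
    and E: "\<And>n s. (n, s) \<in> E \<Longrightarrow> b s \<Longrightarrow> (n, g s) \<in> E"
    and m: "\<And>n s. (n, s) \<in> E \<Longrightarrow> b s \<Longrightarrow> m n (g s) < m n s"
    and mb: "polyb E m"
    and b: "ptime E b" and g: "ptime {(n, s) \<in> E. b s} g"
  shows "ptime E F"
proof -
  obtain B R where BR: "polyb E R"
    and B: "\<And>n x. (n, x) \<in> E \<Longrightarrow> runs B (enc x) (enc (b x)) (R n x)"
    using b by (rule ptimeE) blast
  obtain P S where PS: "polyb {(n, s) \<in> E. b s} S"
    and P: "\<And>n x. (n, x) \<in> {(n, s) \<in> E. b s} \<Longrightarrow> runs P (enc x) (enc (g x)) (S n x)"
    using g by (rule ptimeE) blast
  obtain i j where i: "\<And>n x. (n, x) \<in> E \<Longrightarrow> R n x \<le> (n + 2) ^ i"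
    and j: "\<And>n x. (n, x) \<in> E \<Longrightarrow> b x \<Longrightarrow> S n x \<le> (n + 2) ^ j"
    using BR PS unfolding polyb_def by blast
  \<comment> \<open>A round pays for the test, the body and the reading of the state; the last is at
    most the cost of the test, hence the factor 2.\<close>
  define T where "T n = 2 * (n + 2) ^ i + (n + 2) ^ j" for n :: nat
  have R: "R n x + bs x \<le> 2 * (n + 2) ^ i" if "(n, x) \<in> E" for n x
    using i[OF that] runs_bits_arg_le[OF B[OF that]] by simp
  have "\<exists>t \<le> (m n x + 1) * T n. runs (While B P) (enc x) (enc (F x)) t" if "(n, x) \<in> E" for n x
    using that
  proof (induction "m n x" arbitrary: x rule: less_induct)
    case less
    show ?case
    proof (cases "b x")
      case False
      have "R n x + bs x \<le> (m n x + 1) * T n"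
        using R[OF less(2)] by (auto simp: T_def)
      moreover have "runs (While B P) (enc x) (enc x) (R n x + bs x)"
        using B[OF less(2)] False by (intro runs.While_stop) simp
      ultimately show ?thesis using F[OF less(2)] False by auto
    next
      case True
      obtain u where u: "u \<le> (m n (g x) + 1) * T n" "runs (While B P) (enc (g x)) (enc (F (g x))) u"
        using less(1)[OF m[OF less(2) True] E[OF less(2) True]] by blast
      have "runs (While B P) (enc x) (enc (F (g x))) (R n x + S n x + u + bs x)"
        using B[OF less(2)] P less(2) u(2) True by (intro runs.While_step) auto
      moreover have "R n x + S n x + u + bs x \<le> T n + (m n (g x) + 1) * T n"
        using R[OF less(2)] j[OF less(2) True] u(1) by (simp add: T_def)
      moreover have "T n + (m n (g x) + 1) * T n \<le> (m n x + 1) * T n"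
        using m[OF less(2) True] mult_le_mono1[of "m n (g x) + 2" "m n x + 1" "T n"] by simp
      ultimately show ?thesis using F[OF less(2)] True by (metis le_trans)
    qed
  qed
  moreover have "polyb E (\<lambda>n x. (m n x + 1) * T n)"
    unfolding T_def by (intro polyb_intros mb)
  ultimately show ?thesis
    unfolding ptime_def by (intro exI conjI[of "polyb _ _"]) auto
qed

subsection \<open>Lists\<close>

lemma bs_tl_le: "bs (tl xs) \<le> bs xs"
  by (cases xs) auto

lemma bs_mem_le: "x \<in> set xs \<Longrightarrow> bs x \<le> bs xs"
  by (induction xs) auto

lemma length_le_bs: "length xs \<le> bs xs"
  by (induction xs) auto

lemma bs_list_le: "(\<And>x. x \<in> set xs \<Longrightarrow> bs x \<le> B) \<Longrightarrow> bs xs \<le> 1 + length xs * (B + 1)"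
proof (induction xs)
  case (Cons a xs)
  then have "bs xs \<le> 1 + length xs * (B + 1)" "bs a \<le> B" by auto
  then show ?case by simp
qed (simp add: floorlog_def)

text \<open>\<open>S n z ys s\<close> is an invariant of the accumulator \<open>s\<close> after the prefix \<open>ys\<close> has been processed;
  it has to bound the size of \<open>s\<close>.\<close>

lemma ptime_foldl_prefix:
  assumes i: "ptime D i" and xs: "ptime D xs"
    and S0: "\<And>n z. (n, z) \<in> D \<Longrightarrow> S n z [] (i z)"
    and S1: "\<And>n z s a ys zs. (n, z) \<in> D \<Longrightarrow> S n z ys s \<Longrightarrow> xs z = ys @ a # zs \<Longrightarrow> S n z (ys @ [a]) (g z s a)"
    and Sb: "polyb {(n, (z, ys, s)). (n, z) \<in> D \<and> (\<exists>zs. xs z = ys @ zs) \<and> S n z ys s} (\<lambda>n y. bs (snd (snd y)))"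
    and g: "bdd {(n, (z, s, a)). (n, z) \<in> D \<and> (\<exists>ys zs. xs z = ys @ a # zs \<and> S n z ys s)} \<Longrightarrow>
       ptime {(n, (z, s, a)). (n, z) \<in> D \<and> (\<exists>ys zs. xs z = ys @ a # zs \<and> S n z ys s)}
         (\<lambda>y. g (fst y) (fst (snd y)) (snd (snd y)))"
  shows "ptime D (\<lambda>z. foldl (g z) (i z) (xs z))"
proof -
  let ?L = "{(n, (z, s, a)). (n, z) \<in> D \<and> (\<exists>ys zs. xs z = ys @ a # zs \<and> S n z ys s)}"
  define E where "E = {(n, (z, s, zs)). (n, z) \<in> D \<and> (\<exists>ys. xs z = ys @ zs \<and> S n z ys s)}"
  define G where "G y = (fst y, g (fst y) (fst (snd y)) (hd (snd (snd y))), tl (snd (snd y)))" for y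
  \<comment> \<open>\<open>ptime_tailrec\<close> describes the whole final state, in which the
    remaining list is empty.\<close>
  define F where "F y = (fst y, foldl (g (fst y)) (fst (snd y)) (snd (snd y)), [] :: 'c list)" for y
  note z = ptime_bdd[OF i]
  have aux: "bdd H" if H: "\<And>n z s a. (n, (z, s, a)) \<in> H \<Longrightarrow>
      (n, z) \<in> D \<and> (\<exists>ys zs. xs z = ys @ zs \<and> S n z ys s) \<and> bs a \<le> bs (xs z)"
    for H :: "(nat \<times> 'a \<times> 'b \<times> 'x::enc) set"
  proof -
    have 1: "polyb H (\<lambda>n y. bs (fst y))"
      by (rule polyb_reindex[OF z[unfolded bdd_def]]) (use H in auto)
    have 2: "polyb H (\<lambda>n y. bs (fst (snd y)))"
      by (rule polyb_transfer[OF Sb]) (use H in fastforce)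
    have 3: "polyb H (\<lambda>n y. bs (xs (fst y)))"
      by (rule polyb_reindex[OF ptime_bs_le[OF xs]]) (use H in auto)
    show ?thesis unfolding bdd_def
    proof (rule polyb_mono)
      show "polyb H (\<lambda>n y. 2 + bs (fst y) + bs (fst (snd y)) + bs (xs (fst y)))"
        by (intro polyb_add polyb_const 1 2 3)
    qed (use H in \<open>auto simp: enc_prod_def\<close>)
  qed
  have suffix: "bs ys \<le> bs (zs @ ys)" for ys zs :: "'c list"
    by (induction zs) auto
  have bE: "bdd E"
    by (rule aux) (auto simp: E_def suffix)
  have bL: "bdd ?L"
    by (rule aux) (auto intro: bs_mem_le)
  have "ptime E F"
  proof (rule ptime_tailrec[where b = "\<lambda>y. snd (snd y) \<noteq> []" and g = G and m = "\<lambda>_ y. length (snd (snd y))"])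
    show "F y = (if snd (snd y) \<noteq> [] then F (G y) else y)" for y
    proof (cases "snd (snd y)")
      case Nil then show ?thesis by (cases y) (auto simp: F_def)
    next
      case (Cons a ys) then show ?thesis by (auto simp: F_def G_def)
    qed
    show "(n, G y) \<in> E" if *: "(n, y) \<in> E" "snd (snd y) \<noteq> []" for n y
    proof -
      obtain z s zs where y: "y = (z, s, zs)" by (cases y)
      obtain a as where zs: "zs = a # as" using * y by (cases zs) auto
      obtain ys where "(n, z) \<in> D" "xs z = ys @ a # as" "S n z ys s"
        using * unfolding E_def y zs by auto
      then have "xs z = (ys @ [a]) @ as \<and> S n z (ys @ [a]) (g z s a)" using S1 by simp
      then show ?thesis using \<open>(n, z) \<in> D\<close> unfolding E_def G_def y zs by (auto simp del: append_assoc)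
    qed
    show "length (snd (snd (G y))) < length (snd (snd y))" if "snd (snd y) \<noteq> []" for y
      using that by (auto simp: G_def)
    show "polyb E (\<lambda>n s. length (snd (snd s)))"
    proof (rule polyb_mono[OF bE[unfolded bdd_def]])
      fix n y assume "(n, y) \<in> E"
      show "length (snd (snd y)) \<le> bs y"
        using length_le_bs[of "snd (snd y)"] by (simp add: enc_prod_def)
    qed
    show "ptime E (\<lambda>y. snd (snd y) \<noteq> [])"
      by (intro ptime_not ptime_eq_Nil ptime_snd ptime_id bE)
    let ?E = "{(n, y) \<in> E. snd (snd y) \<noteq> []}"
    have b: "bdd ?E" by (rule bdd_subset[OF bE]) auto
    have "ptime ?E (\<lambda>y. (fst y, fst (snd y), hd (snd (snd y))))"
      by (intro ptime_Pair ptime_hd ptime_fst ptime_snd ptime_id b) auto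
    moreover have "(n, (fst y, fst (snd y), hd (snd (snd y)))) \<in> ?L" if *: "(n, y) \<in> ?E" for n y
      using * unfolding E_def by (cases "snd (snd y)") fastforce+
    ultimately have "ptime ?E (\<lambda>y. g (fst y) (fst (snd y)) (hd (snd (snd y))))"
      by (rule ptime_comp[OF _ g[OF bL], of ?E "\<lambda>y. (fst y, fst (snd y), hd (snd (snd y)))", unfolded fst_conv snd_conv])
    then show "ptime ?E G" unfolding G_def
      by (intro ptime_Pair ptime_tl ptime_fst ptime_snd ptime_id b) auto
  qed
  moreover have "ptime D (\<lambda>z. (z, i z, xs z))"
    by (intro ptime_Pair ptime_id z i xs)
  ultimately have "ptime D (\<lambda>z. F (z, i z, xs z))"
    by (intro ptime_comp[of D "\<lambda>z. (z, i z, xs z)" E F]) (auto simp: E_def S0)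
  then have "ptime D (\<lambda>z. fst (snd (F (z, i z, xs z))))"
    by (intro ptime_fst ptime_snd)
  then show ?thesis by (simp add: F_def)
qed

lemma ptime_foldl:
  assumes i: "ptime D i" and xs: "ptime D xs"
    and S0: "\<And>n z. (n, z) \<in> D \<Longrightarrow> S n z (i z)"
    and S1: "\<And>n z s a. (n, z) \<in> D \<Longrightarrow> S n z s \<Longrightarrow> a \<in> set (xs z) \<Longrightarrow> S n z (g z s a)"
    and Sb: "polyb {(n, (z, s)). (n, z) \<in> D \<and> S n z s} (\<lambda>n y. bs (snd y))"
    and g: "bdd {(n, (z, s, a)). (n, z) \<in> D \<and> S n z s \<and> a \<in> set (xs z)} \<Longrightarrow>
       ptime {(n, (z, s, a)). (n, z) \<in> D \<and> S n z s \<and> a \<in> set (xs z)} (\<lambda>y. g (fst y) (fst (snd y)) (snd (snd y)))"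
  shows "ptime D (\<lambda>z. foldl (g z) (i z) (xs z))"
proof (rule ptime_foldl_prefix[where S = "\<lambda>n z ys s. S n z s", OF i xs])
  show "polyb {(n, z, ys, s). (n, z) \<in> D \<and> (\<exists>zs. xs z = ys @ zs) \<and> S n z s} (\<lambda>n y. bs (snd (snd y)))"
    by (rule polyb_transfer[OF Sb]) fastforce
  have "{(n, (z, s, a)). (n, z) \<in> D \<and> (\<exists>ys zs. xs z = ys @ a # zs \<and> S n z s)}
      = {(n, (z, s, a)). (n, z) \<in> D \<and> S n z s \<and> a \<in> set (xs z)}"
    by (auto simp: in_set_conv_decomp)
  then show "ptime {(n, (z, s, a)). (n, z) \<in> D \<and> (\<exists>ys zs. xs z = ys @ a # zs \<and> S n z s)}
      (\<lambda>y. g (fst y) (fst (snd y)) (snd (snd y)))"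
    if "bdd {(n, (z, s, a)). (n, z) \<in> D \<and> (\<exists>ys zs. xs z = ys @ a # zs \<and> S n z s)}"
    using g that by simp
qed (use S0 S1 in auto)

lemma bs_list_eq: "bs xs = 1 + (\<Sum>x\<leftarrow>xs. bs x + 1)"
  by (induction xs) (auto simp: floorlog_def)

lemma bs_append: "bs (xs @ ys) + 1 = bs xs + bs ys"
  by (simp add: bs_list_eq)

lemma bs_rev [simp]: "bs (rev xs) = bs xs"
proof (induction xs)
  case (Cons x xs)
  then show ?case using bs_append[of "rev xs" "[x]"] by (simp add: floorlog_def)
qed simp

lemma bs_zip_le: "bs (zip xs ys) \<le> bs xs + bs ys"
proof (induction xs ys rule: list_induct2')
  case (4 x xs y ys)
  then show ?case by simp
qed (auto simp: floorlog_def)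

lemma bs_take_drop_le: "bs (take k xs) \<le> bs xs" "bs (drop k xs) \<le> bs xs"
  using bs_append[of "take k xs" "drop k xs"] bs_pos[of "take k xs"] bs_pos[of "drop k xs"] by auto

lemma bs_prefix_le: "xs = ys @ zs \<Longrightarrow> bs ys \<le> bs xs" "xs = ys @ zs \<Longrightarrow> bs zs \<le> bs xs"
  using bs_append[of ys zs] bs_pos[of ys] bs_pos[of zs] by auto

lemma ptime_rev:
  assumes xs: "ptime D xs"
  shows "ptime D (\<lambda>z. rev (xs z))"
proof -
  have "foldl (\<lambda>s a. a # s) ys as = rev as @ ys" for as ys :: "'b list"
    by (induction as arbitrary: ys) auto
  moreover have "ptime D (\<lambda>z. foldl (\<lambda>s a. a # s) [] (xs z))"
  proof (rule ptime_foldl_prefix[where S = "\<lambda>n z ys s. s = rev ys", OF ptime_Nil xs])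
    show "polyb {(n, z, ys, s). (n, z) \<in> D \<and> (\<exists>zs. xs z = ys @ zs) \<and> s = rev ys} (\<lambda>n y. bs (snd (snd y)))"
      by (rule polyb_transfer[OF ptime_bs_le[OF xs]]) (use bs_prefix_le(1) in fastforce)
  qed (auto intro!: ptime_Cons ptime_fst ptime_snd ptime_id ptime_bdd[OF xs])
  ultimately show ?thesis by simp
qed

lemma ptime_append:
  assumes xs: "ptime D xs" and ys: "ptime D ys"
  shows "ptime D (\<lambda>z. xs z @ ys z)"
proof -
  have "foldl (\<lambda>s a. a # s) bs as = rev as @ bs" for as bs :: "'b list"
    by (induction as arbitrary: bs) auto
  moreover have "ptime D (\<lambda>z. foldl (\<lambda>s a. a # s) (ys z) (rev (xs z)))"
  proof (rule ptime_foldl_prefix[where S = "\<lambda>n z as s. s = rev as @ ys z", OF ys ptime_rev[OF xs]])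
    have "polyb D (\<lambda>n z. bs (xs z) + bs (ys z))"
      by (intro polyb_add ptime_bs_le xs ys)
    then show "polyb {(n, z, as, s). (n, z) \<in> D \<and> (\<exists>zs. rev (xs z) = as @ zs) \<and> s = rev as @ ys z} (\<lambda>n y. bs (snd (snd y)))"
    proof (rule polyb_transfer)
      fix n y assume "(n, y) \<in> {(n, z, as, s). (n, z) \<in> D \<and> (\<exists>zs. rev (xs z) = as @ zs) \<and> s = rev as @ ys z}"
      then obtain z as zs where y: "y = (z, as, rev as @ ys z)" "(n, z) \<in> D" "rev (xs z) = as @ zs" by auto
      have "bs (rev as @ ys z) \<le> bs (xs z) + bs (ys z)"
        using bs_append[of "rev as" "ys z"] bs_prefix_le(1)[OF y(3)] by simp
      then show "\<exists>z. (n, z) \<in> D \<and> bs (snd (snd y)) \<le> bs (xs z) + bs (ys z)"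
        using y by auto
    qed
  qed (auto intro!: ptime_Cons ptime_fst ptime_snd ptime_id)
  ultimately show ?thesis by simp
qed

text \<open>The pairs \<open>(z, a)\<close> keep the parameter of \<open>z\<close>, so one exponent
  bounds all values \<open>g z a\<close>, and the accumulated list has polynomial size.\<close>

lemma ptime_map:
  assumes xs: "ptime D xs"
    and g: "bdd {(n, (z, a)). (n, z) \<in> D \<and> a \<in> set (xs z)} \<Longrightarrow>
      ptime {(n, (z, a)). (n, z) \<in> D \<and> a \<in> set (xs z)} (\<lambda>y. g (fst y) (snd y))"
  shows "ptime D (\<lambda>z. map (g z) (xs z))"
proof -
  let ?E = "{(n, (z, a)). (n, z) \<in> D \<and> a \<in> set (xs z)}"
  have "bdd ?E" unfolding bdd_def
  proof (rule polyb_transfer)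
    show "polyb D (\<lambda>n z. 1 + (bs z + bs (xs z)))"
      by (intro polyb_intros ptime_bs_le xs ptime_bdd[OF xs, unfolded bdd_def])
  next
    fix n y assume "(n, y) \<in> ?E"
    then have "(n, fst y) \<in> D" "bs (snd y) \<le> bs (xs (fst y))" by (auto intro: bs_mem_le)
    then show "\<exists>z. (n, z) \<in> D \<and> bs y \<le> 1 + (bs z + bs (xs z))"
      by (intro exI[of _ "fst y"]) (auto simp: enc_prod_def)
  qed
  note g = g[OF this]
  obtain k where k: "\<And>n z a. (n, z) \<in> D \<Longrightarrow> a \<in> set (xs z) \<Longrightarrow> bs (g z a) \<le> (n + 2) ^ k"
    using ptime_bs_le[OF g] unfolding polyb_def by fastforce
  have "foldl (\<lambda>s a. g z a # s) ys as = rev (map (g z) as) @ ys" for z as ys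
    by (induction as arbitrary: ys) auto
  moreover have "ptime D (\<lambda>z. foldl (\<lambda>s a. g z a # s) [] (xs z))"
  proof (rule ptime_foldl_prefix[where S = "\<lambda>n z ys s. s = rev (map (g z) ys)", OF ptime_Nil xs])
    have "polyb D (\<lambda>n z. 1 + bs (xs z) * ((n + 2) ^ k + 1))"
      by (intro polyb_intros ptime_bs_le xs)
    then show "polyb {(n, z, ys, s). (n, z) \<in> D \<and> (\<exists>zs. xs z = ys @ zs) \<and> s = rev (map (g z) ys)} (\<lambda>n y. bs (snd (snd y)))"
    proof (rule polyb_transfer)
      fix n y assume "(n, y) \<in> {(n, z, ys, s). (n, z) \<in> D \<and> (\<exists>zs. xs z = ys @ zs) \<and> s = rev (map (g z) ys)}"
      then obtain z ys zs where y: "y = (z, ys, rev (map (g z) ys))" "(n, z) \<in> D" "xs z = ys @ zs" by auto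
      have "bs (rev (map (g z) ys)) \<le> 1 + length ys * ((n + 2) ^ k + 1)"
        using bs_list_le[of "map (g z) ys"] k[OF y(2)] y(3) by auto
      also have "\<dots> \<le> 1 + bs (xs z) * ((n + 2) ^ k + 1)"
        using length_le_bs[of ys] bs_prefix_le(1)[OF y(3)] by (intro add_mono mult_mono) auto
      finally show "\<exists>z. (n, z) \<in> D \<and> bs (snd (snd y)) \<le> 1 + bs (xs z) * ((n + 2) ^ k + 1)"
        using y by auto
    qed
  next
    let ?H = "{(n, (z, s, a)). (n, z) \<in> D \<and> (\<exists>ys zs. xs z = ys @ a # zs \<and> s = rev (map (g z) ys))}"
    assume b: "bdd ?H"
    have "ptime ?H (\<lambda>y. (fst y, snd (snd y)))"
      by (intro ptime_Pair ptime_fst ptime_snd ptime_id b)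
    then have "ptime ?H (\<lambda>y. g (fst (fst y, snd (snd y))) (snd (fst y, snd (snd y))))"
      by (rule ptime_comp[OF _ g]) auto
    then show "ptime ?H (\<lambda>y. g (fst y) (snd (snd y)) # fst (snd y))"
      by (intro ptime_Cons ptime_fst ptime_snd ptime_id b) simp
  qed (auto intro: ptime_bdd[OF xs])
  then have "ptime D (\<lambda>z. rev (foldl (\<lambda>s a. g z a # s) [] (xs z)))" by (rule ptime_rev)
  ultimately show ?thesis by simp
qed

text \<open>The second list travels in the accumulator and loses its head at each element of the
  first; equal lengths keep it nonempty whenever its head is taken.\<close>

lemma ptime_zip:
  assumes xs: "ptime D xs" and ys: "ptime D ys" and len: "\<And>n z. (n, z) \<in> D \<Longrightarrow> length (xs z) = length (ys z)"
  shows "ptime D (\<lambda>z. zip (xs z) (ys z))"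
proof -
  let ?g = "\<lambda>s a. ((a, hd (snd s)) # fst s, tl (snd s))"
  have fold: "foldl ?g (acc, bs) as = (rev (zip as bs) @ acc, drop (length as) bs)"
    if "length as \<le> length bs" for acc and as :: "'b list" and bs :: "'c list"
    using that
  proof (induction as arbitrary: acc bs)
    case (Cons a as)
    then show ?case by (cases bs) auto
  qed auto
  have pt: "ptime D (\<lambda>z. foldl ?g ([], ys z) (xs z))"
  proof (rule ptime_foldl_prefix[where S = "\<lambda>n z as s. s = (rev (zip as (ys z)), drop (length as) (ys z))",
        OF ptime_Pair[OF ptime_Nil[OF ptime_bdd[OF xs]] ys] xs])
    have "polyb D (\<lambda>n z. 1 + ((bs (xs z) + bs (ys z)) + bs (ys z)))"
      by (intro polyb_intros ptime_bs_le xs ys)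
    then show "polyb {(n, z, as, s). (n, z) \<in> D \<and> (\<exists>zs. xs z = as @ zs) \<and>
        s = (rev (zip as (ys z)), drop (length as) (ys z))} (\<lambda>n y. bs (snd (snd y)))"
    proof (rule polyb_transfer)
      fix n y assume "(n, y) \<in> {(n, z, as, s). (n, z) \<in> D \<and> (\<exists>zs. xs z = as @ zs) \<and>
        s = (rev (zip as (ys z)), drop (length as) (ys z))}"
      then obtain z as zs where y: "y = (z, as, rev (zip as (ys z)), drop (length as) (ys z))"
        "(n, z) \<in> D" "xs z = as @ zs" by auto
      have "bs (snd (snd y)) \<le> 1 + ((bs (xs z) + bs (ys z)) + bs (ys z))"
        using bs_zip_le[of as "ys z"] bs_prefix_le(1)[OF y(3)] bs_take_drop_le(2)[of "length as" "ys z"] y(1) by simp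
      with y show "\<exists>z. (n, z) \<in> D \<and> bs (snd (snd y)) \<le> 1 + ((bs (xs z) + bs (ys z)) + bs (ys z))"
        by blast
    qed
    show "?g s a = (rev (zip (as @ [a]) (ys z)), drop (length (as @ [a])) (ys z))"
      if "(n, z) \<in> D" "s = (rev (zip as (ys z)), drop (length as) (ys z))" "xs z = as @ a # zs" for n z as s a zs
    proof -
      have l: "length as < length (ys z)" using len[OF that(1)] that(3) by simp
      then obtain c cs where "drop (length as) (ys z) = c # cs" by (metis Cons_nth_drop_Suc)
      then have "ys z = take (length as) (ys z) @ c # cs" by (metis append_take_drop_id)
      then obtain bs where "ys z = bs @ c # cs" "length bs = length as"
        using l by (metis length_take min.absorb4)
      moreover from this have "zip as (bs @ c # cs) = zip as bs"
        by (simp add: zip_append2)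
      ultimately show ?thesis using that(2) by simp
    qed
    let ?H = "{(n, (z, s, a)). (n, z) \<in> D \<and> (\<exists>as zs. xs z = as @ a # zs \<and>
        s = (rev (zip as (ys z)), drop (length as) (ys z)))}"
    assume b: "bdd ?H"
    have "snd (fst (snd y)) \<noteq> []" if "(n, y) \<in> ?H" for n y
      using that len by fastforce
    then show "ptime ?H (\<lambda>y. ((snd (snd y), hd (snd (fst (snd y)))) # fst (fst (snd y)), tl (snd (fst (snd y)))))"
      by (intro ptime_Pair ptime_Cons ptime_hd ptime_tl ptime_fst ptime_snd ptime_id b)
  qed auto
  have "ptime D (\<lambda>z. rev (fst (foldl ?g ([], ys z) (xs z))))"
    by (intro ptime_rev ptime_fst pt)
  then show ?thesis by (rule ptime_cong) (simp add: fold len)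
qed

lemma bs_nat_le: "bs (k::nat) \<le> k + 2"
proof -
  have "k < 2 ^ Suc k" using less_exp[of k] by (simp only: power_Suc)
  then have "floorlog 2 k \<le> Suc k" by (simp only: floorlog_2_le_iff)
  then show ?thesis by (simp add: enc_nat_def)
qed

text \<open>The number \<open>k z\<close> itself has to be polynomial in \<open>n\<close>, not only
  its bit length, since all smaller numbers are written down.\<close>

lemma ptime_upt:
  assumes k: "ptime D k" and kb: "polyb D (\<lambda>n z. k z)"
  shows "ptime D (\<lambda>z. [0..<k z])"
proof -
  obtain j where j: "\<And>n z. (n, z) \<in> D \<Longrightarrow> k z \<le> (n + 2) ^ j"
    using kb unfolding polyb_def by blast
  \<comment> \<open>The state counts down and does not contain the upper end \<open>K\<close> of the
    interval, which is only known to be polynomially bounded.\<close>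
  define E where "E = {(n, (i, acc)). \<exists>K \<le> (n + 2) ^ j. i \<le> K \<and> acc = [i..<K]}"
  define F where "F y = (0::nat, [0..<fst y] @ snd y)" for y
  define G where "G y = (fst y - 1, (fst y - 1) # snd y)" for y :: "nat \<times> nat list"
  have bE: "bdd E" unfolding bdd_def
  proof (rule polyb_mono)
    show "polyb E (\<lambda>n y. 1 + (((n + 2) ^ j + 2) + (1 + (n + 2) ^ j * (((n + 2) ^ j + 2) + 1))))"
      by (intro polyb_intros)
    fix n y assume "(n, y) \<in> E"
    then obtain i K where y: "y = (i, [i..<K])" and K: "K \<le> (n + 2) ^ j" "i \<le> K" unfolding E_def by auto
    have "bs [i..<K] \<le> 1 + length [i..<K] * ((K + 2) + 1)"
      by (rule bs_list_le) (use bs_nat_le in \<open>fastforce intro: order_trans\<close>)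
    also have "\<dots> \<le> 1 + (n + 2) ^ j * (((n + 2) ^ j + 2) + 1)"
      using K by (intro add_mono mult_mono) auto
    finally have 1: "bs [i..<K] \<le> \<dots>" .
    have "bs i \<le> (n + 2) ^ j + 2"
      using bs_nat_le[of i] K by linarith
    with 1 show "bs y \<le> 1 + (((n + 2) ^ j + 2) + (1 + (n + 2) ^ j * (((n + 2) ^ j + 2) + 1)))"
      unfolding y enc_Pair bits.simps(2) by linarith
  qed
  have "ptime E F"
  proof (rule ptime_tailrec[where b = "\<lambda>y. 0 < fst y" and g = G and m = "\<lambda>_. fst"])
    show "F y = (if 0 < fst y then F (G y) else y)" for y
    proof (cases "fst y")
      case 0 then show ?thesis by (cases y) (auto simp: F_def)
    qed (auto simp: F_def G_def)
    show "(n, G y) \<in> E" if yE: "(n, y) \<in> E" and pos: "0 < fst y" for n y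
    proof -
      obtain i K where y: "y = (i, [i..<K])" and K: "K \<le> (n + 2) ^ j" "i \<le> K"
        using yE unfolding E_def by auto
      have "(i - 1) # [i..<K] = [i - 1..<K]"
        using pos y K by (subst (2) upt_conv_Cons) auto
      then show ?thesis using K unfolding E_def G_def y by auto
    qed
    show "polyb E (\<lambda>n y. fst y)"
    proof (rule polyb_mono)
      show "polyb E (\<lambda>n y. (n + 2) ^ j)" by (intro polyb_intros)
    qed (auto simp: E_def)
    show "ptime E (\<lambda>y. 0 < fst y)"
      by (intro ptime_less ptime_nat ptime_fst ptime_id bE)
    show "ptime {(n, y) \<in> E. 0 < fst y} G" unfolding G_def
      by (intro ptime_Pair ptime_Cons ptime_minus ptime_nat ptime_fst ptime_snd ptime_id bdd_subset[OF bE]) auto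
  qed (auto simp: G_def)
  moreover have "ptime D (\<lambda>z. (k z, []))"
    by (intro ptime_Pair ptime_Nil k ptime_bdd[OF k])
  ultimately have "ptime D (\<lambda>z. F (k z, []))"
    using j by (intro ptime_comp[of D "\<lambda>z. (k z, [])" E F]) (fastforce simp: E_def)+
  then have "ptime D (\<lambda>z. snd (F (k z, [])))" by (rule ptime_snd)
  then show ?thesis by (simp add: F_def)
qed

section \<open>Roots of unity in finite fields\<close>

locale finite_field = field K for K (structure) +
  assumes finite_carrier: "finite (carrier K)"
begin

text \<open>HOL-Algebra defines \<open>mult_of\<close> twice; the lemmas on orders use the other one than the problem statement.\<close>

abbreviation "Kx \<equiv> Multiplicative_Group.mult_of K"

lemma mult_of_eq_Kx: "mult_of K = Kx"
  by (simp add: Multiplicative_Group.mult_of_def Ring_Divisibility.mult_of_def)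

sublocale mult: comm_group Kx
  rewrites "mult Kx = (\<otimes>)" and "one Kx = \<one>"
    and "([^]\<^bsub>Kx\<^esub>) = (([^]) :: _ \<Rightarrow> nat \<Rightarrow> _)"
proof -
  show "comm_group Kx"
    using units_comm_group by (simp add: mult_of_is_Units)
qed (simp_all add: Multiplicative_Group.nat_pow_mult_of)

definition N :: nat where "N = order Kx"

lemma N_pos: "N > 0"
  unfolding N_def by (simp add: mult.order_gt_0_iff_finite finite_carrier)

section \<open>Roots and powers in the group of units\<close>

lemma pow_N: "x \<in> carrier K \<Longrightarrow> x \<noteq> \<zero> \<Longrightarrow> x [^] N = \<one>"
  unfolding N_def using mult.pow_order_eq_1[of x] by simp

lemma zero_pow: "0 < (n::nat) \<Longrightarrow> \<zero> [^] n = \<zero>"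
  using nat_pow_zero by auto

lemma pow_nonzero [simp]: "x \<in> carrier K \<Longrightarrow> x \<noteq> \<zero> \<Longrightarrow> x [^] (n::nat) \<noteq> \<zero>"
  using mult.nat_pow_closed[of x n] by simp

text \<open>Writing \<open>b\<close> as a power \<open>g ^ i\<close> of a generator turns the
  hypothesis into \<open>r dvd i\<close>. Only existence is obtained: the root describes the
  components of \<open>R\<close> in the proof, and the algorithm never has it.\<close>

lemma ex_root:
  assumes "r dvd N" and b: "b \<in> carrier K" "b \<noteq> \<zero>" "b [^] (N div r) = \<one>"
  shows "\<exists>a\<in>carrier K. a \<noteq> \<zero> \<and> a [^] r = b"
proof -
  have r: "0 < r" using assms(1) N_pos by (auto intro: Nat.gr0I)
  obtain g where g: "g \<in> carrier Kx" and gen: "carrier Kx = {g [^] i | i::nat. i \<in> UNIV}"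
    by (rule bexE[OF finite_field_mult_group_has_gen[OF finite_carrier]]) (rule that)
  have fin: "finite (carrier Kx)" using finite_carrier by simp
  have "mult.ord g = N"
    using mult.generate_pow_on_finite_carrier[OF fin g] gen mult.generate_pow_card[OF g]
    by (simp add: N_def order_def)
  obtain i where i: "b = g [^] (i::nat)" using b(1,2) gen by auto
  have "g [^] (i * (N div r)) = \<one>"
    using b(3) g unfolding i by (simp add: nat_pow_pow)
  then have "N dvd i * (N div r)"
    using mult.pow_eq_id[OF g] \<open>mult.ord g = N\<close> by simp
  then have "(N div r) * r dvd (N div r) * i"
    using assms(1) by (simp add: mult.commute)
  moreover have "N div r \<noteq> 0" using assms(1) N_pos r by (auto simp: dvd_div_eq_0_iff)
  ultimately have "r dvd i" by simp
  then have "(g [^] (i div r)) [^] r = b"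
    using g i by (simp add: nat_pow_pow)
  moreover have "g [^] (i div r) \<in> carrier Kx" using mult.nat_pow_closed[OF g] .
  ultimately show ?thesis by auto
qed

text \<open>The \<open>z\<close> distinct powers of \<open>zeta\<close> are roots of
  \<open>X ^ z - 1\<close>, which has at most \<open>z\<close> roots. So comparing with the powers
  of one known root of unity is exhaustive.\<close>

lemma root_of_unity_is_power:
  assumes z: "zeta \<in> carrier Kx" "mult.ord zeta = z" "0 < z" and x: "x \<in> carrier K" "x [^] z = \<one>"
  shows "\<exists>k<z. x = zeta [^] k"
proof -
  let ?A = "(\<lambda>k. zeta [^] k) ` {0..mult.ord zeta - 1}"
  let ?B = "{x \<in> carrier K. x [^] z = \<one>}"
  have fin: "finite (carrier Kx)" using finite_carrier by simp
  have "inj_on (\<lambda>k. zeta [^] k) {0..mult.ord zeta - 1}"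
    by (rule mult.ord_inj[OF z(1)])
  then have "card ?A = z" using z by (simp add: card_image)
  moreover have "?A \<subseteq> ?B"
  proof
    fix y assume "y \<in> ?A"
    then obtain k where y: "y = zeta [^] (k::nat)" by auto
    have "y [^] z = (zeta [^] z) [^] k" using z by (simp add: y nat_pow_pow mult.commute)
    also have "zeta [^] z = \<one>" using mult.pow_ord_eq_1[OF z(1)] z(2) by simp
    finally show "y \<in> ?B" using z(1) y by simp
  qed
  moreover have "card ?B \<le> z" using num_roots_le_deg[OF finite_carrier, of z] z(3) by simp
  moreover have "finite ?B" using finite_carrier by simp
  ultimately have "?A = ?B" by (intro card_seteq) auto
  then have "x \<in> ?A" using x by auto
  then obtain k where "k \<le> z - 1" "x = zeta [^] k" using z(2) by auto
  then show ?thesis using z(3) by (intro exI[of _ k]) auto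
qed

lemma dvd_N_iff_ord: "g \<in> carrier Kx \<Longrightarrow> mult.ord g dvd N"
  unfolding N_def by (rule mult.ord_dvd_group_order)

lemma pow_coprime_eq_one:
  assumes "x \<in> carrier Kx" "x [^] a = \<one>" "x [^] b = \<one>" "coprime a (b::nat)"
  shows "x = \<one>"
proof -
  have "mult.ord x dvd gcd a b" using assms(2,3) mult.pow_eq_id[OF assms(1)] by simp
  then show ?thesis using assms(1,4) mult.ord_eq_1 by simp
qed

text \<open>Elements of \<open>R\<close> are described by their values at the components, written as
  sequences of period \<open>r\<close> on all naturals: conjugation is then a shift of the index,
  and the norm is \<open>nprod\<close> over one period.\<close>

primrec nprod :: "(nat \<Rightarrow> 'a) \<Rightarrow> nat \<Rightarrow> 'a" where
  "nprod f 0 = \<one>"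
| "nprod f (Suc n) = nprod f n \<otimes> f n"

primrec nsum :: "(nat \<Rightarrow> 'a) \<Rightarrow> nat \<Rightarrow> 'a" where
  "nsum f 0 = \<zero>"
| "nsum f (Suc n) = nsum f n \<oplus> f n"

lemma nprod_closed [simp]: "(\<And>i. f i \<in> carrier K) \<Longrightarrow> nprod f n \<in> carrier K"
  by (induction n) auto

lemma nsum_closed [simp]: "(\<And>i. f i \<in> carrier K) \<Longrightarrow> nsum f n \<in> carrier K"
  by (induction n) auto

lemma nprod_nonzero [simp]: "(\<And>i. f i \<in> carrier K) \<Longrightarrow> (\<And>i. f i \<noteq> \<zero>) \<Longrightarrow> nprod f n \<noteq> \<zero>"
  by (induction n) (auto simp: integral_iff)

lemma nprod_mult:
  "(\<And>i. f i \<in> carrier K) \<Longrightarrow> (\<And>i. g i \<in> carrier K) \<Longrightarrow> nprod (\<lambda>i. f i \<otimes> g i) n = nprod f n \<otimes> nprod g n"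
  by (induction n) (auto simp: m_ac)

lemma nprod_pow:
  "(\<And>i. f i \<in> carrier K) \<Longrightarrow> nprod (\<lambda>i. f i [^] (k::nat)) n = nprod f n [^] k"
  by (induction n) (auto simp: nat_pow_distrib)

lemma nprod_shift:
  assumes f: "\<And>i. f i \<in> carrier K"
  shows "f 0 \<otimes> nprod (\<lambda>i. f (Suc i)) n = nprod f n \<otimes> f n"
proof (induction n)
  case (Suc n)
  have "f 0 \<otimes> nprod (\<lambda>i. f (Suc i)) (Suc n) = (f 0 \<otimes> nprod (\<lambda>i. f (Suc i)) n) \<otimes> f (Suc n)"
    using f by (simp add: m_assoc)
  then show ?case unfolding Suc by simp
qed (use f in simp)

text \<open>Moving the window by one replaces the factor \<open>f i\<close> by the equal factor
  \<open>f (i + r)\<close>. This is the invariance of the norm under conjugation.\<close>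

lemma nprod_rotate:
  assumes f: "\<And>i. f i \<in> carrier K" "\<And>i. f (i + r) = f i" "\<And>i. f i \<noteq> \<zero>"
  shows "nprod (\<lambda>k. f (i + k)) r = nprod f r"
proof (induction i)
  case (Suc i)
  have "f i \<otimes> nprod (\<lambda>k. f (i + Suc k)) r = nprod (\<lambda>k. f (i + k)) r \<otimes> f (i + r)"
    using nprod_shift[of "\<lambda>k. f (i + k)" r] f by simp
  then have "f i \<otimes> nprod (\<lambda>k. f (i + Suc k)) r = f i \<otimes> nprod f r"
    using Suc f by (simp add: m_comm)
  then show ?case using f by (simp add: m_lcancel)
qed simp

text \<open>The easy half of Hilbert 90: the norm is multiplicative and invariant under conjugation,
  so it is 1 on the quotient of an element by its conjugate.\<close>

lemma nprod_quotient:
  assumes w: "\<And>i. w i \<in> carrier K" "\<And>i. w i \<noteq> \<zero>" "\<And>i. w (i + r) = w i"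
    and u: "\<And>i. u i \<in> carrier K" "\<And>i. u i \<otimes> w (Suc i) = w i"
  shows "nprod u r = \<one>"
proof -
  have "nprod u r \<otimes> nprod (\<lambda>i. w (Suc i)) r = nprod w r"
    using nprod_mult[of u "\<lambda>i. w (Suc i)" r] u w by simp
  also have "nprod (\<lambda>i. w (Suc i)) r = nprod w r"
    using nprod_rotate[of w r 1] w by simp
  finally have "nprod u r \<otimes> nprod w r = \<one> \<otimes> nprod w r" using w by simp
  then show ?thesis using w u by (subst (asm) m_rcancel) auto
qed

lemma periodic_mod:
  assumes "\<And>i. f (i + r) = f (i::nat)"
  shows "f (i mod r) = f i"
proof -
  have "f (i + k * r) = f i" for i k
  proof (induction k)
    case (Suc k)
    then show ?case using assms[of "i + k * r"] by (simp add: algebra_simps)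
  qed simp
  from this[of "i mod r" "i div r"] show ?thesis by simp
qed

text \<open>A nonconstant periodic sequence \<open>v\<close> with product 1 whose \<open>l\<close>-th powers are constant: unless the
  quotients of neighbours are nonconstant roots of unity of order \<open>l\<close>, the sequence is geometric, hence \<open>l = r\<close>,
  and its product shows that its own elements are roots of unity, of order 4 if \<open>r = 2\<close>.\<close>

lemma nonconstant_roots_of_unity:
  assumes v: "\<And>i. v i \<in> carrier K" "\<And>i. v i \<noteq> \<zero>" "\<And>i. v (i + r) = v i" and prod: "nprod v r = \<one>"
    and r: "Factorial_Ring.prime r" and l: "Factorial_Ring.prime l"
    and c: "\<And>i. v i [^] l = v 0 [^] l" and nonconst: "v i0 \<noteq> v 0"
    and d: "\<And>i. d i \<in> carrier K" "\<And>i. d i \<otimes> v (Suc i) = v i"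
  shows "(\<forall>i. d i [^] l = \<one>) \<and> (\<exists>i. d i \<noteq> d 0) \<or> (\<forall>i. v i [^] root_order l = \<one>)"
proof (cases "\<exists>i. d i \<noteq> d 0")
  case True
  have "d i [^] l = \<one>" for i
  proof -
    have "d i [^] l \<otimes> v (Suc i) [^] l = v i [^] l"
      using d v by (simp flip: nat_pow_distrib)
    then have "d i [^] l \<otimes> v 0 [^] l = \<one> \<otimes> v 0 [^] l"
      using c[of i] c[of "Suc i"] v by simp
    then show ?thesis using d v by (subst (asm) m_rcancel) auto
  qed
  with True show ?thesis by blast
next
  case False
  \<comment> \<open>In the remaining case all quotients of neighbours equal \<open>D\<close>, so
    that \<open>v\<close> is geometric.\<close>
  define D where "D = d 0"
  have dD: "d i = D" for i using False by (auto simp: D_def)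
  have D: "D \<in> carrier K" using d by (simp add: D_def)
  have Dv: "D \<otimes> v (Suc i) = v i" for i using d(2)[of i] dD by simp
  have D0: "D \<noteq> \<zero>"
  proof
    assume "D = \<zero>"
    then have "v 0 = \<zero>" using Dv[of 0] v(1)[of "Suc 0"] by simp
    then show False using v(2)[of 0] by simp
  qed
  have geo: "v 0 = D [^] i \<otimes> v i" for i
  proof (induction i)
    case (Suc i)
    then show ?case using Dv[of i] D v by (simp add: m_assoc)
  qed (use v in simp)
  have pow: "D [^] k = \<one>" if "v 0 [^] j = (D [^] k) \<otimes> v 0 [^] j" for j k :: nat
  proof -
    have "D [^] k \<otimes> v 0 [^] j = \<one> \<otimes> v 0 [^] j" using that v by simp
    then show ?thesis using D v by (subst (asm) m_rcancel) auto
  qed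
  \<comment> \<open>Going once around the period multiplies by \<open>D ^ r\<close> and returns to
    \<open>v 0\<close>.\<close>
  have Dr: "D [^] r = \<one>"
  proof (rule pow[of 1])
    show "v 0 [^] (1::nat) = D [^] r \<otimes> v 0 [^] (1::nat)"
      using geo[of r] v(1)[of 0] v(3)[of 0] by simp
  qed
  \<comment> \<open>The \<open>l\<close>-th powers of \<open>v 0\<close>, which is \<open>D\<close>
    times \<open>v 1\<close>, and of \<open>v 1\<close> agree.\<close>
  have Dl: "D [^] l = \<one>"
  proof (rule pow[of l])
    have "v 0 [^] l = (D \<otimes> v 1) [^] l" using geo[of 1] D by simp
    also have "\<dots> = D [^] l \<otimes> v 0 [^] l" using D v c[of 1] by (simp add: nat_pow_distrib)
    finally show "v 0 [^] l = D [^] l \<otimes> v 0 [^] l" .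
  qed
  have D1: "D \<noteq> \<one>" using geo[of i0] nonconst v by auto
  have "l = r"
  proof (rule ccontr)
    assume "l \<noteq> r"
    then have "coprime l r" using r l by (simp add: primes_coprime)
    then show False using pow_coprime_eq_one[of D l r] D D0 D1 Dl Dr by simp
  qed
  \<comment> \<open>Multiplying the relations of \<open>geo\<close> over all \<open>i < m\<close>
    produces the exponent \<open>0 + 1 + ... + (m - 1)\<close>. For \<open>m = r\<close> the product
    of the \<open>v i\<close> is 1.\<close>
  have gauss: "v 0 [^] m = D [^] (m * (m - 1) div 2) \<otimes> nprod v m" for m
  proof (induction m)
    case (Suc m)
    have e: "m * (m - 1) div 2 + m = Suc m * (Suc m - 1) div 2"
      by (cases m) (auto simp: algebra_simps)
    have "v 0 [^] Suc m = (D [^] (m * (m - 1) div 2) \<otimes> nprod v m) \<otimes> (D [^] m \<otimes> v m)"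
      using Suc geo[of m] by simp
    also have "\<dots> = (D [^] (m * (m - 1) div 2) \<otimes> D [^] m) \<otimes> nprod v (Suc m)"
      using D v by (simp add: m_ac)
    finally show ?case using D e by (simp add: nat_pow_mult)
  qed simp
  have v0: "v 0 [^] r = D [^] (r * (r - 1) div 2)"
    using gauss[of r] prod D by simp
  show ?thesis
  proof (cases "r = 2")
    case True
    \<comment> \<open>Here the exponent in \<open>gauss\<close> is 1: the square of
      \<open>v 0\<close> is \<open>D\<close>, and only the next squaring gives 1.\<close>
    have "v i [^] (4::nat) = \<one>" for i
    proof -
      have "v i [^] (4::nat) = (v i [^] l) [^] (2::nat)" using v True \<open>l = r\<close> by (simp add: nat_pow_pow)
      also have "\<dots> = (v 0 [^] r) [^] (2::nat)" using c[of i] \<open>l = r\<close> by simp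
      also have "\<dots> = D [^] r" using v0 True D by (simp add: nat_pow_pow)
      finally show ?thesis using Dr by simp
    qed
    then show ?thesis using True \<open>l = r\<close> by (simp add: root_order_def)
  next
    case False
    then have "odd r" using r prime_odd_nat prime_ge_2_nat[OF r] by force
    \<comment> \<open>For odd \<open>r\<close> the exponent in \<open>gauss\<close> is a multiple of
      \<open>r\<close>.\<close>
    then have "r * (r - 1) div 2 = r * ((r - 1) div 2)" by (elim oddE) simp
    then have "v 0 [^] r = \<one>" using v0 D Dr by (simp flip: nat_pow_pow)
    then have "v i [^] r = \<one>" for i using c[of i] \<open>l = r\<close> by simp
    then show ?thesis using False \<open>l = r\<close> by (simp add: root_order_def)
  qed
qed

text \<open>The power \<open>y ^ (N - 1)\<close> is the inverse of \<open>y\<close>. In this form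
  division can be carried out in the quotient ring, in all components at once and without a
  Euclidean algorithm.\<close>

lemma quotient_pow:
  assumes "x \<in> carrier K" "y \<in> carrier K" "y \<noteq> \<zero>"
  shows "(x \<otimes> y [^] (N - 1)) \<otimes> y = x"
proof -
  have "y [^] (N - 1) \<otimes> y = y [^] N"
    using N_pos by (cases N) auto
  then show ?thesis using assms pow_N by (simp add: m_assoc)
qed

text \<open>The situation in which the order of \<open>b\<close>, a power \<open>s\<close> of \<open>r\<close>, is to be raised; \<open>a\<close> is an
  \<open>r\<close>-th root of \<open>b\<close>, and the conjugates of \<open>a\<close> are the points \<open>x i\<close>.\<close>

definition root_step :: "nat \<Rightarrow> nat \<Rightarrow> 'a \<Rightarrow> bool" where
  "root_step r s b \<longleftrightarrow> Factorial_Ring.prime r \<and> (\<exists>k>0. s = r ^ k) \<and> b \<in> carrier K \<and>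
     b [^] s = \<one> \<and> b [^] (s div r) \<noteq> \<one>"

lemma root_stepD:
  assumes "root_step r s b"
  shows "Factorial_Ring.prime r" "r dvd s" "s > 0" "b \<in> carrier K" "b \<noteq> \<zero>" "b [^] s = \<one>" "b [^] (s div r) \<noteq> \<one>"
    "b [^] (s div r) \<in> carrier K" "b [^] (s div r) \<noteq> \<zero>" "(b [^] (s div r)) [^] r = \<one>"
proof -
  show r: "Factorial_Ring.prime r" and b: "b \<in> carrier K" "b [^] s = \<one>" "b [^] (s div r) \<noteq> \<one>"
    using assms by (auto simp: root_step_def)
  show s: "r dvd s" "s > 0"
    using assms prime_gt_0_nat[OF r] by (auto simp: root_step_def)
  show "b \<noteq> \<zero>" using b(2) zero_pow[OF s(2)] by auto
  then show "b [^] (s div r) \<in> carrier K" "b [^] (s div r) \<noteq> \<zero>" using b by auto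
  show "(b [^] (s div r)) [^] r = \<one>" using b s by (simp add: nat_pow_pow)
qed

context
  fixes r s b a rho and x :: "nat \<Rightarrow> 'a"
  assumes step: "root_step r s b" and a: "a \<in> carrier K" "a [^] r = b"
  defines "rho \<equiv> b [^] (s div r)" and "x \<equiv> \<lambda>i. a \<otimes> rho [^] i"
begin

lemma rho: "rho \<in> carrier K" "rho \<noteq> \<zero>" "rho \<noteq> \<one>" "rho [^] r = \<one>"
  using root_stepD[OF step] by (auto simp: rho_def)

lemma a_nonzero: "a \<noteq> \<zero>"
  using a root_stepD[OF step] zero_pow[of r] prime_gt_0_nat by auto

lemma x_closed: "x i \<in> carrier K" and x_nonzero: "x i \<noteq> \<zero>" and x_Suc: "x (Suc i) = rho \<otimes> x i"
  and x_periodic: "x (i + r) = x i" and x_pow_r: "x i [^] r = b"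
proof -
  note [simp] = rho a a_nonzero
  show "x i \<in> carrier K" "x i \<noteq> \<zero>" by (auto simp: x_def integral_iff)
  show "x (Suc i) = rho \<otimes> x i" by (simp add: x_def m_ac)
  show "x (i + r) = x i" by (simp add: x_def flip: nat_pow_mult)
  have "(rho [^] i) [^] r = (rho [^] r) [^] i" by (simp add: nat_pow_pow mult.commute del: rho(4))
  then show "x i [^] r = b" using root_stepD(4)[OF step] by (simp add: x_def nat_pow_distrib)
qed

text \<open>Raising to the \<open>s\<close>-th power is raising to the \<open>r\<close>-th, which
  gives \<open>b\<close>, and then to \<open>s div r\<close>. As the result is the same for all
  points, the product of \<open>t\<close> of them has the \<open>s\<close>-th power
  \<open>rho ^ t\<close>.\<close>

lemma x_pow_s: "x i [^] s = rho"
proof -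
  have "x i [^] s = (x i [^] r) [^] (s div r)"
    using root_stepD[OF step] x_closed by (simp add: nat_pow_pow)
  then show ?thesis by (simp add: x_pow_r rho_def)
qed

text \<open>Otherwise the square of \<open>x i\<close> is 1. For \<open>r = 2\<close> this
  contradicts \<open>x_pow_s\<close>, since \<open>s\<close> is even; for odd \<open>r\<close> it
  makes the square of \<open>rho\<close> equal to 1. Hence \<open>1 + X\<close> is a unit of
  \<open>R\<close> and can be divided by its conjugate.\<close>

lemma one_plus_x_nonzero: "\<one> \<oplus> x i \<noteq> \<zero>"
proof
  assume "\<one> \<oplus> x i = \<zero>"
  then have "x i = \<ominus> \<one>" using x_closed[of i] by (metis minus_equality a_comm one_closed)
  then have sq: "x i [^] (2::nat) = \<one>" by (simp add: numeral_2_eq_2 l_minus r_minus)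
  note r = root_stepD(1)[OF step]
  show False
  proof (cases "r = 2")
    case True
    then have "x i [^] s = (x i [^] (2::nat)) [^] (s div 2)"
      using root_stepD[OF step] x_closed by (simp add: nat_pow_pow)
    then show False using sq x_pow_s rho by simp
  next
    case False
    then have "coprime 2 r" using r by (metis primes_coprime two_is_prime_nat)
    moreover have "rho [^] (2::nat) = \<one>"
      using sq x_closed by (simp flip: x_pow_s[of i] add: nat_pow_pow mult.commute)
         (metis nat_pow_one nat_pow_pow mult.commute x_closed)
    ultimately show False using pow_coprime_eq_one[of rho 2 r] rho by simp
  qed
qed

text \<open>If \<open>d\<close> is both of the first two quotients, subtracting the two equations
  and cancelling the difference of \<open>x 1\<close> and \<open>x 0\<close> shows that
  \<open>d\<close> is inverse to \<open>rho\<close>. The first equation then reads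
  \<open>d + x 0 = 1 + x 0\<close>, so that \<open>d\<close> and \<open>rho\<close> would be
  1.\<close>

lemma quotients_nonconstant:
  assumes u: "\<And>i. u i \<in> carrier K" "\<And>i. u i \<otimes> (\<one> \<oplus> x (Suc i)) = \<one> \<oplus> x i"
  shows "u 1 \<noteq> u 0"
proof
  note [simp] = rho a a_nonzero x_closed u(1)
  define d where "d = u 0"
  have d [simp]: "d \<in> carrier K" by (simp add: d_def)
  assume "u 1 = u 0"
  then have 1: "d \<otimes> (\<one> \<oplus> x 1) = \<one> \<oplus> x 0" and 2: "d \<otimes> (\<one> \<oplus> x 2) = \<one> \<oplus> x 1"
    using u(2)[of 0] u(2)[of 1] by (auto simp: d_def numeral_2_eq_2)
  have "d \<otimes> rho \<otimes> (x 1 \<ominus> x 0) = d \<otimes> x 2 \<ominus> d \<otimes> x 1"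
  proof -
    have x2: "x 2 = rho \<otimes> x 1" "x 1 = rho \<otimes> x 0" using x_Suc[of 0] x_Suc[of 1] by (simp_all add: numeral_2_eq_2)
    have "d \<otimes> rho \<otimes> (x 1 \<ominus> x 0) = d \<otimes> (rho \<otimes> x 1) \<ominus> d \<otimes> (rho \<otimes> x 0)"
      using x_closed[of 1] x_closed[of 0] d rho(1) by algebra
    then show ?thesis by (simp only: x2(1)[symmetric] x2(2)[symmetric])
  qed
  also have "\<dots> = d \<otimes> (\<one> \<oplus> x 2) \<ominus> d \<otimes> (\<one> \<oplus> x 1)"
    using x_closed[of 2] x_closed[of 1] d by algebra
  also have "\<dots> = \<one> \<otimes> (x 1 \<ominus> x 0)"
    unfolding 1 2 using x_closed[of 1] x_closed[of 0] by algebra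
  finally have *: "d \<otimes> rho \<otimes> (x 1 \<ominus> x 0) = \<one> \<otimes> (x 1 \<ominus> x 0)" .
  have "x 1 \<noteq> x 0"
  proof
    assume "x 1 = x 0"
    then have "rho \<otimes> x 0 = \<one> \<otimes> x 0" using x_Suc[of 0] by simp
    then show False using x_nonzero[of 0] by (subst (asm) m_rcancel) auto
  qed
  then have "d \<otimes> rho = \<one>"
    using * by (subst (asm) m_rcancel) auto
  moreover have "d \<otimes> (\<one> \<oplus> x 1) = d \<oplus> (d \<otimes> rho) \<otimes> x 0"
  proof -
    have "d \<otimes> (\<one> \<oplus> rho \<otimes> x 0) = d \<oplus> (d \<otimes> rho) \<otimes> x 0"
      using x_closed[of 0] rho(1) d by algebra
    then show ?thesis using x_Suc[of 0] by simp
  qed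
  ultimately have "d \<oplus> x 0 = \<one> \<oplus> x 0" using 1 by simp
  then have "d = \<one>" by (subst (asm) add.r_cancel) auto
  with \<open>d \<otimes> rho = \<one>\<close> show False by simp
qed

text \<open>The \<open>s\<close>-th power of the product is \<open>rho ^ t\<close>, where
  \<open>t\<close> is the number of selected points. A proper nonempty selection has
  \<open>0 < t < r\<close>, so \<open>t\<close> is prime to \<open>r\<close>, and this power is a
  nontrivial \<open>r\<close>-th root of unity.\<close>

lemma selected_product:
  assumes P: "i < r" "P i" "j < r" "\<not> P j"
  defines "c \<equiv> nprod (\<lambda>k. if P k then x k else \<one>) r"
  shows "c \<in> carrier K" "c [^] s \<noteq> \<one>" "c [^] (s * r) = \<one>"
proof -
  note [simp] = rho a a_nonzero x_closed
  \<comment> \<open>\<open>t\<close> counts the selected indices. The two implications record just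
    what excludes its extreme values at \<open>m = r\<close>.\<close>
  have "\<exists>t\<le>m. (t = 0 \<longrightarrow> (\<forall>k<m. \<not> P k)) \<and> (t = m \<longrightarrow> (\<forall>k<m. P k)) \<and>
      nprod (\<lambda>k. if P k then x k else \<one>) m [^] s = rho [^] t" for m
  proof (induction m)
    case (Suc m)
    then obtain t where t: "t \<le> m" "t = 0 \<longrightarrow> (\<forall>k<m. \<not> P k)" "t = m \<longrightarrow> (\<forall>k<m. P k)"
      "nprod (\<lambda>k. if P k then x k else \<one>) m [^] s = rho [^] t" by blast
    show ?case
    proof (cases "P m")
      case True
      have "nprod (\<lambda>k. if P k then x k else \<one>) (Suc m) [^] s = rho [^] t \<otimes> rho"
        using True t(4) x_pow_s[of m] by (simp add: nat_pow_distrib)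
      then show ?thesis using t True by (intro exI[of _ "Suc t"]) (auto simp: less_Suc_eq)
    next
      case False
      then show ?thesis using t by (intro exI[of _ t]) (auto simp: less_Suc_eq)
    qed
  qed simp
  from this[of r] obtain t where t: "t \<le> r" "t \<noteq> 0" "t \<noteq> r" "c [^] s = rho [^] t"
    using P unfolding c_def by blast
  show c: "c \<in> carrier K" unfolding c_def by simp
  have "\<not> r dvd t" using t by (auto dest: dvd_imp_le)
  then have "coprime t r"
    using root_stepD(1)[OF step] by (simp add: coprime_commute prime_imp_coprime)
  then show "c [^] s \<noteq> \<one>" using t(4) pow_coprime_eq_one[of rho t r] by auto
  have "(c [^] s) [^] r = (rho [^] r) [^] t" unfolding t(4) by (simp add: nat_pow_pow mult.commute del: rho(4))
  then show "c [^] (s * r) = \<one>" using c by (simp add: nat_pow_pow)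
qed

lemma geometric_nsum:
  assumes "y \<in> carrier K"
  shows "(y \<ominus> \<one>) \<otimes> nsum (\<lambda>i. y [^] i) m = y [^] m \<ominus> \<one>"
proof (induction m)
  case 0
  show ?case using assms by (simp add: a_minus_def r_neg)
next
  case (Suc m)
  have [simp]: "nsum (\<lambda>i. y [^] i) m \<in> carrier K" "y [^] m \<in> carrier K" using assms by auto
  have "(y \<ominus> \<one>) \<otimes> nsum (\<lambda>i. y [^] i) (Suc m) = (y \<ominus> \<one>) \<otimes> nsum (\<lambda>i. y [^] i) m \<oplus> (y \<ominus> \<one>) \<otimes> y [^] m"
    using assms by (simp add: r_distr)
  also have "\<dots> = y [^] m \<otimes> y \<ominus> \<one>"
    unfolding Suc using assms \<open>y [^] m \<in> carrier K\<close> by algebra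
  finally show ?case by simp
qed

lemma nsum_add:
  "(\<And>i. f i \<in> carrier K) \<Longrightarrow> (\<And>i. g i \<in> carrier K) \<Longrightarrow> nsum (\<lambda>i. f i \<oplus> g i) n = nsum f n \<oplus> nsum g n"
  by (induction n) (auto simp: a_ac)

lemma nsum_cmult:
  "(\<And>i. f i \<in> carrier K) \<Longrightarrow> c \<in> carrier K \<Longrightarrow> nsum (\<lambda>i. c \<otimes> f i) n = c \<otimes> nsum f n"
  by (induction n) (auto simp: r_distr)

text \<open>The powers form a geometric sequence with ratio \<open>rho ^ t\<close>, which differs
  from 1 because \<open>r\<close> does not divide \<open>t\<close>; the ratio minus 1 annihilates
  the sum over a period.\<close>

lemma nsum_x_pow:
  assumes "0 < t" "t < r"
  shows "nsum (\<lambda>i. x i [^] t) r = \<zero>"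
proof -
  note [simp] = rho a a_nonzero x_closed
  define y where "y = rho [^] t"
  have y [simp]: "y \<in> carrier K" by (simp add: y_def)
  have "\<not> r dvd t" using assms by (auto dest: dvd_imp_le)
  then have "coprime t r"
    using root_stepD(1)[OF step] by (simp add: coprime_commute prime_imp_coprime)
  then have "y \<noteq> \<one>" using pow_coprime_eq_one[of rho t r] by (auto simp: y_def)
  have "y [^] r = (rho [^] r) [^] t" by (simp add: y_def nat_pow_pow mult.commute del: rho(4))
  then have "(y \<ominus> \<one>) \<otimes> nsum (\<lambda>i. y [^] i) r = \<zero>"
    using geometric_nsum[OF y, of r] by (simp add: a_minus_def r_neg)
  then have "nsum (\<lambda>i. y [^] i) r = \<zero>"
    using \<open>y \<noteq> \<one>\<close> by (simp add: integral_iff)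
  moreover have "x i [^] t = a [^] t \<otimes> y [^] i" for i
    by (simp add: x_def y_def nat_pow_distrib nat_pow_pow mult.commute)
  ultimately show ?thesis by (simp add: nsum_cmult)
qed

text \<open>The constant coefficient is the mean of the values at the points \<open>x i\<close>, since the power sums vanish.\<close>

lemma last_coeff_of_constant:
  assumes p: "set p \<subseteq> carrier K" "p \<noteq> []" "length p \<le> r" and c: "\<And>i. eval p (x i) = c" and r: "r dvd N"
  shows "last p = c"
proof -
  have sum: "nsum (\<lambda>i. eval p (x i)) r = nsum (\<lambda>i. last p) r"
    if "set p \<subseteq> carrier K" "p \<noteq> []" "length p \<le> r" for p
    using that
  proof (induction p)
    case (Cons h p)
    show ?case
    proof (cases "p = []")
      case True
      then show ?thesis using Cons by simp
    next
      case False
      have h: "h \<in> carrier K" and p: "set p \<subseteq> carrier K" using Cons by auto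
      have "nsum (\<lambda>i. eval (h # p) (x i)) r = nsum (\<lambda>i. h \<otimes> x i [^] length p \<oplus> eval p (x i)) r"
        by simp
      also have "\<dots> = h \<otimes> nsum (\<lambda>i. x i [^] length p) r \<oplus> nsum (\<lambda>i. eval p (x i)) r"
        using h p by (simp add: nsum_add nsum_cmult x_closed eval_in_carrier)
      also have "\<dots> = nsum (\<lambda>i. last (h # p)) r"
        using Cons False h by (subst nsum_x_pow) (auto simp: x_closed intro!: nsum_closed l_zero)
      finally show ?thesis .
    qed
  qed simp
  have last: "last p \<in> carrier K" using p by auto
  have cK: "c \<in> carrier K" using eval_in_carrier[OF p(1) x_closed[of 0]] c[of 0] by metis
  have const: "nsum (\<lambda>i. y) m = y \<otimes> nsum (\<lambda>i. \<one>) m" if "y \<in> carrier K" for y m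
    using that nsum_cmult[of "\<lambda>i. \<one>" y m] by simp
  \<comment> \<open>The integer \<open>r\<close> is invertible in \<open>K\<close>: were it zero
    there, its multiple \<open>N\<close> would be zero, whereas \<open>N + 1\<close>, the number of
    elements, is zero in \<open>K\<close>.\<close>
  have ones: "nsum (\<lambda>i. \<one>) r \<noteq> \<zero>"
  proof
    assume r0: "nsum (\<lambda>i. \<one>) r = \<zero>"
    have add: "nsum (\<lambda>i. \<one>) (m + n) = nsum (\<lambda>i. \<one>) m \<oplus> nsum (\<lambda>i. \<one>) n" for m n
      by (induction n) (auto simp: a_assoc)
    have mult: "nsum (\<lambda>i. \<one>) (r * k) = \<zero>" for k
      by (induction k) (auto simp: add r0)
    have "nsum (\<lambda>i. \<one>) m = add_pow K m \<one>" for m :: nat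
      by (induction m) auto
    moreover have "add_pow K (order K) \<one> = \<zero>"
      using add.pow_order_eq_1[of \<one>] by (simp add: order_def)
    moreover have "order K = Suc N"
      using order_mult_of[OF finite_carrier] N_pos by (simp add: N_def)
    ultimately have "nsum (\<lambda>i. \<one>) N \<oplus> \<one> = \<zero>" by (metis nsum.simps(2))
    then show False using mult[of "N div r"] r by simp
  qed
  have "last p \<otimes> nsum (\<lambda>i. \<one>) r = c \<otimes> nsum (\<lambda>i. \<one>) r"
    using sum[OF p] c const[OF last] const[OF cK] by simp
  then show ?thesis using last cK ones by (subst (asm) m_rcancel) auto
qed

end

text \<open>Take the least prefix after which the values agree. It exists because the full product
  gives 1, and it is nonempty because the values differ at the start; its last entry is
  \<open>l\<close>.\<close>

lemma power_chain:
  fixes ls :: "nat list"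
  assumes "\<And>i. v i \<in> carrier K" "\<And>i. v i [^] prod_list ls = \<one>" "\<exists>i. v i \<noteq> v (0::nat)"
  shows "\<exists>ks l ms. ls = ks @ l # ms \<and> (\<exists>i. v i [^] prod_list ks \<noteq> v 0 [^] prod_list ks) \<and>
     (\<forall>i. v i [^] prod_list (ks @ [l]) = v 0 [^] prod_list (ks @ [l]))"
proof -
  define C where "C m \<longleftrightarrow> (\<forall>i. v i [^] prod_list (take m ls) = v 0 [^] prod_list (take m ls))" for m
  define m where "m = (LEAST m. C m)"
  have C: "C (length ls)" using assms(2) by (simp add: C_def)
  then have m: "C m" "m \<le> length ls"
    unfolding m_def by (auto intro: LeastI Least_le)
  have "v i [^] prod_list ([] :: nat list) = v i" for i by (simp only: prod_list.Nil nat_pow_eone[OF assms(1)])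
  then have "\<not> C 0" using assms(3) by (simp add: C_def)
  then obtain j where j: "m = Suc j" using m(1) by (cases m) auto
  have "\<not> C j" using not_less_Least[of j C] by (simp add: m_def[symmetric] j)
  moreover have "take m ls = take j ls @ [ls ! j]" using m(2) j by (simp add: take_Suc_conv_app_nth)
  moreover have "ls = take j ls @ ls ! j # drop m ls" using m(2) j by (simp add: id_take_nth_drop)
  ultimately show ?thesis using m(1) unfolding C_def by metis
qed

lemma primitive_elementI:
  assumes g: "g \<in> carrier Kx" and "\<And>r. Factorial_Ring.prime r \<Longrightarrow> r dvd N \<Longrightarrow> g [^] (N div r) \<noteq> \<one>"
  shows "primitive_element K g"
proof -
  have fin: "finite (carrier Kx)" using finite_carrier by simp
  have "mult.ord g = N"
  proof (rule ccontr)
    assume ne: "mult.ord g \<noteq> N"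
    obtain k where k: "N = mult.ord g * k" using dvd_N_iff_ord[OF g] by blast
    then have "k \<noteq> 1" using ne by auto
    then obtain r where r: "Factorial_Ring.prime r" "r dvd k" using prime_factor_nat by blast
    then obtain j where j: "k = r * j" by blast
    have "N div r = mult.ord g * j" using k j r prime_gt_0_nat[OF r(1)] by simp
    then have "g [^] (N div r) = \<one>" using mult.pow_eq_id[OF g] by simp
    then show False using assms(2)[OF r(1)] k j by simp
  qed
  then have "card (generate Kx {g}) = card (carrier Kx)"
    using mult.generate_pow_card[OF g] by (simp add: N_def order_def)
  moreover have "generate Kx {g} \<subseteq> carrier Kx"
    using mult.generate_incl[of "{g}"] g by simp
  ultimately have "generate Kx {g} = carrier Kx"
    using fin by (intro card_subset_eq) auto
  then show ?thesis using g by (simp add: primitive_element_def mult_of_eq_Kx)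
qed

lemma foldl_mult_pow:
  assumes "\<And>l. l \<in> set ps \<Longrightarrow> f l \<in> carrier K \<and> f l [^] e = \<one>" "h \<in> carrier K"
  shows "foldl (\<lambda>g l. g \<otimes> f l) h ps [^] (e::nat) = h [^] e"
  using assms by (induction ps arbitrary: h) (auto simp: nat_pow_distrib)

lemma foldl_mult_closed:
  assumes "\<And>l. l \<in> set ps \<Longrightarrow> f l \<in> carrier Kx" "h \<in> carrier Kx"
  shows "foldl (\<lambda>g l. g \<otimes> f l) h ps \<in> carrier Kx"
  using assms by (induction ps arbitrary: h) (auto simp: integral_iff)

text \<open>In the power with exponent \<open>N div r\<close> each factor for a prime
  \<open>l\<close> other than \<open>r\<close> becomes 1, as \<open>s l\<close> still divides the
  exponent. The factor for \<open>r\<close> survives, since its exponent is \<open>s r div r\<close>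
  times a number prime to \<open>r\<close>.\<close>

lemma primitive_element_product:
  assumes ps: "distinct ps" "set ps = {r. Factorial_Ring.prime r \<and> r dvd N}"
    and f: "\<And>r. r \<in> set ps \<Longrightarrow> root_step r (s r) (f r) \<and> s r dvd N \<and> \<not> s r * r dvd N"
  shows "primitive_element K (foldl (\<lambda>g r. g \<otimes> f r) \<one> ps)"
proof (rule primitive_elementI)
  have fK: "f r \<in> carrier Kx" if "r \<in> set ps" for r
    using f[OF that] root_stepD[of r "s r" "f r"] by auto
  then show "foldl (\<lambda>g r. g \<otimes> f r) \<one> ps \<in> carrier Kx"
    by (intro foldl_mult_closed) auto
  fix r :: nat assume r: "Factorial_Ring.prime r" "r dvd N"
  then have "r \<in> set ps" using ps by simp
  then obtain as bs where split: "ps = as @ r # bs" by (auto dest: split_list)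
  have rps: "r \<in> set ps" using split by simp
  have one: "f l \<in> carrier K \<and> f l [^] (N div r) = \<one>" if l: "l \<in> set as \<union> set bs" for l
  proof -
    have ll: "l \<in> set ps" "l \<noteq> r" using l split ps(1) by auto
    note st = f[OF ll(1)]
    obtain k where k: "s l = l ^ k" "Factorial_Ring.prime l" using st by (auto simp: root_step_def)
    have "coprime (s l) r" using k r(1) ll(2) by (simp add: primes_coprime)
    moreover have "s l dvd r * (N div r)" using st r(2) by simp
    ultimately have "s l dvd N div r" by (simp add: coprime_dvd_mult_right_iff)
    then obtain j where j: "N div r = s l * j" by blast
    have "f l [^] (N div r) = (f l [^] s l) [^] j"
      using fK[OF ll(1)] by (simp add: j nat_pow_pow)
    then show ?thesis using root_stepD[of l "s l" "f l"] st by simp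
  qed
  define g0 where "g0 = foldl (\<lambda>g r. g \<otimes> f r) \<one> as"
  have g0: "g0 \<in> carrier K" "g0 [^] (N div r) = \<one>"
    using foldl_mult_closed[of as f \<one>] fK split foldl_mult_pow[of as f "N div r" \<one>] one
    by (auto simp: g0_def)
  have "foldl (\<lambda>g r. g \<otimes> f r) \<one> ps [^] (N div r) = (g0 \<otimes> f r) [^] (N div r)"
    unfolding split using foldl_mult_pow[of bs f "N div r" "g0 \<otimes> f r"] one g0 fK[OF rps] by (simp add: g0_def)
  also have "\<dots> = f r [^] (N div r)"
    using g0 fK[OF rps] by (simp add: nat_pow_distrib)
  finally have eq: "foldl (\<lambda>g r. g \<otimes> f r) \<one> ps [^] (N div r) = f r [^] (N div r)" .
  note st = f[OF rps]
  obtain M where M: "N = s r * M" using st by blast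
  have "\<not> r dvd M" using st M by auto
  then have "coprime M r" using r(1) by (metis coprime_commute prime_imp_coprime)
  have "N div r = (s r div r) * M"
    using M root_stepD(2)[of r "s r" "f r"] st by (simp add: div_mult_swap dvd_div_mult)
  then have "f r [^] (N div r) = (f r [^] (s r div r)) [^] M"
    using fK[OF rps] by (simp add: nat_pow_pow)
  moreover have "(f r [^] (s r div r)) [^] M \<noteq> \<one>"
    using pow_coprime_eq_one[of "f r [^] (s r div r)" M r] \<open>coprime M r\<close> root_stepD[of r "s r" "f r"] st by auto
  ultimately show "foldl (\<lambda>g r. g \<otimes> f r) \<one> ps [^] (N div r) \<noteq> \<one>" using eq by simp
qed

end

section \<open>Rings given by polynomial-time operations\<close>

lemma ptime_comp2:
  assumes "ptime E (\<lambda>z. f (fst z) (snd z))" "ptime D a" "ptime D b" "\<And>n z. (n, z) \<in> D \<Longrightarrow> (n, (a z, b z)) \<in> E"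
  shows "ptime D (\<lambda>z. f (a z) (b z))"
  using ptime_comp[OF ptime_Pair[OF assms(2,3)] assms(1)] assms(4) by simp

lemma ptime_comp3:
  assumes "ptime E (\<lambda>z. f (fst z) (fst (snd z)) (snd (snd z)))" "ptime D a" "ptime D b" "ptime D c"
    "\<And>n z. (n, z) \<in> D \<Longrightarrow> (n, (a z, b z, c z)) \<in> E"
  shows "ptime D (\<lambda>z. f (a z) (b z) (c z))"
  using ptime_comp[OF ptime_Pair[OF assms(2) ptime_Pair[OF assms(3,4)]] assms(1)] assms(5) by simp

lemma ptime_comp4:
  assumes "ptime E (\<lambda>z. f (fst z) (fst (snd z)) (fst (snd (snd z))) (snd (snd (snd z))))"
    "ptime D a" "ptime D b" "ptime D c" "ptime D d"
    "\<And>n z. (n, z) \<in> D \<Longrightarrow> (n, (a z, b z, c z, d z)) \<in> E"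
  shows "ptime D (\<lambda>z. f (a z) (b z) (c z) (d z))"
  using ptime_comp[OF ptime_Pair[OF assms(2) ptime_Pair[OF assms(3) ptime_Pair[OF assms(4,5)]]] assms(1)] assms(6)
  by simp

lemma ptime_while:
  assumes "\<And>n s. (n, s) \<in> E \<Longrightarrow> b s \<Longrightarrow> (n, g s) \<in> E"
    and "\<And>n s. (n, s) \<in> E \<Longrightarrow> b s \<Longrightarrow> m n (g s) < m n s" and "polyb E m"
    and "ptime E b" and "ptime {(n, s) \<in> E. b s} g"
  shows "ptime E (while b g)"
  by (rule ptime_tailrec[where b = b and g = g and m = m, OF while_unfold]) (use assms in auto)

lemma bddI_prod:
  assumes "polyb E (\<lambda>n y. bs (fst y))" "polyb E (\<lambda>n y. bs (snd y))"
  shows "bdd E"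
  unfolding bdd_def
  by (rule polyb_mono[OF polyb_add[OF polyb_const[of _ 1] polyb_add[OF assms]]]) (simp add: enc_prod_def)

lemma ptime_odd: "ptime D f \<Longrightarrow> ptime D (\<lambda>x. odd (f x :: nat))"
  by (rule ptime_cong[where f = "\<lambda>x. f x mod 2 = 1"])
     (auto intro!: ptime_eq_nat ptime_mod ptime_nat dest: ptime_bdd simp: odd_iff_mod_2_eq_one)

lemmas ptime_proj = ptime_fst ptime_snd ptime_id

text \<open>The argument \<open>c\<close> belongs to the input, so that a single program operates in
  all rings of a family. Ring laws are not demanded here; they are inherited through the maps of
  \<open>rep\<close>. The bound on all of \<open>V c\<close> makes sizes independent of the number
  of operations performed.\<close>

locale ring_ops =
  fixes C :: "(nat \<times> 'c::enc) set" and V :: "'c \<Rightarrow> 'a::enc set"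
    and zero one mone :: "'c \<Rightarrow> 'a" and add mul :: "'c \<Rightarrow> 'a \<Rightarrow> 'a \<Rightarrow> 'a"
  assumes zero_closed: "\<And>n c. (n, c) \<in> C \<Longrightarrow> zero c \<in> V c"
    and one_closed: "\<And>n c. (n, c) \<in> C \<Longrightarrow> one c \<in> V c"
    and mone_closed: "\<And>n c. (n, c) \<in> C \<Longrightarrow> mone c \<in> V c"
    and add_closed: "\<And>n c x y. (n, c) \<in> C \<Longrightarrow> x \<in> V c \<Longrightarrow> y \<in> V c \<Longrightarrow> add c x y \<in> V c"
    and mul_closed: "\<And>n c x y. (n, c) \<in> C \<Longrightarrow> x \<in> V c \<Longrightarrow> y \<in> V c \<Longrightarrow> mul c x y \<in> V c"
    and bdd_CV: "bdd {(n, (c, x)). (n, c) \<in> C \<and> x \<in> V c}"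
    and pt_zero0: "ptime C zero" and pt_one0: "ptime C one" and pt_mone0: "ptime C mone"
    and pt_add0: "ptime {(n, (c, x, y)). (n, c) \<in> C \<and> x \<in> V c \<and> y \<in> V c} (\<lambda>z. add (fst z) (fst (snd z)) (snd (snd z)))"
    and pt_mul0: "ptime {(n, (c, x, y)). (n, c) \<in> C \<and> x \<in> V c \<and> y \<in> V c} (\<lambda>z. mul (fst z) (fst (snd z)) (snd (snd z)))"
begin

lemmas closed = zero_closed one_closed mone_closed add_closed mul_closed

lemma pt_zero: "ptime D c \<Longrightarrow> (\<And>n z. (n, z) \<in> D \<Longrightarrow> (n, c z) \<in> C) \<Longrightarrow> ptime D (\<lambda>z. zero (c z))"
  by (rule ptime_comp[OF _ pt_zero0])

lemma pt_one: "ptime D c \<Longrightarrow> (\<And>n z. (n, z) \<in> D \<Longrightarrow> (n, c z) \<in> C) \<Longrightarrow> ptime D (\<lambda>z. one (c z))"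
  by (rule ptime_comp[OF _ pt_one0])

lemma pt_mone: "ptime D c \<Longrightarrow> (\<And>n z. (n, z) \<in> D \<Longrightarrow> (n, c z) \<in> C) \<Longrightarrow> ptime D (\<lambda>z. mone (c z))"
  by (rule ptime_comp[OF _ pt_mone0])

lemma pt_add:
  "ptime D c \<Longrightarrow> ptime D x \<Longrightarrow> ptime D y \<Longrightarrow>
    (\<And>n z. (n, z) \<in> D \<Longrightarrow> (n, c z) \<in> C \<and> x z \<in> V (c z) \<and> y z \<in> V (c z)) \<Longrightarrow>
    ptime D (\<lambda>z. add (c z) (x z) (y z))"
  by (rule ptime_comp3[OF pt_add0]) auto

lemma pt_mul:
  "ptime D c \<Longrightarrow> ptime D x \<Longrightarrow> ptime D y \<Longrightarrow>
    (\<And>n z. (n, z) \<in> D \<Longrightarrow> (n, c z) \<in> C \<and> x z \<in> V (c z) \<and> y z \<in> V (c z)) \<Longrightarrow>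
    ptime D (\<lambda>z. mul (c z) (x z) (y z))"
  by (rule ptime_comp3[OF pt_mul0]) auto

lemma polyb_V:
  assumes "\<And>n z. (n, z) \<in> D \<Longrightarrow> (n, c z) \<in> C \<and> x z \<in> V (c z)"
  shows "polyb D (\<lambda>n z. bs (c z))" "polyb D (\<lambda>n z. bs (x z))"
proof -
  have "polyb D (\<lambda>n z. bs (c z, x z))"
    by (rule polyb_reindex[OF bdd_CV[unfolded bdd_def]]) (use assms in auto)
  then show "polyb D (\<lambda>n z. bs (c z))" "polyb D (\<lambda>n z. bs (x z))"
    by (auto elim: polyb_mono)
qed

lemma V_bounded: "\<exists>k. \<forall>n c x. (n, c) \<in> C \<longrightarrow> x \<in> V c \<longrightarrow> bs x \<le> (n + 2) ^ k"
proof -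
  obtain k where k: "\<And>n y. (n, y) \<in> {(n, (c, x)). (n, c) \<in> C \<and> x \<in> V c} \<Longrightarrow> bs y \<le> (n + 2) ^ k"
    using bdd_CV unfolding bdd_def polyb_def by blast
  have "bs x \<le> (n + 2) ^ k" if "(n, c) \<in> C" "x \<in> V c" for n c x
    using k[of n "(c, x)"] that by simp
  then show ?thesis by blast
qed

text \<open>Exponents such as \<open>N\<close> are polynomial only in bit length, hence
  square-and-multiply with one round per bit. The state consists of \<open>c\<close>, the
  accumulated product, the current square and the remaining exponent.\<close>

definition pow :: "'c \<Rightarrow> 'a \<Rightarrow> nat \<Rightarrow> 'a" where
  "pow c x e = fst (snd (while (\<lambda>s. 0 < snd (snd (snd s)))
     (\<lambda>s. (fst s,
       if odd (snd (snd (snd s))) then mul (fst s) (fst (snd s)) (fst (snd (snd s))) else fst (snd s),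
       mul (fst s) (fst (snd (snd s))) (fst (snd (snd s))),
       snd (snd (snd s)) div 2)) (c, one c, x, e)))"

lemma pow_state_closed:
  fixes e :: nat
  assumes "(n, c) \<in> C" "a \<in> V c" "b \<in> V c"
  shows "fst (snd (while (\<lambda>s. 0 < snd (snd (snd s)))
     (\<lambda>s. (fst s,
       if odd (snd (snd (snd s))) then mul (fst s) (fst (snd s)) (fst (snd (snd s))) else fst (snd s),
       mul (fst s) (fst (snd (snd s))) (fst (snd (snd s))),
       snd (snd (snd s)) div 2)) (c, a, b, e))) \<in> V c"
  using assms
proof (induction e arbitrary: a b rule: less_induct)
  case (less e)
  show ?case
    using less(2-4) less(1)[OF _ less(2,3) mul_closed[OF less(2,4,4)]]
      less(1)[OF _ less(2) mul_closed[OF less(2-4)] mul_closed[OF less(2,4,4)]]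
    by (subst while_unfold) auto
qed

lemma pow_closed: "(n, c) \<in> C \<Longrightarrow> x \<in> V c \<Longrightarrow> pow c x e \<in> V c"
  unfolding pow_def by (rule pow_state_closed) (auto intro: closed)

lemma pt_pow:
  assumes c: "ptime D c" and x: "ptime D x" and e: "ptime D e"
    and D: "\<And>n z. (n, z) \<in> D \<Longrightarrow> (n, c z) \<in> C \<and> x z \<in> V (c z)"
  shows "ptime D (\<lambda>z. pow (c z) (x z) (e z))"
proof -
  let ?b = "\<lambda>s :: 'c \<times> 'a \<times> 'a \<times> nat. 0 < snd (snd (snd s))"
  let ?g = "\<lambda>s. (fst s,
       if odd (snd (snd (snd s))) then mul (fst s) (fst (snd s)) (fst (snd (snd s))) else fst (snd s),
       mul (fst s) (fst (snd (snd s))) (fst (snd (snd s))),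
       snd (snd (snd s)) div 2)"
  obtain k where k: "\<And>n z. (n, z) \<in> D \<Longrightarrow> bs (e z) \<le> (n + 2) ^ k"
    using ptime_bs_le[OF e] unfolding polyb_def by blast
  define E where "E = {(n, (c, a, b, e)). (n, c) \<in> C \<and> a \<in> V c \<and> b \<in> V c \<and> bs (e::nat) \<le> (n + 2) ^ k}"
  have mono: "floorlog 2 (i div 2) \<le> floorlog 2 i" for i
    by (rule floorlog_mono) simp
  have bE: "bdd E"
  proof (intro bddI_prod)
    show "polyb E (\<lambda>n y. bs (fst y))"
      by (rule polyb_V[where x = "\<lambda>y. fst (snd y)"]) (auto simp: E_def)
    have "polyb E (\<lambda>n y. 2 + (bs (fst (snd y)) + (bs (fst (snd (snd y))) + (n + 2) ^ k)))"
      by (intro polyb_intros polyb_V(2)[where c = fst]) (auto simp: E_def)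
    then show "polyb E (\<lambda>n y. bs (snd y))"
      by (rule polyb_mono) (auto simp: E_def enc_prod_def)
  qed
  have w: "ptime E (while ?b ?g)"
  proof (rule ptime_while[where m = "\<lambda>_ s. floorlog 2 (snd (snd (snd s)))"])
    show "(n, ?g s) \<in> E" if "(n, s) \<in> E" for n s
      using that mono[of "snd (snd (snd s))"]
      by (auto simp: E_def enc_nat_def simp del: add_2_eq_Suc' intro: closed elim: order_trans[rotated])
    show "floorlog 2 (snd (snd (snd (?g s)))) < floorlog 2 (snd (snd (snd s)))" if "?b s" for s
    proof -
      have "floorlog 2 i = Suc (floorlog 2 (i div 2))" if "0 < i" for i
        using that by (subst compute_floorlog) simp
      then show ?thesis using that by simp
    qed
    show "polyb E (\<lambda>n s. floorlog 2 (snd (snd (snd s))))"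
      by (rule polyb_mono[OF bE[unfolded bdd_def]]) (simp add: enc_prod_def enc_nat_def)
    show "ptime E ?b"
      by (intro ptime_less ptime_nat ptime_proj bE)
    show "ptime {(n, s) \<in> E. ?b s} ?g"
      by (intro ptime_Pair ptime_if ptime_odd ptime_div ptime_nat pt_mul ptime_proj bdd_subset[OF bE])
         (auto simp: E_def)
  qed
  have "ptime D (\<lambda>z. fst (snd (while ?b ?g (c z, one (c z), x z, e z))))"
    by (intro ptime_fst ptime_snd ptime_comp[OF _ w] ptime_Pair pt_one c x e)
       (use D k in \<open>auto simp: E_def intro: closed\<close>)
  then show ?thesis by (simp add: pow_def)
qed

end

text \<open>The map \<open>f\<close> need not be injective: an element of \<open>R\<close> is
  studied through its evaluations at the several roots, each of which is such a map.\<close>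

definition ring_rep ::
    "('k, 'l) ring_scheme \<Rightarrow> 'a set \<Rightarrow> 'a \<Rightarrow> 'a \<Rightarrow> 'a \<Rightarrow> ('a \<Rightarrow> 'a \<Rightarrow> 'a) \<Rightarrow> ('a \<Rightarrow> 'a \<Rightarrow> 'a) \<Rightarrow> ('a \<Rightarrow> 'k) \<Rightarrow> bool" where
  "ring_rep K V z u w p t f \<longleftrightarrow>
     f ` V \<subseteq> carrier K \<and> f z = \<zero>\<^bsub>K\<^esub> \<and> f u = \<one>\<^bsub>K\<^esub> \<and> f w = \<ominus>\<^bsub>K\<^esub> \<one>\<^bsub>K\<^esub> \<and>
     (\<forall>x\<in>V. \<forall>y\<in>V. f (p x y) = f x \<oplus>\<^bsub>K\<^esub> f y \<and> f (t x y) = f x \<otimes>\<^bsub>K\<^esub> f y)"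

context ring_ops
begin

definition rep :: "('k, 'l) ring_scheme \<Rightarrow> 'c \<Rightarrow> ('a \<Rightarrow> 'k) \<Rightarrow> bool" where
  "rep K c = ring_rep K (V c) (zero c) (one c) (mone c) (add c) (mul c)"

lemma repD:
  assumes "rep K c f"
  shows "x \<in> V c \<Longrightarrow> f x \<in> carrier K" "f (zero c) = \<zero>\<^bsub>K\<^esub>" "f (one c) = \<one>\<^bsub>K\<^esub>" "f (mone c) = \<ominus>\<^bsub>K\<^esub> \<one>\<^bsub>K\<^esub>"
    "x \<in> V c \<Longrightarrow> y \<in> V c \<Longrightarrow> f (add c x y) = f x \<oplus>\<^bsub>K\<^esub> f y"
    "x \<in> V c \<Longrightarrow> y \<in> V c \<Longrightarrow> f (mul c x y) = f x \<otimes>\<^bsub>K\<^esub> f y"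
  using assms by (auto simp: rep_def ring_rep_def)

lemma rep_pow:
  assumes K: "cring K" and r: "rep K c f" and c: "(n, c) \<in> C" and x: "x \<in> V c"
  shows "f (pow c x e) = f x [^]\<^bsub>K\<^esub> e"
proof -
  interpret K: cring K by (rule K)
  note r = repD[OF r]
  have "f (fst (snd (while (\<lambda>s. 0 < snd (snd (snd s)))
     (\<lambda>s. (fst s,
       if odd (snd (snd (snd s))) then mul (fst s) (fst (snd s)) (fst (snd (snd s))) else fst (snd s),
       mul (fst s) (fst (snd (snd s))) (fst (snd (snd s))),
       snd (snd (snd s)) div 2)) (c, a, b, e)))) = f a \<otimes>\<^bsub>K\<^esub> f b [^]\<^bsub>K\<^esub> e"
    if "a \<in> V c" "b \<in> V c" for a b
    using that
  proof (induction e arbitrary: a b rule: less_induct)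
    case (less e)
    show ?case
    proof (cases "e = 0")
      case True
      then show ?thesis using less(2) by (subst while_unfold) (simp add: r)
    next
      case False
      define d where "d = e div 2"
      have e: "e = (if odd e then Suc (2 * d) else 2 * d)" by (auto simp: d_def elim: oddE)
      have m: "mul c b b \<in> V c" "mul c a b \<in> V c" using c less by (auto intro: closed)
      have bb: "(f b \<otimes>\<^bsub>K\<^esub> f b) [^]\<^bsub>K\<^esub> d = f b [^]\<^bsub>K\<^esub> (2 * d)"
        using less(3) by (simp add: r K.nat_pow_distrib K.nat_pow_mult mult_2)
      have IH: "d < e" using False by (simp add: d_def)
      show ?thesis
      proof (cases "odd e")
        case True
        then have e': "e = Suc (2 * d)" using e by simp
        show ?thesis
          using False True less(2,3) less(1)[OF IH m(2) m(1)]
          by (subst while_unfold) (simp add: d_def[symmetric] bb r K.m_ac, subst e', simp add: r K.m_ac)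
      next
        case odd: False
        then have e': "e = 2 * d" using e by simp
        show ?thesis
          using False odd less(2,3) less(1)[OF IH less(2) m(1)]
          by (subst while_unfold) (simp add: d_def[symmetric] r bb, subst e', simp)
      qed
    qed
  qed
  from this[of "one c" x] show ?thesis
    using x c unfolding pow_def by (simp add: r closed)
qed

subsection \<open>Adjoining a root\<close>

text \<open>For \<open>h\<close> of length \<open>d\<close>, the pair \<open>(c, h)\<close> stands for the quotient by \<open>X ^ d - h\<close>; its elements are
  coefficient lists of length \<open>d\<close>, leading coefficient first.\<close>

definition ext_C :: "(nat \<times> 'c \<times> 'a list) set" where
  "ext_C = {(n, (c, h)). (n, c) \<in> C \<and> set h \<subseteq> V c \<and> h \<noteq> [] \<and> length h \<le> n}"

definition ext_V :: "'c \<times> 'a list \<Rightarrow> 'a list set" where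
  "ext_V ch = {x. set x \<subseteq> V (fst ch) \<and> length x = length (snd ch)}"

definition ext_const :: "'c \<times> 'a list \<Rightarrow> 'a \<Rightarrow> 'a list" where
  "ext_const ch a = map (\<lambda>_. zero (fst ch)) (tl (snd ch)) @ [a]"

definition ext_zero :: "'c \<times> 'a list \<Rightarrow> 'a list" where
  "ext_zero ch = map (\<lambda>_. zero (fst ch)) (snd ch)"

definition ext_one :: "'c \<times> 'a list \<Rightarrow> 'a list" where
  "ext_one ch = ext_const ch (one (fst ch))"

definition ext_mone :: "'c \<times> 'a list \<Rightarrow> 'a list" where
  "ext_mone ch = ext_const ch (mone (fst ch))"

definition ext_add :: "'c \<times> 'a list \<Rightarrow> 'a list \<Rightarrow> 'a list \<Rightarrow> 'a list" where
  "ext_add ch x y = map (\<lambda>p. add (fst ch) (fst p) (snd p)) (zip x y)"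

definition ext_smul :: "'c \<times> 'a list \<Rightarrow> 'a \<Rightarrow> 'a list \<Rightarrow> 'a list" where
  "ext_smul ch a x = map (\<lambda>b. mul (fst ch) a b) x"

text \<open>This is multiplication by \<open>X\<close>: the coefficients move up one place, and the
  overflowing term \<open>a * X ^ d\<close> becomes \<open>a * h\<close>.\<close>

definition ext_shift :: "'c \<times> 'a list \<Rightarrow> 'a list \<Rightarrow> 'a list" where
  "ext_shift ch x = ext_add ch (tl x @ [zero (fst ch)]) (ext_smul ch (hd x) (snd ch))"

text \<open>Horner's rule in the first factor.\<close>

definition ext_mul :: "'c \<times> 'a list \<Rightarrow> 'a list \<Rightarrow> 'a list \<Rightarrow> 'a list" where
  "ext_mul ch x y = foldl (\<lambda>s a. ext_add ch (ext_shift ch s) (ext_smul ch a y)) (ext_zero ch) x"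

lemma ext_CD: "(n, ch) \<in> ext_C \<Longrightarrow> (n, fst ch) \<in> C \<and> set (snd ch) \<subseteq> V (fst ch) \<and> snd ch \<noteq> [] \<and> length (snd ch) \<le> n \<and> snd ch \<in> ext_V ch"
  by (auto simp: ext_C_def ext_V_def)

lemma ext_V_nonempty: "(n, ch) \<in> ext_C \<Longrightarrow> x \<in> ext_V ch \<Longrightarrow> x \<noteq> []"
  by (auto simp: ext_C_def ext_V_def)

lemma ext_const_closed: "(n, ch) \<in> ext_C \<Longrightarrow> a \<in> V (fst ch) \<Longrightarrow> ext_const ch a \<in> ext_V ch"
  using ext_CD[of n ch] by (auto simp: ext_const_def ext_V_def intro: closed)

lemma ext_zero_closed: "(n, ch) \<in> ext_C \<Longrightarrow> ext_zero ch \<in> ext_V ch"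
  using ext_CD[of n ch] by (auto simp: ext_zero_def ext_V_def intro: closed)

lemma ext_add_closed: "(n, ch) \<in> ext_C \<Longrightarrow> x \<in> ext_V ch \<Longrightarrow> y \<in> ext_V ch \<Longrightarrow> ext_add ch x y \<in> ext_V ch"
  using ext_CD[of n ch] by (auto simp: ext_add_def ext_V_def intro!: closed dest: set_zip_leftD set_zip_rightD)

lemma ext_smul_closed: "(n, ch) \<in> ext_C \<Longrightarrow> a \<in> V (fst ch) \<Longrightarrow> x \<in> ext_V ch \<Longrightarrow> ext_smul ch a x \<in> ext_V ch"
  using ext_CD[of n ch] by (auto simp: ext_smul_def ext_V_def intro!: closed)

lemma ext_pad_closed: "(n, ch) \<in> ext_C \<Longrightarrow> x \<in> ext_V ch \<Longrightarrow> tl x @ [zero (fst ch)] \<in> ext_V ch"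
  using ext_CD[of n ch] by (cases x) (auto simp: ext_V_def intro: closed)

lemma ext_hd_closed: "(n, ch) \<in> ext_C \<Longrightarrow> x \<in> ext_V ch \<Longrightarrow> hd x \<in> V (fst ch)"
  using ext_CD[of n ch] by (cases x) (auto simp: ext_V_def)

lemma ext_shift_closed: "(n, ch) \<in> ext_C \<Longrightarrow> x \<in> ext_V ch \<Longrightarrow> ext_shift ch x \<in> ext_V ch"
  unfolding ext_shift_def using ext_CD[of n ch]
  by (intro ext_add_closed ext_smul_closed ext_pad_closed ext_hd_closed) auto

lemma ext_mem: "x \<in> ext_V ch \<Longrightarrow> a \<in> set x \<Longrightarrow> a \<in> V (fst ch)"
  by (auto simp: ext_V_def)

lemma ext_mem': "x \<in> ext_V (c, h) \<Longrightarrow> a \<in> set x \<Longrightarrow> a \<in> V c"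
  by (auto simp: ext_V_def)

lemma ext_smul_closed': "(n, (c, h)) \<in> ext_C \<Longrightarrow> a \<in> V c \<Longrightarrow> x \<in> ext_V (c, h) \<Longrightarrow> ext_smul (c, h) a x \<in> ext_V (c, h)"
  using ext_smul_closed[of n "(c, h)"] by simp

lemma ext_h_closed: "(n, ch) \<in> ext_C \<Longrightarrow> snd ch \<in> ext_V ch" and ext_base: "(n, ch) \<in> ext_C \<Longrightarrow> (n, fst ch) \<in> C"
  using ext_CD by auto

lemma ext_one_closed: "(n, ch) \<in> ext_C \<Longrightarrow> ext_one ch \<in> ext_V ch"
  unfolding ext_one_def by (intro ext_const_closed one_closed ext_base)

lemma ext_mone_closed: "(n, ch) \<in> ext_C \<Longrightarrow> ext_mone ch \<in> ext_V ch"
  unfolding ext_mone_def by (intro ext_const_closed mone_closed ext_base)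

lemma ext_base': "(n, (c, h)) \<in> ext_C \<Longrightarrow> (n, c) \<in> C"
  by (simp add: ext_C_def)

lemma ext_mul_closed:
  assumes "(n, ch) \<in> ext_C" "x \<in> ext_V ch" "y \<in> ext_V ch"
  shows "ext_mul ch x y \<in> ext_V ch"
proof -
  have "foldl (\<lambda>s a. ext_add ch (ext_shift ch s) (ext_smul ch a y)) s xs \<in> ext_V ch"
    if "set xs \<subseteq> V (fst ch)" "s \<in> ext_V ch" for xs s
    using that
    by (induction xs arbitrary: s)
       (use assms in \<open>auto intro!: ext_add_closed ext_shift_closed ext_smul_closed\<close>)
  moreover have "set x \<subseteq> V (fst ch)" using assms(2) by (simp add: ext_V_def)
  ultimately show ?thesis unfolding ext_mul_def using ext_zero_closed[OF assms(1)] by blast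
qed

text \<open>An element has at most \<open>n\<close> coefficients, and a single exponent bounds the
  sizes of all of them.\<close>

lemma bdd_ext: "bdd {(n, (ch, x)). (n, ch) \<in> ext_C \<and> x \<in> ext_V ch}"
proof -
  let ?D = "{(n, (ch, x)). (n, ch) \<in> ext_C \<and> x \<in> ext_V ch}"
  obtain k where k: "\<And>n c x. (n, c) \<in> C \<Longrightarrow> x \<in> V c \<Longrightarrow> bs x \<le> (n + 2) ^ k"
    using V_bounded by blast
  have list: "polyb ?D (\<lambda>n y. bs (l y))" if "\<And>n y. (n, y) \<in> ?D \<Longrightarrow> l y \<in> ext_V (fst y)" for l
  proof (rule polyb_mono)
    show "polyb ?D (\<lambda>n y. 1 + n * ((n + 2) ^ k + 1))" by (intro polyb_intros)
    fix n y assume y: "(n, y) \<in> ?D"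
    note l = that[OF y]
    have "(n, fst y) \<in> ext_C" using y by auto
    then have c: "(n, fst (fst y)) \<in> C" "length (l y) \<le> n"
      using l ext_CD by (auto simp: ext_V_def)
    have "bs (l y) \<le> 1 + length (l y) * ((n + 2) ^ k + 1)"
      by (rule bs_list_le) (rule k[OF c(1)], rule ext_mem[OF l])
    also have "\<dots> \<le> 1 + n * ((n + 2) ^ k + 1)" using c(2) by (intro add_mono mult_mono) auto
    finally show "bs (l y) \<le> 1 + n * ((n + 2) ^ k + 1)" .
  qed
  have "polyb ?D (\<lambda>n y. bs (fst (fst y)))"
    by (rule polyb_V[where x = "\<lambda>y. zero (fst (fst y))"]) (auto intro!: zero_closed elim: ext_base')
  moreover have "polyb ?D (\<lambda>n y. bs (snd (fst y)))"
    by (rule list) (use ext_CD in auto)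
  ultimately have "polyb ?D (\<lambda>n y. 1 + (bs (fst (fst y)) + bs (snd (fst y))))"
    by (intro polyb_intros)
  then have "polyb ?D (\<lambda>n y. bs (fst y))"
    by (rule polyb_mono) (simp add: enc_prod_def)
  moreover have "polyb ?D (\<lambda>n y. bs (snd y))" by (rule list) auto
  ultimately show ?thesis by (rule bddI_prod)
qed

lemma ext_polyb_V:
  assumes "\<And>n z. (n, z) \<in> D \<Longrightarrow> (n, c z) \<in> ext_C \<and> x z \<in> ext_V (c z)"
  shows "polyb D (\<lambda>n z. bs (c z))" "polyb D (\<lambda>n z. bs (x z))"
proof -
  have "polyb D (\<lambda>n z. bs (c z, x z))"
    by (rule polyb_reindex[OF bdd_ext[unfolded bdd_def]]) (use assms in auto)
  then show "polyb D (\<lambda>n z. bs (c z))" "polyb D (\<lambda>n z. bs (x z))"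
    by (auto elim: polyb_mono)
qed

lemma bdd_ext_C: "bdd ext_C"
  unfolding bdd_def by (rule ext_polyb_V[where x = ext_zero]) (auto intro: ext_zero_closed)

lemma bdd_ext2: "bdd {(n, (ch, x, y)). (n, ch) \<in> ext_C \<and> x \<in> ext_V ch \<and> y \<in> ext_V ch}" (is "bdd ?D")
proof (intro bddI_prod)
  show "polyb ?D (\<lambda>n y. bs (fst y))"
    by (rule ext_polyb_V[where x = "\<lambda>y. fst (snd y)"]) auto
  have "polyb ?D (\<lambda>n y. 1 + (bs (fst (snd y)) + bs (snd (snd y))))"
    by (intro polyb_intros ext_polyb_V(2)[where c = fst]) auto
  then show "polyb ?D (\<lambda>n y. bs (snd y))"
    by (rule polyb_mono) (auto simp: enc_prod_def)
qed

lemma pt_ext_const: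
  assumes "ptime D ch" "ptime D a" "\<And>n z. (n, z) \<in> D \<Longrightarrow> (n, ch z) \<in> ext_C"
  shows "ptime D (\<lambda>z. ext_const (ch z) (a z))"
proof -
  have "ptime ext_C (\<lambda>ch. map (\<lambda>_. zero (fst ch)) (tl (snd ch)))"
    by (intro ptime_map pt_zero ptime_tl ptime_proj bdd_ext_C) (use ext_CD in auto)
  then have "ptime D (\<lambda>z. map (\<lambda>_. zero (fst (ch z))) (tl (snd (ch z))))"
    by (rule ptime_comp[OF assms(1)]) (rule assms(3))
  then show ?thesis unfolding ext_const_def
    by (intro ptime_append ptime_Cons ptime_Nil assms(2) ptime_bdd[OF assms(1)])
qed

lemma pt_ext_add0:
  "ptime {(n, (ch, x, y)). (n, ch) \<in> ext_C \<and> x \<in> ext_V ch \<and> y \<in> ext_V ch}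
    (\<lambda>z. ext_add (fst z) (fst (snd z)) (snd (snd z)))"
  unfolding ext_add_def
  by (intro ptime_map ptime_zip pt_add ptime_proj bdd_ext2)
     (use ext_CD in \<open>auto simp: ext_V_def elim!: in_set_zipE\<close>)

lemma pt_ext_add:
  "ptime D c \<Longrightarrow> ptime D x \<Longrightarrow> ptime D y \<Longrightarrow>
    (\<And>n z. (n, z) \<in> D \<Longrightarrow> (n, c z) \<in> ext_C \<and> x z \<in> ext_V (c z) \<and> y z \<in> ext_V (c z)) \<Longrightarrow>
    ptime D (\<lambda>z. ext_add (c z) (x z) (y z))"
  by (rule ptime_comp3[OF pt_ext_add0]) auto

lemma pt_ext_smul:
  assumes "ptime D c" "ptime D a" "ptime D x"
    "\<And>n z. (n, z) \<in> D \<Longrightarrow> (n, c z) \<in> ext_C \<and> a z \<in> V (fst (c z)) \<and> x z \<in> ext_V (c z)"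
  shows "ptime D (\<lambda>z. ext_smul (c z) (a z) (x z))"
proof (rule ptime_comp3[OF _ assms(1-3)])
  let ?D = "{(n, (ch, a, x)). (n, ch) \<in> ext_C \<and> a \<in> V (fst ch) \<and> x \<in> ext_V ch}"
  have b: "bdd ?D"
  proof (intro bddI_prod)
    show "polyb ?D (\<lambda>n y. bs (fst y))"
      by (rule ext_polyb_V[where x = "\<lambda>y. snd (snd y)"]) auto
    have "polyb ?D (\<lambda>n y. 1 + (bs (fst (snd y)) + bs (snd (snd y))))"
      by (intro polyb_intros ext_polyb_V(2)[where c = fst] polyb_V(2)[where c = "\<lambda>y. fst (fst y)"]) (use ext_CD in auto)
    then show "polyb ?D (\<lambda>n y. bs (snd y))"
      by (rule polyb_mono) (auto simp: enc_prod_def)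
  qed
  show "ptime ?D (\<lambda>z. ext_smul (fst z) (fst (snd z)) (snd (snd z)))"
    unfolding ext_smul_def
    by (intro ptime_map pt_mul ptime_proj b) (use ext_CD in \<open>auto simp: ext_V_def\<close>)
qed (use assms(4) in auto)

lemma pt_ext_shift:
  assumes "ptime D c" "ptime D x"
    "\<And>n z. (n, z) \<in> D \<Longrightarrow> (n, c z) \<in> ext_C \<and> x z \<in> ext_V (c z)"
  shows "ptime D (\<lambda>z. ext_shift (c z) (x z))"
  unfolding ext_shift_def
  by (intro pt_ext_add pt_ext_smul ptime_append ptime_tl ptime_hd ptime_Cons ptime_Nil pt_zero ptime_fst ptime_snd assms(1,2)
      ptime_bdd[OF assms(1)])
     (use assms(3) in \<open>auto dest: ext_V_nonempty intro: ext_hd_closed ext_smul_closed ext_pad_closed ext_h_closed ext_base\<close>)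

lemma pt_ext_mul0:
  "ptime {(n, (ch, x, y)). (n, ch) \<in> ext_C \<and> x \<in> ext_V ch \<and> y \<in> ext_V ch}
    (\<lambda>z. ext_mul (fst z) (fst (snd z)) (snd (snd z)))"
  (is "ptime ?D _")
  unfolding ext_mul_def
proof (rule ptime_foldl[where S = "\<lambda>n z s. s \<in> ext_V (fst z)"])
  have z: "(n, ch) \<in> ext_C \<Longrightarrow> (n, (ch, ext_zero ch, ext_zero ch)) \<in> ?D" for n ch
    by (auto intro: ext_zero_closed)
  show "ptime ?D (\<lambda>z. ext_zero (fst z))"
    unfolding ext_zero_def by (intro ptime_map pt_zero ptime_proj bdd_ext2) (use ext_CD in auto)
  show "ptime ?D (\<lambda>z. fst (snd z))" by (intro ptime_proj bdd_ext2)
  show "polyb {(n, (z, s)). (n, z) \<in> ?D \<and> s \<in> ext_V (fst z)} (\<lambda>n y. bs (snd y))"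
    by (rule ext_polyb_V(2)[where c = "\<lambda>y. fst (fst y)"]) auto
  show "ptime {(n, (z, s, a)). (n, z) \<in> ?D \<and> s \<in> ext_V (fst z) \<and> a \<in> set (fst (snd z))}
     (\<lambda>y. ext_add (fst (fst y)) (ext_shift (fst (fst y)) (fst (snd y)))
           (ext_smul (fst (fst y)) (snd (snd y)) (snd (snd (fst y)))))"
    if "bdd {(n, (z, s, a)). (n, z) \<in> ?D \<and> s \<in> ext_V (fst z) \<and> a \<in> set (fst (snd z))}"
    by (intro pt_ext_add pt_ext_shift pt_ext_smul ptime_proj that)
       (auto intro!: ext_shift_closed ext_smul_closed' elim: ext_mem')
qed (auto intro!: ext_zero_closed ext_add_closed ext_shift_closed ext_smul_closed intro: ext_mem')

text \<open>The result is of the same kind as the base, so the construction can be iterated: over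
  the integers modulo \<open>p\<close> it yields the presented field, and over that field the ring
  \<open>R\<close>.\<close>

lemma ext_ring_ops: "ring_ops ext_C ext_V ext_zero ext_one ext_mone ext_add ext_mul"
proof
  show "ptime ext_C ext_one" unfolding ext_one_def
    by (intro pt_ext_const pt_one ptime_proj bdd_ext_C) (use ext_CD in auto)
  show "ptime ext_C ext_mone" unfolding ext_mone_def
    by (intro pt_ext_const pt_mone ptime_proj bdd_ext_C) (use ext_CD in auto)
  show "ptime ext_C ext_zero" unfolding ext_zero_def
    by (intro ptime_map pt_zero ptime_proj bdd_ext_C) (use ext_CD in auto)
qed (fact ext_zero_closed ext_one_closed ext_mone_closed ext_add_closed ext_mul_closed bdd_ext pt_ext_add0 pt_ext_mul0)+

text \<open>Evaluation at \<open>xi\<close> respects \<open>ext_shift\<close>, because by hypothesis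
  \<open>xi ^ d\<close> has the value of its replacement; Horner's rule extends this to products.
  The modulus may be reducible, as \<open>X ^ r - b\<close> is: each of its roots gives one
  evaluation.\<close>

lemma ext_rep:
  assumes K: "cring K" and r: "rep K c f" and ch: "(n, (c, h)) \<in> ext_C"
    and xi: "xi \<in> carrier K" "xi [^]\<^bsub>K\<^esub> length h = ring.eval K (map f h) xi"
  defines "F \<equiv> \<lambda>x. ring.eval K (map f x) xi"
  shows "ring_ops.rep ext_V ext_zero ext_one ext_mone ext_add ext_mul K (c, h) F"
    and "a \<in> V c \<Longrightarrow> F (ext_const (c, h) a) = f a"
    and "a \<in> V c \<Longrightarrow> x \<in> ext_V (c, h) \<Longrightarrow> F (ext_smul (c, h) a x) = f a \<otimes>\<^bsub>K\<^esub> F x"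
    and "x \<in> ext_V (c, h) \<Longrightarrow> F (ext_shift (c, h) x) = xi \<otimes>\<^bsub>K\<^esub> F x"
proof -
  interpret K: cring K by (rule K)
  interpret ext: ring_ops ext_C ext_V ext_zero ext_one ext_mone ext_add ext_mul by (rule ext_ring_ops)
  note r = repD[OF r]
  have c: "(n, c) \<in> C" using ch by (simp add: ext_C_def)
  have F_closed: "F x \<in> carrier K" if "set x \<subseteq> V c" for x
    unfolding F_def by (rule K.eval_in_carrier) (use that r xi in auto)
  have zeros: "F (map (\<lambda>_. zero c) l @ [a]) = f a" if "a \<in> V c" for a and l :: "'a list"
    using that xi unfolding F_def by (induction l) (auto simp: r)
  show const: "F (ext_const (c, h) a) = f a" if "a \<in> V c" for a
    unfolding ext_const_def using zeros[OF that] by simp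
  have add: "F (ext_add (c, h) x y) = F x \<oplus>\<^bsub>K\<^esub> F y"
    if "set x \<subseteq> V c" "set y \<subseteq> V c" "length x = length y" for x y
    using that(3,1,2)
  proof (induction x y rule: list_induct2)
    case (Cons a x b y)
    have [simp]: "F x \<in> carrier K" "F y \<in> carrier K" "f a \<in> carrier K" "f b \<in> carrier K"
      using Cons(3,4) by (auto intro: F_closed r)
    have "F (ext_add (c, h) (a # x) (b # y)) = f (add c a b) \<otimes>\<^bsub>K\<^esub> xi [^]\<^bsub>K\<^esub> length x \<oplus>\<^bsub>K\<^esub> F (ext_add (c, h) x y)"
      using Cons(1) by (simp add: F_def ext_add_def)
    also have "\<dots> = (f a \<oplus>\<^bsub>K\<^esub> f b) \<otimes>\<^bsub>K\<^esub> xi [^]\<^bsub>K\<^esub> length x \<oplus>\<^bsub>K\<^esub> (F x \<oplus>\<^bsub>K\<^esub> F y)"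
      using Cons by (simp add: r)
    also have "\<dots> = (f a \<otimes>\<^bsub>K\<^esub> xi [^]\<^bsub>K\<^esub> length x \<oplus>\<^bsub>K\<^esub> F x) \<oplus>\<^bsub>K\<^esub> (f b \<otimes>\<^bsub>K\<^esub> xi [^]\<^bsub>K\<^esub> length x \<oplus>\<^bsub>K\<^esub> F y)"
      using xi(1) by (simp add: K.l_distr K.a_ac)
    finally show ?case using Cons(1) by (simp add: F_def)
  qed (simp add: F_def ext_add_def)
  show smul: "F (ext_smul (c, h) a x) = f a \<otimes>\<^bsub>K\<^esub> F x" if "a \<in> V c" "x \<in> ext_V (c, h)" for a x
  proof -
    have "set x \<subseteq> V c" using that by (simp add: ext_V_def)
    then show ?thesis
    proof (induction x)
      case (Cons b x)
      then have [simp]: "F x \<in> carrier K" "f b \<in> carrier K" "f a \<in> carrier K" using that by (auto intro: F_closed r)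
      have "F (ext_smul (c, h) a (b # x)) = f (mul c a b) \<otimes>\<^bsub>K\<^esub> xi [^]\<^bsub>K\<^esub> length x \<oplus>\<^bsub>K\<^esub> F (ext_smul (c, h) a x)"
        by (simp add: F_def ext_smul_def)
      also have "\<dots> = (f a \<otimes>\<^bsub>K\<^esub> f b) \<otimes>\<^bsub>K\<^esub> xi [^]\<^bsub>K\<^esub> length x \<oplus>\<^bsub>K\<^esub> f a \<otimes>\<^bsub>K\<^esub> F x"
        using Cons that r by simp
      also have "\<dots> = f a \<otimes>\<^bsub>K\<^esub> (f b \<otimes>\<^bsub>K\<^esub> xi [^]\<^bsub>K\<^esub> length x \<oplus>\<^bsub>K\<^esub> F x)"
        using xi by (simp add: K.r_distr K.m_ac)
      finally show ?case by (simp add: F_def)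
    qed (use that r in \<open>simp add: F_def ext_smul_def\<close>)
  qed
  show shift: "F (ext_shift (c, h) x) = xi \<otimes>\<^bsub>K\<^esub> F x" if x: "x \<in> ext_V (c, h)" for x
  proof -
    obtain a t where x': "x = a # t" using ext_V_nonempty[OF ch x] by (cases x) auto
    have t: "set t \<subseteq> V c" "a \<in> V c" "length h = Suc (length t)" using x x' by (auto simp: ext_V_def)
    have h: "set h \<subseteq> V c" "h \<in> ext_V (c, h)" using ch by (auto simp: ext_C_def ext_V_def)
    have [simp]: "F t \<in> carrier K" "F h \<in> carrier K" "f a \<in> carrier K" using t h by (auto intro: F_closed r)
    have snoc: "F (t @ [zero c]) = F t \<otimes>\<^bsub>K\<^esub> xi"
      unfolding F_def using K.eval_append_aux[of "map f t" "f (zero c)" xi] t xi r F_closed[OF t(1)]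
      by (auto simp: F_def)
    have "F (ext_shift (c, h) x) = F (t @ [zero c]) \<oplus>\<^bsub>K\<^esub> F (ext_smul (c, h) a h)"
      unfolding ext_shift_def x' fst_conv snd_conv list.sel
      by (rule add) (use t h c in \<open>auto simp: ext_smul_def intro: closed\<close>)
    also have "\<dots> = F t \<otimes>\<^bsub>K\<^esub> xi \<oplus>\<^bsub>K\<^esub> f a \<otimes>\<^bsub>K\<^esub> xi [^]\<^bsub>K\<^esub> length h"
      using smul[OF t(2) h(2)] snoc xi(2) by (simp add: F_def)
    also have "\<dots> = xi \<otimes>\<^bsub>K\<^esub> (f a \<otimes>\<^bsub>K\<^esub> xi [^]\<^bsub>K\<^esub> length t \<oplus>\<^bsub>K\<^esub> F t)"
      using xi(1) t(3) by (simp add: K.r_distr K.m_ac K.a_ac)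
    finally show ?thesis by (simp add: x' F_def)
  qed
  have zero: "F (ext_zero (c, h)) = \<zero>\<^bsub>K\<^esub>"
  proof -
    have "F (map (\<lambda>_. zero c) l) = \<zero>\<^bsub>K\<^esub>" for l :: "'a list"
      unfolding F_def using xi by (induction l) (auto simp: r)
    then show ?thesis by (simp add: ext_zero_def)
  qed
  have mul: "F (ext_mul (c, h) x y) = F x \<otimes>\<^bsub>K\<^esub> F y" if xy: "x \<in> ext_V (c, h)" "y \<in> ext_V (c, h)" for x y
  proof -
    have "F (foldl (\<lambda>s a. ext_add (c, h) (ext_shift (c, h) s) (ext_smul (c, h) a y)) s xs)
        = F s \<otimes>\<^bsub>K\<^esub> xi [^]\<^bsub>K\<^esub> length xs \<oplus>\<^bsub>K\<^esub> F xs \<otimes>\<^bsub>K\<^esub> F y"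
      if "set xs \<subseteq> V c" "s \<in> ext_V (c, h)" for xs s
      using that
    proof (induction xs arbitrary: s)
      case Nil
      then have "F s \<in> carrier K" by (auto simp: ext_V_def intro: F_closed)
      moreover have "F y \<in> carrier K" using xy by (auto simp: ext_V_def intro: F_closed)
      ultimately show ?case by (simp add: F_def)
    next
      case (Cons a xs)
      have m: "ext_shift (c, h) s \<in> ext_V (c, h)" "ext_smul (c, h) a y \<in> ext_V (c, h)"
        using Cons xy by (auto intro: ext_shift_closed[OF ch] ext_smul_closed[OF ch])
      have [simp]: "F s \<in> carrier K" "F y \<in> carrier K" "F xs \<in> carrier K" "f a \<in> carrier K"
        using Cons xy by (auto simp: ext_V_def intro: F_closed r)
      have "F (ext_add (c, h) (ext_shift (c, h) s) (ext_smul (c, h) a y)) = xi \<otimes>\<^bsub>K\<^esub> F s \<oplus>\<^bsub>K\<^esub> f a \<otimes>\<^bsub>K\<^esub> F y"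
        using add[of "ext_shift (c, h) s" "ext_smul (c, h) a y"] m Cons xy shift smul by (simp add: ext_V_def)
      moreover have "F (a # xs) = f a \<otimes>\<^bsub>K\<^esub> xi [^]\<^bsub>K\<^esub> length xs \<oplus>\<^bsub>K\<^esub> F xs"
        by (simp add: F_def)
      ultimately show ?case
        using Cons.IH[OF _ ext_add_closed[OF ch m]] Cons(2) xi
        by (simp add: K.r_distr K.l_distr K.m_ac K.a_ac)
    qed
    from this[of x "ext_zero (c, h)"] show ?thesis
      using xy ext_zero_closed[OF ch] xi(1) zero
      by (simp add: ext_mul_def) (simp add: ext_V_def F_closed)
  qed
  show "ext.rep K (c, h) F"
    unfolding ext.rep_def ring_rep_def
    using F_closed zero const add mul r c by (auto simp: ext_one_def ext_mone_def ext_V_def closed)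
qed

end

section \<open>The algorithm\<close>

lemma ptime_last:
  assumes "ptime D f" "\<And>n x. (n, x) \<in> D \<Longrightarrow> f x \<noteq> []"
  shows "ptime D (\<lambda>x. last (f x))"
  using ptime_hd[OF ptime_rev[OF assms(1)]] assms(2)
  by (rule_tac ptime_cong) (auto simp: hd_rev)

lemma ptime_root_order: "ptime D f \<Longrightarrow> ptime D (\<lambda>x. root_order (f x))"
  unfolding root_order_def
  by (intro ptime_if ptime_eq_nat ptime_nat) (auto intro: ptime_subset dest: ptime_bdd elim: bdd_subset)

text \<open>Equality of representatives is what the test of candidates computes. It becomes equality
  in the field once the representation is injective.\<close>

locale ring_ops_eq = ring_ops C V zero one mone add mul
  for C :: "(nat \<times> 'c::enc) set" and V :: "'c \<Rightarrow> 'a::enc set" and zero one mone add mul +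
  assumes pt_eq0: "ptime {(n, (c, x, y)). (n, c) \<in> C \<and> x \<in> V c \<and> y \<in> V c} (\<lambda>z. fst (snd z) = snd (snd z))"
begin

lemma pt_eq:
  "ptime D c \<Longrightarrow> ptime D x \<Longrightarrow> ptime D y \<Longrightarrow>
    (\<And>n z. (n, z) \<in> D \<Longrightarrow> (n, c z) \<in> C \<and> x z \<in> V (c z) \<and> y z \<in> V (c z)) \<Longrightarrow>
    ptime D (\<lambda>z. x z = y z)"
  by (rule ptime_comp3[OF pt_eq0]) auto

interpretation ext: ring_ops ext_C ext_V ext_zero ext_one ext_mone ext_add ext_mul
  by (rule ext_ring_ops)

text \<open>An environment \<open>(ch, rho, q, s, r)\<close> consists of the extension by an \<open>r\<close>-th root \<open>X\<close> of an element of
  order \<open>s\<close>, a primitive \<open>r\<close>-th root of unity \<open>rho\<close>, the order \<open>q\<close> of the group of units, \<open>s\<close> and \<open>r\<close>.\<close>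

type_synonym ('x, 'y) env = "('x \<times> 'y list) \<times> 'y \<times> nat \<times> nat \<times> nat"

definition Env :: "(nat \<times> ('c, 'a) env) set" where
  "Env = {(n, (ch, rho, q, s, r)). (n, ch) \<in> ext_C \<and> rho \<in> V (fst ch) \<and>
     floorlog 2 q \<le> n \<and> floorlog 2 s \<le> n \<and> floorlog 2 r \<le> n}"

abbreviation env_base :: "('c, 'a) env \<Rightarrow> 'c" where "env_base e \<equiv> fst (fst e)"
abbreviation env_rho :: "('c, 'a) env \<Rightarrow> 'a" where "env_rho e \<equiv> fst (snd e)"
abbreviation env_q :: "('c, 'a) env \<Rightarrow> nat" where "env_q e \<equiv> fst (snd (snd e))"
abbreviation env_s :: "('c, 'a) env \<Rightarrow> nat" where "env_s e \<equiv> fst (snd (snd (snd e)))"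
abbreviation env_r :: "('c, 'a) env \<Rightarrow> nat" where "env_r e \<equiv> snd (snd (snd (snd e)))"

lemma EnvD: "(n, e) \<in> Env \<Longrightarrow> (n, fst e) \<in> ext_C" "(n, e) \<in> Env \<Longrightarrow> (n, env_base e) \<in> C"
  "(n, e) \<in> Env \<Longrightarrow> env_rho e \<in> V (env_base e)"
  by (auto simp: Env_def ext_C_def)

lemma EnvD': "(n, ((c, h), t)) \<in> Env \<Longrightarrow> (n, (c, h)) \<in> ext_C" "(n, ((c, h), t)) \<in> Env \<Longrightarrow> (n, c) \<in> C"
  "(n, ((c, h), rho, u)) \<in> Env \<Longrightarrow> rho \<in> V c"
  by (auto simp: Env_def ext_C_def)

lemma bdd_Env_ext:
  assumes "\<And>n z. (n, z) \<in> D \<Longrightarrow> (n, fst z) \<in> Env" "polyb D (\<lambda>n z. bs (snd z))"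
  shows "bdd D"
proof (rule bddI_prod[OF _ assms(2)])
  have "polyb D (\<lambda>n z. 4 + (bs (fst (fst z)) + (bs (env_rho (fst z)) + ((1 + n) + ((1 + n) + (1 + n))))))"
    by (intro polyb_intros polyb_V(2)[where c = "\<lambda>z. env_base (fst z)"] ext.polyb_V(1)[where x = "\<lambda>z. snd (fst (fst z))"])
       (use assms(1) EnvD ext_h_closed in blast)+
  then show "polyb D (\<lambda>n z. bs (fst z))"
  proof (rule polyb_mono)
    fix n z assume "(n, z) \<in> D"
    then have "(n, fst z) \<in> Env" by (rule assms(1))
    then show "bs (fst z) \<le> 4 + (bs (fst (fst z)) + (bs (env_rho (fst z)) + ((1 + n) + ((1 + n) + (1 + n)))))"
      by (auto simp: Env_def enc_prod_def enc_nat_def)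
  qed
qed

text \<open>The coefficient of \<open>X ^ j\<close> is multiplied by \<open>rho ^ j\<close>. The
  fold starts at the constant coefficient, hence \<open>rev\<close>; its first component is the
  current power of \<open>rho\<close>, and consing restores the order.\<close>

definition conj :: "('c, 'a) env \<Rightarrow> 'a list \<Rightarrow> 'a list" where
  "conj e x = snd (foldl (\<lambda>p a. (mul (env_base e) (fst p) (env_rho e), mul (env_base e) (fst p) a # snd p))
     (one (env_base e), []) (rev x))"

text \<open>Where the conjugate has a nonzero value, the power is its inverse.\<close>

definition quot :: "('c, 'a) env \<Rightarrow> 'a list \<Rightarrow> 'a list" where
  "quot e x = ext_mul (fst e) x (ext.pow (fst e) (conj e x) (env_q e - 1))"

text \<open>The list folded over is the modulus, used as a counter: its length \<open>r\<close> is
  the number of conjugates.\<close>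

definition norm :: "('c, 'a) env \<Rightarrow> 'a list \<Rightarrow> 'a list" where
  "norm e y = fst (foldl (\<lambda>p _. (ext_mul (fst e) (fst p) (snd p), conj e (snd p))) (ext_one (fst e), y) (snd (fst e)))"

definition ext_X :: "'c \<times> 'a list \<Rightarrow> 'a list" where
  "ext_X ch = ext_shift ch (ext_one ch)"

text \<open>The power in \<open>candidate\<close> has the value 0 where \<open>v\<close> has the value \<open>g\<close>, and 1 elsewhere, so the argument of
  \<open>norm\<close> has the value \<open>X\<close> where \<open>v \<noteq> g\<close>, and 1 elsewhere. The norm is the product of the selected conjugates
  of \<open>X\<close>, hence a constant.\<close>

definition candidate :: "('c, 'a) env \<Rightarrow> 'a list \<Rightarrow> 'a \<Rightarrow> 'a" where
  "candidate e v g = last (norm e (ext_add (fst e)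
     (ext_mul (fst e)
       (ext.pow (fst e) (ext_add (fst e) v (ext_const (fst e) (mul (env_base e) (mone (env_base e)) g))) (env_q e))
       (ext_add (fst e) (ext_X (fst e)) (ext_mone (fst e))))
     (ext_one (fst e))))"

text \<open>When \<open>s\<close> is a power of the prime \<open>r\<close>, this says that the order
  of \<open>b\<close> is exactly \<open>s * r\<close>.\<close>

definition raises :: "('c, 'a) env \<Rightarrow> 'a \<Rightarrow> bool" where
  "raises e b \<longleftrightarrow> pow (env_base e) b (env_s e) \<noteq> one (env_base e) \<and>
     pow (env_base e) b (env_s e * env_r e) = one (env_base e)"

text \<open>All powers of the known root of unity are tried as \<open>g\<close>; a later candidate
  replaces a good one only if it is good itself.\<close>

definition trial :: "('c, 'a) env \<Rightarrow> 'a list \<Rightarrow> nat \<times> 'a \<Rightarrow> 'a \<Rightarrow> 'a" where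
  "trial e v lz b = foldl (\<lambda>b k. if raises e (candidate e v (pow (env_base e) (snd lz) k))
     then candidate e v (pow (env_base e) (snd lz) k) else b) b [0..<root_order (fst lz)]"

text \<open>One round consumes one prime factor \<open>l\<close> of \<open>q\<close>: it passes from \<open>v\<close> to \<open>v ^ l\<close> and looks for an element of
  larger order by means of \<open>v\<close> and of the quotient of \<open>v\<close> by its conjugate.\<close>

definition round :: "('c, 'a) env \<Rightarrow> 'a list \<times> 'a \<Rightarrow> nat \<times> 'a \<Rightarrow> 'a list \<times> 'a" where
  "round e p lz = (ext.pow (fst e) (fst p) (fst lz),
     trial e (quot e (fst p)) lz (trial e (fst p) lz (snd p)))"

text \<open>The list, \<open>r - 1\<close> zeros followed by \<open>b\<close>, is the constant
  polynomial \<open>b\<close>, so the modulus is \<open>X ^ r - b\<close>. The power of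
  \<open>b\<close> is \<open>rho\<close>.\<close>

definition step_env :: "'c \<Rightarrow> nat \<Rightarrow> nat \<Rightarrow> 'a \<Rightarrow> nat \<Rightarrow> ('c, 'a) env" where
  "step_env c q r b s = ((c, map (\<lambda>_. zero c) [0..<r - 1] @ [b]), pow c b (s div r), q, s, r)"

definition raise :: "('c, 'a) env \<Rightarrow> (nat \<times> 'a) list \<Rightarrow> 'a \<Rightarrow> 'a" where
  "raise e fs b = snd (foldl (round e) (quot e (ext_add (fst e) (ext_one (fst e)) (ext_X (fst e))), b) fs)"

definition sylow_loop :: "'c \<Rightarrow> nat \<Rightarrow> (nat \<times> 'a) list \<Rightarrow> nat \<Rightarrow> 'a \<times> nat \<Rightarrow> 'a \<times> nat" where
  "sylow_loop c q fs r = while (\<lambda>p. q mod (snd p * r) = 0) (\<lambda>p. (raise (step_env c q r (fst p) (snd p)) fs (fst p), snd p * r))"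

definition sylow_generator :: "'c \<Rightarrow> nat \<Rightarrow> (nat \<times> 'a) list \<Rightarrow> nat \<times> 'a \<Rightarrow> 'a" where
  "sylow_generator c q fs rz = fst (sylow_loop c q fs (fst rz) (snd rz, root_order (fst rz)))"

definition generator :: "'c \<Rightarrow> nat \<Rightarrow> (nat \<times> 'a) list \<Rightarrow> (nat \<times> 'a) list \<Rightarrow> 'a" where
  "generator c q fs ps = foldl (\<lambda>g rz. mul c g (sylow_generator c q fs rz)) (one c) ps"

section \<open>Closedness of the operations of the algorithm\<close>

lemma conj_closed:
  assumes "(n, e) \<in> Env" "x \<in> ext_V (fst e)"
  shows "conj e x \<in> ext_V (fst e)"
proof -
  let ?F = "foldl (\<lambda>p a. (mul (env_base e) (fst p) (env_rho e), mul (env_base e) (fst p) a # snd p))"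
  have "set (snd (?F (w, ys) xs)) \<subseteq> V (env_base e) \<and> length (snd (?F (w, ys) xs)) = length xs + length ys"
    if "set xs \<subseteq> V (env_base e)" "w \<in> V (env_base e)" "set ys \<subseteq> V (env_base e)" for xs w ys
    using that
    by (induction xs arbitrary: w ys) (use EnvD[OF assms(1)] in \<open>auto simp: mul_closed\<close>)
  from this[of "rev x" "one (env_base e)" "[]"] show ?thesis
    using assms EnvD[OF assms(1)] unfolding conj_def by (simp add: ext_V_def one_closed)
qed

lemma quot_closed: "(n, e) \<in> Env \<Longrightarrow> x \<in> ext_V (fst e) \<Longrightarrow> quot e x \<in> ext_V (fst e)"
  unfolding quot_def
  by (rule ext.mul_closed[OF EnvD(1) _ ext.pow_closed[OF EnvD(1) conj_closed]])

lemma norm_state_closed: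
  assumes "(n, e) \<in> Env" "a \<in> ext_V (fst e)" "y \<in> ext_V (fst e)"
  shows "fst (foldl (\<lambda>p _. (ext_mul (fst e) (fst p) (snd p), conj e (snd p))) (a, y) xs) \<in> ext_V (fst e)"
  using assms(2,3)
proof (induction xs arbitrary: a y)
  case (Cons b xs)
  then show ?case using EnvD[OF assms(1)] conj_closed[OF assms(1)] ext.mul_closed by simp
qed simp

lemma norm_closed: "(n, e) \<in> Env \<Longrightarrow> x \<in> ext_V (fst e) \<Longrightarrow> norm e x \<in> ext_V (fst e)"
  unfolding norm_def by (rule norm_state_closed) (auto intro: ext.one_closed EnvD)

lemma ext_X_closed: "(n, ch) \<in> ext_C \<Longrightarrow> ext_X ch \<in> ext_V ch"
  unfolding ext_X_def by (intro ext_shift_closed ext.one_closed)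

lemma candidate_arg_closed:
  assumes "(n, e) \<in> Env" "v \<in> ext_V (fst e)" "g \<in> V (env_base e)"
  shows "ext_const (fst e) (mul (env_base e) (mone (env_base e)) g) \<in> ext_V (fst e)"
    and "ext_add (fst e) v (ext_const (fst e) (mul (env_base e) (mone (env_base e)) g)) \<in> ext_V (fst e)"
    and "ext.pow (fst e) (ext_add (fst e) v (ext_const (fst e) (mul (env_base e) (mone (env_base e)) g))) (env_q e) \<in> ext_V (fst e)"
    and "ext_add (fst e) (ext_X (fst e)) (ext_mone (fst e)) \<in> ext_V (fst e)"
    and "ext_add (fst e)
     (ext_mul (fst e)
       (ext.pow (fst e) (ext_add (fst e) v (ext_const (fst e) (mul (env_base e) (mone (env_base e)) g))) (env_q e))
       (ext_add (fst e) (ext_X (fst e)) (ext_mone (fst e))))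
     (ext_one (fst e)) \<in> ext_V (fst e)"
proof -
  note E = EnvD[OF assms(1)]
  show 1: "ext_const (fst e) (mul (env_base e) (mone (env_base e)) g) \<in> ext_V (fst e)"
    by (rule ext_const_closed[OF E(1) mul_closed[OF E(2) mone_closed[OF E(2)] assms(3)]])
  show 2: "ext_add (fst e) v (ext_const (fst e) (mul (env_base e) (mone (env_base e)) g)) \<in> ext_V (fst e)"
    by (rule ext.add_closed[OF E(1) assms(2) 1])
  show 3: "ext.pow (fst e) (ext_add (fst e) v (ext_const (fst e) (mul (env_base e) (mone (env_base e)) g))) (env_q e) \<in> ext_V (fst e)"
    by (rule ext.pow_closed[OF E(1) 2])
  show 4: "ext_add (fst e) (ext_X (fst e)) (ext_mone (fst e)) \<in> ext_V (fst e)"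
    by (rule ext.add_closed[OF E(1) ext_X_closed[OF E(1)] ext.mone_closed[OF E(1)]])
  show "ext_add (fst e)
     (ext_mul (fst e)
       (ext.pow (fst e) (ext_add (fst e) v (ext_const (fst e) (mul (env_base e) (mone (env_base e)) g))) (env_q e))
       (ext_add (fst e) (ext_X (fst e)) (ext_mone (fst e))))
     (ext_one (fst e)) \<in> ext_V (fst e)"
    by (rule ext.add_closed[OF E(1) ext.mul_closed[OF E(1) 3 4] ext.one_closed[OF E(1)]])
qed

lemma candidate_closed:
  assumes "(n, e) \<in> Env" "v \<in> ext_V (fst e)" "g \<in> V (env_base e)"
  shows "candidate e v g \<in> V (env_base e)"
proof -
  note x = norm_closed[OF assms(1) candidate_arg_closed(5)[OF assms]]
  show ?thesis unfolding candidate_def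
    using x ext_V_nonempty[OF EnvD(1)[OF assms(1)] x] ext_mem[OF x] by simp
qed

lemma trial_closed:
  assumes "(n, e) \<in> Env" "v \<in> ext_V (fst e)" "snd lz \<in> V (env_base e)" "b \<in> V (env_base e)"
  shows "trial e v lz b \<in> V (env_base e)"
proof -
  have "foldl (\<lambda>b k. if raises e (candidate e v (pow (env_base e) (snd lz) k))
     then candidate e v (pow (env_base e) (snd lz) k) else b) b ks \<in> V (env_base e)" for ks
    using assms(4)
    by (induction ks arbitrary: b)
       (use candidate_closed[OF assms(1,2) pow_closed[OF EnvD(2)[OF assms(1)] assms(3)]] in auto)
  then show ?thesis by (simp add: trial_def)
qed

lemma round_closed:
  assumes "(n, e) \<in> Env" "fst p \<in> ext_V (fst e)" "snd p \<in> V (env_base e)" "snd lz \<in> V (env_base e)"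
  shows "fst (round e p lz) \<in> ext_V (fst e)" "snd (round e p lz) \<in> V (env_base e)"
  using assms EnvD[OF assms(1)]
  by (auto simp: round_def intro!: ext.pow_closed trial_closed quot_closed)

lemma rounds_closed:
  assumes "(n, e) \<in> Env" "fst p \<in> ext_V (fst e)" "snd p \<in> V (env_base e)" "\<And>lz. lz \<in> set fs \<Longrightarrow> snd lz \<in> V (env_base e)"
  shows "fst (foldl (round e) p fs) \<in> ext_V (fst e) \<and> snd (foldl (round e) p fs) \<in> V (env_base e)"
  using assms(2-) by (induction fs arbitrary: p) (use round_closed[OF assms(1)] in auto)

lemma raise_start_closed:
  "(n, e) \<in> Env \<Longrightarrow> ext_add (fst e) (ext_one (fst e)) (ext_X (fst e)) \<in> ext_V (fst e)"
  by (rule ext.add_closed[OF EnvD(1) ext.one_closed[OF EnvD(1)] ext_X_closed[OF EnvD(1)]])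

lemma raise_closed:
  assumes "(n, e) \<in> Env" "b \<in> V (env_base e)" "\<And>lz. lz \<in> set fs \<Longrightarrow> snd lz \<in> V (env_base e)"
  shows "raise e fs b \<in> V (env_base e)"
  unfolding raise_def
  using rounds_closed[OF assms(1), of "(quot e (ext_add (fst e) (ext_one (fst e)) (ext_X (fst e))), b)" fs]
    quot_closed[OF assms(1) raise_start_closed[OF assms(1)]] assms(2,3) by simp

lemma step_env_closed:
  assumes "(n, c) \<in> C" "b \<in> V c" "0 < r" "r \<le> n" "floorlog 2 q \<le> n" "floorlog 2 s \<le> n"
  shows "(n, step_env c q r b s) \<in> Env"
proof -
  have "floorlog 2 r \<le> n"
    using assms(4) less_exp[of r] by (auto simp: floorlog_2_le_iff intro: less_le_trans[OF less_exp] power_increasing)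
  then show ?thesis
    using assms by (auto simp: Env_def step_env_def ext_C_def intro: zero_closed pow_closed)
qed

section \<open>Running time of the algorithm\<close>

lemma pt_conj:
  assumes "ptime D e" "ptime D x" "\<And>n z. (n, z) \<in> D \<Longrightarrow> (n, e z) \<in> Env \<and> x z \<in> ext_V (fst (e z))"
  shows "ptime D (\<lambda>z. conj (e z) (x z))"
proof (rule ptime_comp2[OF _ assms(1,2)])
  let ?D = "{(n, (e, x)). (n, e) \<in> Env \<and> x \<in> ext_V (fst e)}"
  have bD: "bdd ?D"
    by (rule bdd_Env_ext) (auto intro!: ext.polyb_V(2)[where c = "\<lambda>z. fst (fst z)"] EnvD)
  show "ptime ?D (\<lambda>z. conj (fst z) (snd z))"
    unfolding conj_def
  proof (intro ptime_snd, rule ptime_foldl_prefix[where S = "\<lambda>n z ys p. fst p \<in> V (env_base (fst z)) \<and>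
        set (snd p) \<subseteq> V (env_base (fst z)) \<and> length (snd p) = length ys"])
    show "ptime ?D (\<lambda>z. (one (env_base (fst z)), []))"
      by (intro ptime_Pair ptime_Nil pt_one ptime_proj bD) (auto intro: EnvD)
    show "ptime ?D (\<lambda>z. rev (snd z))" by (intro ptime_rev ptime_proj bD)
    let ?S = "{(n, (z, ys, p)). (n, z) \<in> ?D \<and> (\<exists>zs. rev (snd z) = ys @ zs) \<and> fst p \<in> V (env_base (fst z)) \<and>
        set (snd p) \<subseteq> V (env_base (fst z)) \<and> length (snd p) = length ys}"
    obtain k where k: "\<And>n c x. (n, c) \<in> C \<Longrightarrow> x \<in> V c \<Longrightarrow> bs x \<le> (n + 2) ^ k"
      using V_bounded by blast
    have "polyb ?S (\<lambda>n y. 1 + ((n + 2) ^ k + (1 + n * ((n + 2) ^ k + 1))))" by (intro polyb_intros)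
    then show "polyb ?S (\<lambda>n y. bs (snd (snd y)))"
    proof (rule polyb_mono)
      fix n y assume "(n, y) \<in> ?S"
      then obtain e x ys w l where y: "y = ((e, x), ys, (w, l))" "(n, e) \<in> Env" "x \<in> ext_V (fst e)"
        "\<exists>zs. rev x = ys @ zs" "w \<in> V (env_base e)" "set l \<subseteq> V (env_base e)" "length l = length ys" by auto
      have "length ys \<le> length x" using y(4) by (metis length_append length_rev le_add1)
      then have "length l \<le> n" using y(3,7) ext_CD[OF EnvD(1)[OF y(2)]] by (simp add: ext_V_def)
      have "bs l \<le> 1 + length l * ((n + 2) ^ k + 1)"
        using k[OF EnvD(2)[OF y(2)]] y(6) by (intro bs_list_le) auto
      also have "\<dots> \<le> 1 + n * ((n + 2) ^ k + 1)"
        using \<open>length l \<le> n\<close> by (intro add_mono mult_mono) auto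
      finally show "bs (snd (snd y)) \<le> 1 + ((n + 2) ^ k + (1 + n * ((n + 2) ^ k + 1)))"
        using k[OF EnvD(2)[OF y(2)] y(5)] unfolding y(1) by simp
    qed
    let ?L = "{(n, (z, p, a)). (n, z) \<in> ?D \<and> (\<exists>ys zs. rev (snd z) = ys @ a # zs \<and> fst p \<in> V (env_base (fst z)) \<and>
        set (snd p) \<subseteq> V (env_base (fst z)) \<and> length (snd p) = length ys)}"
    have mem: "a \<in> V (env_base e)" if "rev x = ys @ a # zs" "x \<in> ext_V (fst e)" for a x ys zs and e :: "('c, 'a) env"
    proof -
      have "a \<in> set (rev x)" using that(1) by simp
      then show ?thesis using ext_mem[OF that(2)] by simp
    qed
    assume "bdd ?L"
    then show "ptime ?L (\<lambda>y. (mul (env_base (fst (fst y))) (fst (fst (snd y))) (env_rho (fst (fst y))),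
        mul (env_base (fst (fst y))) (fst (fst (snd y))) (snd (snd y)) # snd (fst (snd y))))"
      by (intro ptime_Pair ptime_Cons pt_mul ptime_proj) (auto intro: EnvD mem)
  next
    show "fst (mul (env_base (fst z)) (fst p) (env_rho (fst z)), mul (env_base (fst z)) (fst p) a # snd p) \<in> V (env_base (fst z)) \<and>
        set (snd (mul (env_base (fst z)) (fst p) (env_rho (fst z)), mul (env_base (fst z)) (fst p) a # snd p)) \<subseteq> V (env_base (fst z)) \<and>
        length (snd (mul (env_base (fst z)) (fst p) (env_rho (fst z)), mul (env_base (fst z)) (fst p) a # snd p)) = length (ys @ [a])"
      if "(n, z) \<in> ?D" "fst p \<in> V (env_base (fst z)) \<and> set (snd p) \<subseteq> V (env_base (fst z)) \<and> length (snd p) = length ys"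
        "rev (snd z) = ys @ a # zs" for n z p a ys zs
    proof -
      have "a \<in> set (rev (snd z))" using that(3) by simp
      moreover have "snd z \<in> ext_V (fst (fst z))" using that(1) by auto
      ultimately have "a \<in> V (env_base (fst z))" using ext_mem by simp
      then show ?thesis using that EnvD[of n "fst z"] by (auto simp: mul_closed)
    qed
  qed (auto intro!: one_closed elim: EnvD'(2))
qed (use assms(3) in auto)

lemma pt_quot:
  assumes "ptime D e" "ptime D x" "\<And>n z. (n, z) \<in> D \<Longrightarrow> (n, e z) \<in> Env \<and> x z \<in> ext_V (fst (e z))"
  shows "ptime D (\<lambda>z. quot (e z) (x z))"
  unfolding quot_def
  by (intro ext.pt_mul ext.pt_pow pt_conj ptime_minus ptime_nat ptime_fst ptime_snd assms(1,2) ptime_bdd[OF assms(1)])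
     (use assms(3) in \<open>auto intro: EnvD conj_closed ext.pow_closed\<close>)

lemma pt_norm:
  assumes "ptime D e" "ptime D x" "\<And>n z. (n, z) \<in> D \<Longrightarrow> (n, e z) \<in> Env \<and> x z \<in> ext_V (fst (e z))"
  shows "ptime D (\<lambda>z. norm (e z) (x z))"
proof (rule ptime_comp2[OF _ assms(1,2)])
  let ?D = "{(n, (e, x)). (n, e) \<in> Env \<and> x \<in> ext_V (fst e)}"
  have bD: "bdd ?D"
    by (rule bdd_Env_ext) (auto intro!: ext.polyb_V(2)[where c = "\<lambda>z. fst (fst z)"] EnvD)
  show "ptime ?D (\<lambda>z. norm (fst z) (snd z))"
    unfolding norm_def
  proof (intro ptime_fst, rule ptime_foldl[where S = "\<lambda>n z p. fst p \<in> ext_V (fst (fst z)) \<and> snd p \<in> ext_V (fst (fst z))"])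
    show "ptime ?D (\<lambda>z. (ext_one (fst (fst z)), snd z))"
      by (intro ptime_Pair ext.pt_one ptime_proj bD) (auto intro: EnvD)
    show "ptime ?D (\<lambda>z. snd (fst (fst z)))" by (intro ptime_proj bD)
    let ?S = "{(n, (z, p)). (n, z) \<in> ?D \<and> fst p \<in> ext_V (fst (fst z)) \<and> snd p \<in> ext_V (fst (fst z))}"
    have "polyb ?S (\<lambda>n y. 1 + (bs (fst (snd y)) + bs (snd (snd y))))"
      by (intro polyb_intros ext.polyb_V(2)[where c = "\<lambda>y. fst (fst (fst y))"]) (auto intro: EnvD)
    then show "polyb ?S (\<lambda>n y. bs (snd y))"
      by (rule polyb_mono) (simp add: enc_prod_def)
    let ?L = "{(n, (z, p, a)). (n, z) \<in> ?D \<and> (fst p \<in> ext_V (fst (fst z)) \<and> snd p \<in> ext_V (fst (fst z))) \<and> a \<in> set (snd (fst (fst z)))}"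
    assume "bdd ?L"
    then show "ptime ?L (\<lambda>y. (ext_mul (fst (fst (fst y))) (fst (fst (snd y))) (snd (fst (snd y))), conj (fst (fst y)) (snd (fst (snd y)))))"
      by (intro ptime_Pair ext.pt_mul pt_conj ptime_proj) (auto intro: EnvD)
  qed (use EnvD in \<open>auto intro!: ext.one_closed ext.mul_closed conj_closed\<close>)
qed (use assms(3) in auto)

lemma pt_ext_X:
  assumes "ptime D ch" "\<And>n z. (n, z) \<in> D \<Longrightarrow> (n, ch z) \<in> ext_C"
  shows "ptime D (\<lambda>z. ext_X (ch z))"
  unfolding ext_X_def by (intro pt_ext_shift ext.pt_one assms) (use assms(2) in \<open>auto intro: ext.one_closed\<close>)

lemma pt_candidate:
  assumes e: "ptime D e" and v: "ptime D v" and g: "ptime D g"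
    and D: "\<And>n z. (n, z) \<in> D \<Longrightarrow> (n, e z) \<in> Env \<and> v z \<in> ext_V (fst (e z)) \<and> g z \<in> V (env_base (e z))"
  shows "ptime D (\<lambda>z. candidate (e z) (v z) (g z))"
proof -
  have D': "(n, e z) \<in> Env" "v z \<in> ext_V (fst (e z))" "g z \<in> V (env_base (e z))" if "(n, z) \<in> D" for n z
    using D[OF that] by auto
  note cl = candidate_arg_closed[OF D'(1) D'(2) D'(3)]
  note E = EnvD[OF D'(1)]
  have nonempty: "norm (e z) (ext_add (fst (e z))
     (ext_mul (fst (e z))
       (ext.pow (fst (e z)) (ext_add (fst (e z)) (v z) (ext_const (fst (e z)) (mul (env_base (e z)) (mone (env_base (e z))) (g z)))) (env_q (e z)))
       (ext_add (fst (e z)) (ext_X (fst (e z))) (ext_mone (fst (e z)))))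
     (ext_one (fst (e z)))) \<noteq> []" if "(n, z) \<in> D" for n z
    using ext_V_nonempty[OF E(1) norm_closed[OF D'(1) cl(5)]] that by blast
  note facts = cl E D' mone_closed[OF E(2)] mul_closed[OF E(2) mone_closed[OF E(2)] D'(3)]
    ext.one_closed[OF E(1)] ext.mone_closed[OF E(1)] ext_X_closed[OF E(1)] ext.mul_closed[OF E(1) cl(3,4)]
  show ?thesis unfolding candidate_def
    by (intro ptime_last pt_norm ext.pt_add ext.pt_mul ext.pt_pow pt_ext_const pt_mul pt_mone pt_ext_X ext.pt_mone ext.pt_one
        ptime_fst ptime_snd e v g)
       (erule nonempty | blast intro: facts)+
qed

lemma pt_raises:
  assumes "ptime D e" "ptime D b" "\<And>n z. (n, z) \<in> D \<Longrightarrow> (n, e z) \<in> Env \<and> b z \<in> V (env_base (e z))"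
  shows "ptime D (\<lambda>z. raises (e z) (b z))"
  unfolding raises_def
  by (intro ptime_conj ptime_not pt_eq[where c = "\<lambda>z. env_base (e z)"] pt_pow pt_one ptime_times ptime_fst ptime_snd assms(1,2))
     (use assms(3) in \<open>auto intro: EnvD pow_closed one_closed\<close>)

lemma pt_trial:
  assumes "ptime D e" "ptime D v" "ptime D lz" "ptime D b"
    "\<And>n z. (n, z) \<in> D \<Longrightarrow> (n, e z) \<in> Env \<and> v z \<in> ext_V (fst (e z)) \<and> fst (lz z) \<le> n \<and>
       snd (lz z) \<in> V (env_base (e z)) \<and> b z \<in> V (env_base (e z))"
  shows "ptime D (\<lambda>z. trial (e z) (v z) (lz z) (b z))"
proof (rule ptime_comp4[OF _ assms(1-4)])
  let ?D = "{(n, (e, v, lz, b)). (n, e) \<in> Env \<and> v \<in> ext_V (fst e) \<and> fst lz \<le> n \<and> snd lz \<in> V (env_base e) \<and> b \<in> V (env_base e)}"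
  have bD: "bdd ?D"
  proof (rule bdd_Env_ext)
    have "polyb ?D (\<lambda>n z. 3 + (bs (fst (snd z)) + ((n + 2) + (bs (snd (fst (snd (snd z)))) + bs (snd (snd (snd z)))))))"
      by (intro polyb_intros ext.polyb_V(2)[where c = "\<lambda>z. fst (fst z)"] polyb_V(2)[where c = "\<lambda>z. fst (fst (fst z))"])
        (auto intro: EnvD)
    then show "polyb ?D (\<lambda>n z. bs (snd z))"
    proof (rule polyb_mono)
      fix n z assume "(n, z) \<in> ?D"
      then have "bs (fst (fst (snd (snd z)))) \<le> n + 2"
        using bs_nat_le[of "fst (fst (snd (snd z)))"] by auto
      then show "bs (snd z) \<le> 3 + (bs (fst (snd z)) + ((n + 2) + (bs (snd (fst (snd (snd z)))) + bs (snd (snd (snd z))))))"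
        by (simp add: enc_prod_def)
    qed
  qed auto
  show "ptime ?D (\<lambda>z. trial (fst z) (fst (snd z)) (fst (snd (snd z))) (snd (snd (snd z))))"
    unfolding trial_def
  proof (rule ptime_foldl[where S = "\<lambda>n z p. p \<in> V (env_base (fst z))"])
    show "ptime ?D (\<lambda>z. snd (snd (snd z)))" by (intro ptime_proj bD)
    have "polyb ?D (\<lambda>n z. n + 4)" by (intro polyb_intros)
    then have "polyb ?D (\<lambda>n z. root_order (fst (fst (snd (snd z)))))"
      by (rule polyb_mono) (auto simp: root_order_def)
    then show "ptime ?D (\<lambda>z. [0..<root_order (fst (fst (snd (snd z))))])"
      by (intro ptime_upt ptime_root_order ptime_proj bD)
    show "polyb {(n, (z, p)). (n, z) \<in> ?D \<and> p \<in> V (env_base (fst z))} (\<lambda>n y. bs (snd y))"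
      by (rule polyb_V(2)[where c = "\<lambda>y. env_base (fst (fst y))"]) (auto intro: EnvD)
    let ?L = "{(n, (z, p, a)). (n, z) \<in> ?D \<and> p \<in> V (env_base (fst z)) \<and> a \<in> set [0..<root_order (fst (fst (snd (snd z))))]}"
    let ?c = "\<lambda>y. candidate (fst (fst y)) (fst (snd (fst y))) (pow (env_base (fst (fst y))) (snd (fst (snd (snd (fst y))))) (snd (snd y)))"
    assume b: "bdd ?L"
    have pc: "ptime ?L ?c"
      by (intro pt_candidate pt_pow ptime_proj b) (auto intro: EnvD' elim!: pow_closed[rotated] EnvD'(2))
    have pr: "ptime ?L (\<lambda>y. raises (fst (fst y)) (?c y))"
      by (intro pt_raises pc ptime_proj b) (auto intro!: candidate_closed pow_closed intro: EnvD EnvD')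
    show "ptime ?L (\<lambda>y. if raises (fst (fst y)) (?c y) then ?c y else fst (snd y))"
      by (intro ptime_if pr) (rule ptime_subset[OF pc], force, intro ptime_proj bdd_subset[OF b], force)
  qed (auto intro!: candidate_closed pow_closed intro: EnvD EnvD')
qed (use assms(5) in auto)

lemma pt_round:
  assumes "ptime D e" "ptime D p" "ptime D lz"
    "\<And>n z. (n, z) \<in> D \<Longrightarrow> (n, e z) \<in> Env \<and> fst (p z) \<in> ext_V (fst (e z)) \<and> snd (p z) \<in> V (env_base (e z)) \<and> fst (lz z) \<le> n \<and>
       snd (lz z) \<in> V (env_base (e z))"
  shows "ptime D (\<lambda>z. round (e z) (p z) (lz z))"
  unfolding round_def
  by (intro ptime_Pair ext.pt_pow pt_trial pt_quot ptime_fst ptime_snd assms(1-3))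
     (use assms(4) in \<open>auto intro: EnvD quot_closed trial_closed\<close>)

lemma pt_raise:
  assumes "ptime D e" "ptime D fs" "ptime D b"
    "\<And>n z. (n, z) \<in> D \<Longrightarrow> (n, e z) \<in> Env \<and> b z \<in> V (env_base (e z)) \<and>
       (\<forall>lz\<in>set (fs z). fst lz \<le> n \<and> snd lz \<in> V (env_base (e z)))"
  shows "ptime D (\<lambda>z. raise (e z) (fs z) (b z))"
proof -
  let ?D = "{(n, (e, fs, b)). (n, e) \<in> Env \<and> b \<in> V (env_base e) \<and> (\<forall>lz\<in>set fs. fst lz \<le> n \<and> snd lz \<in> V (env_base e))}"
  obtain k where k: "\<And>n z. (n, z) \<in> D \<Longrightarrow> bs (fs z) \<le> (n + 2) ^ k"
    using ptime_bs_le[OF assms(2)] unfolding polyb_def by blast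
  let ?D' = "{(n, z) \<in> ?D. bs (fst (snd z)) \<le> (n + 2) ^ k}"
  have bD: "bdd ?D'"
  proof (rule bdd_Env_ext)
    have "polyb ?D' (\<lambda>n z. 1 + ((n + 2) ^ k + bs (snd (snd z))))"
      by (intro polyb_intros polyb_V(2)[where c = "\<lambda>z. fst (fst (fst z))"]) (auto intro: EnvD)
    then show "polyb ?D' (\<lambda>n z. bs (snd z))"
      by (rule polyb_mono) (auto simp: enc_prod_def)
  qed auto
  have "ptime ?D' (\<lambda>z. raise (fst z) (fst (snd z)) (snd (snd z)))"
    unfolding raise_def
  proof (intro ptime_snd, rule ptime_foldl[where S = "\<lambda>n z p. fst p \<in> ext_V (fst (fst z)) \<and> snd p \<in> V (env_base (fst z))"])
    show "ptime ?D' (\<lambda>z. (quot (fst z) (ext_add (fst (fst z)) (ext_one (fst (fst z))) (ext_X (fst (fst z)))), snd (snd z)))"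
      by (intro ptime_Pair pt_quot ext.pt_add ext.pt_one pt_ext_X ptime_proj bD)
         (auto intro: EnvD' raise_start_closed ext.one_closed[OF EnvD'(1)] ext_X_closed[OF EnvD'(1)])
    show "ptime ?D' (\<lambda>z. fst (snd z))" by (intro ptime_proj bD)
    let ?S = "{(n, (z, p)). (n, z) \<in> ?D' \<and> fst p \<in> ext_V (fst (fst z)) \<and> snd p \<in> V (env_base (fst z))}"
    have "polyb ?S (\<lambda>n y. 1 + (bs (fst (snd y)) + bs (snd (snd y))))"
      by (intro polyb_intros ext.polyb_V(2)[where c = "\<lambda>y. fst (fst (fst y))"] polyb_V(2)[where c = "\<lambda>y. env_base (fst (fst y))"])
         (auto intro: EnvD)
    then show "polyb ?S (\<lambda>n y. bs (snd y))"
      by (rule polyb_mono) (simp add: enc_prod_def)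
    let ?L = "{(n, (z, p, a)). (n, z) \<in> ?D' \<and> (fst p \<in> ext_V (fst (fst z)) \<and> snd p \<in> V (env_base (fst z))) \<and> a \<in> set (fst (snd z))}"
    assume "bdd ?L"
    then show "ptime ?L (\<lambda>y. round (fst (fst y)) (fst (snd y)) (snd (snd y)))"
      by (intro pt_round ptime_proj) (auto dest!: bspec)
  qed (auto intro!: quot_closed raise_start_closed round_closed dest!: bspec)
  then show ?thesis
    by (rule ptime_comp3[OF _ assms(1-3)]) (use assms(4) k in auto)
qed

text \<open>In each pass \<open>s\<close> at least doubles and its new value still divides
  \<open>q\<close>, so the bit length of \<open>q\<close> bounds the number of passes.\<close>

lemma sylow_loop_step:
  assumes "0 < q" "1 < r" "0 < s" "q mod (s * r) = (0::nat)"
  shows "floorlog 2 s < floorlog 2 (s * r)" "floorlog 2 (s * r) \<le> floorlog 2 q"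
proof -
  have "s * r \<le> q" using assms by (auto intro: dvd_imp_le simp: mod_eq_0_iff_dvd)
  then show "floorlog 2 (s * r) \<le> floorlog 2 q" by (rule floorlog_mono)
  have "floorlog 2 (s * 2) = floorlog 2 s + 1" using assms(3) by (subst compute_floorlog) simp
  moreover have "floorlog 2 (s * 2) \<le> floorlog 2 (s * r)" using assms(2) by (intro floorlog_mono) simp
  ultimately show "floorlog 2 s < floorlog 2 (s * r)" by simp
qed

lemma sylow_loop_closed:
  assumes "(n, c) \<in> C" "0 < q" "floorlog 2 q \<le> n" "\<And>lz. lz \<in> set fs \<Longrightarrow> snd lz \<in> V c" "1 < r" "r \<le> n"
    and "b \<in> V c" "0 < s" "floorlog 2 s \<le> n"
  shows "fst (sylow_loop c q fs r (b, s)) \<in> V c"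
  using assms(7-9)
proof (induction "floorlog 2 q - floorlog 2 s" arbitrary: b s rule: less_induct)
  case less
  show ?case
  proof (cases "q mod (s * r) = 0")
    case True
    note st = sylow_loop_step[OF assms(2,5) less(3) True]
    have e: "(n, step_env c q r b s) \<in> Env"
      using assms less by (intro step_env_closed) auto
    have "raise (step_env c q r b s) fs b \<in> V c"
      using raise_closed[OF e, of b fs] less(2) assms(4) by (simp add: step_env_def)
    then have "fst (sylow_loop c q fs r (raise (step_env c q r b s) fs b, s * r)) \<in> V c"
      using st assms(3,5) less(3) by (intro less(1)) auto
    then show ?thesis using True by (simp add: sylow_loop_def while_unfold[of _ _ "(b, s)"])
  next
    case False
    then show ?thesis using less(2) by (simp add: sylow_loop_def while_unfold)
  qed
qed

definition Input :: "(nat \<times> 'c \<times> nat \<times> (nat \<times> 'a) list) set" where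
  "Input = {(n, (c, q, fs)). (n, c) \<in> C \<and> 0 < q \<and> floorlog 2 q \<le> n \<and> (\<forall>lz\<in>set fs. 1 < fst lz \<and> fst lz \<le> n \<and> snd lz \<in> V c)}"

text \<open>Here \<open>r\<close> itself has to be at most \<open>n\<close>, not only its bit
  length, because \<open>r - 1\<close> zeros are written out.\<close>

lemma pt_step_env:
  assumes "ptime D c" "ptime D q" "ptime D r" "ptime D b" "ptime D s"
    "\<And>n z. (n, z) \<in> D \<Longrightarrow> (n, c z) \<in> C \<and> r z \<le> n \<and> b z \<in> V (c z)"
  shows "ptime D (\<lambda>z. step_env (c z) (q z) (r z) (b z) (s z))"
proof -
  have "polyb D (\<lambda>n z. n)" by (rule polyb_size)
  then have r: "polyb D (\<lambda>n z. r z - 1)" by (rule polyb_mono) (use assms(6) in fastforce)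
  have u: "ptime D (\<lambda>z. [0..<r z - 1])"
    by (intro ptime_upt ptime_minus ptime_nat assms(3) r ptime_bdd[OF assms(3)])
  let ?E = "{(n, (c, ks)). (n, c) \<in> C \<and> (\<exists>k\<le>n. ks = [0..<k])}"
  have bE: "bdd ?E"
  proof (rule bddI_prod)
    show "polyb ?E (\<lambda>n y. bs (fst y))"
      by (rule polyb_V(1)[where x = "\<lambda>y. zero (fst y)"]) (auto intro: zero_closed)
    have "polyb ?E (\<lambda>n y. 1 + n * ((n + 2) + 1))" by (intro polyb_intros)
    then show "polyb ?E (\<lambda>n y. bs (snd y))"
    proof (rule polyb_mono)
      fix n y assume "(n, y) \<in> ?E"
      then obtain k where k: "k \<le> n" "snd y = [0..<k]" by auto
      have "bs (snd y) \<le> 1 + length [0..<k] * ((n + 2) + 1)"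
        unfolding k(2) by (rule bs_list_le) (use k(1) bs_nat_le in \<open>fastforce intro: order_trans\<close>)
      also have "\<dots> \<le> 1 + n * ((n + 2) + 1)" using k(1) by (intro add_mono mult_mono) auto
      finally show "bs (snd y) \<le> 1 + n * ((n + 2) + 1)" .
    qed
  qed
  have "ptime ?E (\<lambda>y. map (\<lambda>_. zero (fst y)) (snd y))"
    by (intro ptime_map pt_zero ptime_proj bE) auto
  then have m: "ptime D (\<lambda>z. map (\<lambda>_. zero (c z)) [0..<r z - 1])"
  proof (rule ptime_comp2[OF _ assms(1) u])
    fix n z assume z: "(n, z) \<in> D"
    then have "r z - 1 \<le> n" "(n, c z) \<in> C" using assms(6)[OF z] by auto
    then show "(n, (c z, [0..<r z - 1])) \<in> ?E" by blast
  qed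
  show ?thesis unfolding step_env_def
    by (intro ptime_Pair ptime_append ptime_Cons ptime_Nil m pt_pow ptime_div assms(1-5) ptime_bdd[OF assms(1)])
       (use assms(6) in auto)
qed

lemma pt_sylow_generator:
  assumes "ptime D c" "ptime D q" "ptime D fs" "ptime D rz"
    and D: "\<And>n z. (n, z) \<in> D \<Longrightarrow> (n, (c z, q z, fs z)) \<in> Input \<and> snd (rz z) \<in> V (c z) \<and> 1 < fst (rz z) \<and> fst (rz z) \<le> n"
  shows "ptime D (\<lambda>z. sylow_generator (c z) (q z) (fs z) (rz z))"
proof -
  obtain k where k: "\<And>n z. (n, z) \<in> D \<Longrightarrow> bs (fs z) \<le> (n + 2) ^ k"
    using ptime_bs_le[OF assms(3)] unfolding polyb_def by blast
  \<comment> \<open>The slack in \<open>n + 3\<close> admits the initial \<open>s\<close>, which is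
    4 for the prime 2; once the loop test has succeeded, \<open>s\<close> divides \<open>q\<close>
    and the bound improves to \<open>n\<close>.\<close>
  define E where "E = {(n, (a, (b, s))). (n, fst a) \<in> Input \<and> bs (snd (snd (fst a))) \<le> (n + 2) ^ k \<and>
    1 < snd a \<and> snd a \<le> n \<and> b \<in> V (fst (fst a)) \<and> 0 < s \<and> floorlog 2 s \<le> n + 3}"
  let ?b = "\<lambda>y. fst (snd (fst (fst y))) mod (snd (snd y) * snd (fst y)) = 0"
  let ?h = "\<lambda>y. raise (step_env (fst (fst (fst y))) (fst (snd (fst (fst y)))) (snd (fst y)) (fst (snd y)) (snd (snd y)))
     (snd (snd (fst (fst y)))) (fst (snd y))"
  let ?g = "\<lambda>y. (fst y, ?h y, snd (snd y) * snd (fst y))"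
  have bE: "bdd E"
    unfolding bdd_def
  proof (rule polyb_mono)
    show "polyb E (\<lambda>n y. 5 + (bs (fst (fst (fst y))) + ((1 + n) + ((n + 2) ^ k + ((n + 2) + (bs (fst (snd y)) + (n + 4)))))))"
      by (intro polyb_intros polyb_V[where c = "\<lambda>y. fst (fst (fst y))" and x = "\<lambda>y. fst (snd y)"]) (auto simp: E_def Input_def)
    fix n y assume y: "(n, y) \<in> E"
    then have "bs (snd (fst y)) \<le> n + 2" using bs_nat_le[of "snd (fst y)"] by (auto simp: E_def)
    then show "bs y \<le> 5 + (bs (fst (fst (fst y))) + ((1 + n) + ((n + 2) ^ k + ((n + 2) + (bs (fst (snd y)) + (n + 4))))))"
      using y by (auto simp: E_def Input_def enc_prod_def enc_nat_def)
  qed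
  have st: "floorlog 2 (snd (snd y)) < floorlog 2 (snd (snd y) * snd (fst y)) \<and> floorlog 2 (snd (snd y) * snd (fst y)) \<le> floorlog 2 (fst (snd (fst (fst y))))"
    if "(n, y) \<in> E" "?b y" for n y
    using that by (intro conjI sylow_loop_step) (auto simp: E_def Input_def)
  have env: "(n, step_env (fst (fst (fst y))) (fst (snd (fst (fst y)))) (snd (fst y)) (fst (snd y)) (snd (snd y))) \<in> Env"
    if y: "(n, y) \<in> E" "?b y" for n y
  proof (rule step_env_closed)
    show "floorlog 2 (snd (snd y)) \<le> n" using st[OF y] y by (auto simp: E_def Input_def)
  qed (use y in \<open>auto simp: E_def Input_def\<close>)
  have base: "env_base (step_env c q r b s) = c" for c q r b s by (simp add: step_env_def)
  have h: "?h y \<in> V (fst (fst (fst y)))" if y: "(n, y) \<in> E" "?b y" for n y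
  proof (rule raise_closed[OF env[OF y], unfolded base])
    show "fst (snd y) \<in> V (fst (fst (fst y)))" using y by (auto simp: E_def)
    have "\<forall>lz\<in>set (snd (snd (fst (fst y)))). snd lz \<in> V (fst (fst (fst y)))"
      using y by (auto simp: E_def Input_def dest!: bspec)
    then show "snd lz \<in> V (fst (fst (fst y)))" if "lz \<in> set (snd (snd (fst (fst y))))" for lz
      using that by blast
  qed
  have w: "ptime E (while ?b ?g)"
  proof (rule ptime_while[where m = "\<lambda>_ y. floorlog 2 (fst (snd (fst (fst y)))) - floorlog 2 (snd (snd y))"])
    show "(n, ?g y) \<in> E" if y: "(n, y) \<in> E" "?b y" for n y
    proof -
      have "floorlog 2 (fst (snd (fst (fst y)))) \<le> n" using y by (auto simp: E_def Input_def)
      then show ?thesis using h[OF y] st[OF y] y by (auto simp: E_def simp del: add_2_eq_Suc')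
    qed
    show "floorlog 2 (fst (snd (fst (fst (?g y))))) - floorlog 2 (snd (snd (?g y))) < floorlog 2 (fst (snd (fst (fst y)))) - floorlog 2 (snd (snd y))"
      if y: "(n, y) \<in> E" "?b y" for n y
      using st[OF y] by (simp only: fst_conv snd_conv) arith
    show "polyb E (\<lambda>n y. floorlog 2 (fst (snd (fst (fst y)))) - floorlog 2 (snd (snd y)))"
      by (rule polyb_mono[OF polyb_size]) (auto simp: E_def Input_def)
    show "ptime E ?b" by (intro ptime_eq_nat ptime_mod ptime_times ptime_nat ptime_proj bE)
    let ?E = "{(n, y) \<in> E. ?b y}"
    have b: "bdd ?E" by (rule bdd_subset[OF bE]) auto
    have "ptime ?E ?h"
    proof (intro pt_raise pt_step_env ptime_proj b)
      fix n y assume "(n, y) \<in> ?E"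
      then have y: "(n, y) \<in> E" "?b y" by auto
      show "(n, step_env (fst (fst (fst y))) (fst (snd (fst (fst y)))) (snd (fst y)) (fst (snd y)) (snd (snd y))) \<in> Env \<and>
        fst (snd y) \<in> V (env_base (step_env (fst (fst (fst y))) (fst (snd (fst (fst y)))) (snd (fst y)) (fst (snd y)) (snd (snd y)))) \<and>
        (\<forall>lz\<in>set (snd (snd (fst (fst y)))). fst lz \<le> n \<and> snd lz \<in> V (env_base (step_env (fst (fst (fst y))) (fst (snd (fst (fst y)))) (snd (fst y)) (fst (snd y)) (snd (snd y)))))"
        unfolding base using env[OF y] y by (fastforce simp: E_def Input_def)
    qed (auto simp: E_def Input_def)
    then show "ptime ?E ?g" by (intro ptime_Pair ptime_times ptime_proj b)
  qed
  \<comment> \<open>A program has no variables, so its loop carries \<open>c\<close>,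
    \<open>q\<close>, \<open>fs\<close> and \<open>r\<close> in the state. This identifies it with
    \<open>sylow_loop\<close>, which iterates on \<open>(b, s)\<close> only.\<close>
  have fold: "snd (while ?b ?g (((c, q, fs), r), p)) = sylow_loop c q fs r p"
    if "0 < q" "1 < r" "0 < snd p" for c q fs r p
    using that(3) unfolding sylow_loop_def
  proof (induction "floorlog 2 q - floorlog 2 (snd p)" arbitrary: p rule: less_induct)
    case less
    show ?case
    proof (cases "q mod (snd p * r) = 0")
      case True
      have "snd (while ?b ?g (((c, q, fs), r), raise (step_env c q r (fst p) (snd p)) fs (fst p), snd p * r)) =
        while (\<lambda>p. q mod (snd p * r) = 0) (\<lambda>p. (raise (step_env c q r (fst p) (snd p)) fs (fst p), snd p * r))
          (raise (step_env c q r (fst p) (snd p)) fs (fst p), snd p * r)"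
        using sylow_loop_step[OF that(1,2) less(2) True] less(2) that(2) by (intro less(1)) auto
      then show ?thesis using True
        by (subst (1 2) while_unfold) simp
    next
      case False
      then show ?thesis by (subst (1 2) while_unfold) simp
    qed
  qed
  have "ptime D (\<lambda>z. (((c z, q z, fs z), fst (rz z)), snd (rz z), root_order (fst (rz z))))"
    by (intro ptime_Pair ptime_root_order ptime_fst ptime_snd assms(1-4))
  then have "ptime D (\<lambda>z. while ?b ?g (((c z, q z, fs z), fst (rz z)), snd (rz z), root_order (fst (rz z))))"
  proof (rule ptime_comp[OF _ w])
    fix n z assume z: "(n, z) \<in> D"
    have "root_order (fst (rz z)) \<le> 4 \<or> root_order (fst (rz z)) \<le> n"
      using D[OF z] by (auto simp: root_order_def)
    moreover have "(1::nat) \<le> 2 ^ n" by simp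
    ultimately have "root_order (fst (rz z)) \<le> 4 * 2 ^ n"
      using less_exp[of n] by linarith
    also have "\<dots> < 2 ^ (n + 3)" by (simp add: power_add)
    finally have "floorlog 2 (root_order (fst (rz z))) \<le> n + 3" by (simp only: floorlog_2_le_iff)
    then show "(n, (((c z, q z, fs z), fst (rz z)), snd (rz z), root_order (fst (rz z)))) \<in> E"
      using D[OF z] k[OF z] by (auto simp: E_def Input_def root_order_def simp del: add_2_eq_Suc')
  qed
  then have "ptime D (\<lambda>z. fst (snd (while ?b ?g (((c z, q z, fs z), fst (rz z)), snd (rz z), root_order (fst (rz z))))))"
    by (intro ptime_fst ptime_snd)
  then show ?thesis
  proof (rule ptime_cong)
    fix n z assume "(n, z) \<in> D"
    then show "fst (snd (while ?b ?g (((c z, q z, fs z), fst (rz z)), snd (rz z), root_order (fst (rz z))))) =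
      sylow_generator (c z) (q z) (fs z) (rz z)"
      using D[of n z] by (subst fold) (auto simp: sylow_generator_def Input_def root_order_def)
  qed
qed

lemma sylow_generator_closed:
  assumes "(n, (c, q, fs)) \<in> Input" "snd rz \<in> V c" "1 < fst rz" "fst rz \<le> n" "root_order (fst rz) \<le> q"
  shows "sylow_generator c q fs rz \<in> V c"
proof -
  have "floorlog 2 (root_order (fst rz)) \<le> floorlog 2 q" by (rule floorlog_mono) (rule assms)
  moreover have "snd lz \<in> V c" if "lz \<in> set fs" for lz
    using assms(1) that by (auto simp: Input_def)
  ultimately show ?thesis unfolding sylow_generator_def using assms
    by (intro sylow_loop_closed[of n]) (auto simp: Input_def root_order_def)
qed

lemma pt_generator:
  assumes "ptime D c" "ptime D q" "ptime D fs" "ptime D ps"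
    and D: "\<And>n z. (n, z) \<in> D \<Longrightarrow> (n, (c z, q z, fs z)) \<in> Input \<and> (\<forall>rz\<in>set (ps z). 1 < fst rz \<and> fst rz \<le> n \<and>
      root_order (fst rz) \<le> q z \<and> snd rz \<in> V (c z))"
  shows "ptime D (\<lambda>z. generator (c z) (q z) (fs z) (ps z))"
proof -
  let ?P = "\<lambda>n c q fs ps. (n, (c, q, fs)) \<in> Input \<and> (\<forall>rz\<in>set ps. 1 < fst rz \<and> fst rz \<le> n \<and> root_order (fst rz) \<le> q \<and> snd rz \<in> V c)"
  let ?f = "\<lambda>z. (c z, q z, fs z, ps z)"
  have pf: "ptime D ?f" by (intro ptime_Pair assms(1-4))
  define E where "E = {(n, ?f z) | n z. (n, z) \<in> D}"
  have E: "?P n (fst y) (fst (snd y)) (fst (snd (snd y))) (snd (snd (snd y)))" if "(n, y) \<in> E" for n y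
    using that D unfolding E_def by fastforce
  have bE: "bdd E"
    unfolding bdd_def by (rule polyb_transfer[OF ptime_bs_le[OF pf]]) (auto simp: E_def)
  have "ptime E (\<lambda>y. generator (fst y) (fst (snd y)) (fst (snd (snd y))) (snd (snd (snd y))))"
    unfolding generator_def
  proof (rule ptime_foldl[where S = "\<lambda>n y g. g \<in> V (fst y)"])
    show "ptime E (\<lambda>y. one (fst y))" by (intro pt_one ptime_proj bE) (use E in \<open>auto simp: Input_def\<close>)
    show "ptime E (\<lambda>y. snd (snd (snd y)))" by (intro ptime_proj bE)
    show "one (fst y) \<in> V (fst y)" if "(n, y) \<in> E" for n y
      using E[OF that] by (auto simp: Input_def intro: one_closed)
    have sg: "sylow_generator (fst y) (fst (snd y)) (fst (snd (snd y))) a \<in> V (fst y)"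
      if y: "(n, y) \<in> E" "a \<in> set (snd (snd (snd y)))" for n y a
      using E[OF y(1)] y(2) by (intro sylow_generator_closed[of n]) auto
    have C: "(n, fst y) \<in> C" if "(n, y) \<in> E" for n y using E[OF that] by (auto simp: Input_def)
    show "mul (fst y) g (sylow_generator (fst y) (fst (snd y)) (fst (snd (snd y))) a) \<in> V (fst y)"
      if "(n, y) \<in> E" "g \<in> V (fst y)" "a \<in> set (snd (snd (snd y)))" for n y g a
      by (rule mul_closed[OF C[OF that(1)] that(2) sg[OF that(1,3)]])
    show "polyb {(n, (y, g)). (n, y) \<in> E \<and> g \<in> V (fst y)} (\<lambda>n z. bs (snd z))"
      by (rule polyb_V(2)[where c = "\<lambda>z. fst (fst z)"]) (use C in fastforce)
    let ?L = "{(n, (y, g, a)). (n, y) \<in> E \<and> g \<in> V (fst y) \<and> a \<in> set (snd (snd (snd y)))}"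
    have L: "(n, fst z) \<in> E" "fst (snd z) \<in> V (fst (fst z))" "snd (snd z) \<in> set (snd (snd (snd (fst z))))" if "(n, z) \<in> ?L" for n z
      using that by auto
    assume b: "bdd ?L"
    show "ptime ?L (\<lambda>z. mul (fst (fst z)) (fst (snd z)) (sylow_generator (fst (fst z)) (fst (snd (fst z))) (fst (snd (snd (fst z)))) (snd (snd z))))"
    proof (intro pt_mul pt_sylow_generator ptime_proj b)
      fix n z assume "(n, z) \<in> ?L"
      note L = L[OF this]
      show "(n, fst (fst z)) \<in> C \<and> fst (snd z) \<in> V (fst (fst z)) \<and>
        sylow_generator (fst (fst z)) (fst (snd (fst z))) (fst (snd (snd (fst z)))) (snd (snd z)) \<in> V (fst (fst z))"
        using C[OF L(1)] sg[OF L(1,3)] L(2) by simp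
      show "(n, (fst (fst z), fst (snd (fst z)), fst (snd (snd (fst z))))) \<in> Input \<and>
        snd (snd (snd z)) \<in> V (fst (fst z)) \<and> 1 < fst (snd (snd z)) \<and> fst (snd (snd z)) \<le> n"
        using E[OF L(1)] L(3) by auto
    qed
  qed
  then have "ptime D (\<lambda>z. generator (fst (?f z)) (fst (snd (?f z))) (fst (snd (snd (?f z)))) (snd (snd (snd (?f z)))))"
    by (rule ptime_comp[OF pf]) (auto simp: E_def)
  then show ?thesis by simp
qed

end

section \<open>Correctness of the algorithm\<close>

lemma foldl_keep: "P s \<Longrightarrow> (\<And>s a. P s \<Longrightarrow> P (f s a)) \<Longrightarrow> P (foldl f s xs)"
  by (induction xs arbitrary: s) auto

lemma foldl_reach:
  assumes "a \<in> set xs" "\<And>s. P (f s a)" "\<And>s b. P s \<Longrightarrow> P (f s b)"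
  shows "P (foldl f s xs)"
proof -
  obtain as bs where "xs = as @ a # bs" using assms(1) by (auto dest: split_list)
  then show ?thesis using foldl_keep[of P _ f bs, OF assms(2,3)] by simp
qed

locale field_solver = ring_ops_eq C V zero one mone add mul + K: finite_field K
  for C :: "(nat \<times> 'c::enc) set" and V :: "'c \<Rightarrow> 'a::enc set" and zero one mone add mul
    and K :: "('k, 'l) ring_scheme" (structure) +
  fixes n :: nat and c :: 'c and f :: "'a \<Rightarrow> 'k"
  assumes c: "(n, c) \<in> C" and rep: "rep K c f" and inj: "inj_on f (V c)"
begin

interpretation ext: ring_ops ext_C ext_V ext_zero ext_one ext_mone ext_add ext_mul
  by (rule ext_ring_ops)

lemmas f_rep = repD[OF rep]

lemma f_pow: "x \<in> V c \<Longrightarrow> f (pow c x k) = f x [^] k"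
  by (rule rep_pow[OF K.is_cring rep c])

context
  fixes r s :: nat and b :: 'a and a :: 'k and e
  assumes b: "b \<in> V c" and step: "K.root_step r s (f b)" and N: "s * r dvd K.N"
    and a: "a \<in> carrier K" "a [^] r = f b" and rn: "r \<le> n" and Nn: "floorlog 2 K.N \<le> n"
  defines "e \<equiv> step_env c K.N r b s"
begin

definition x :: "nat \<Rightarrow> 'k" where "x i = a \<otimes> (f b [^] (s div r)) [^] i"

text \<open>The \<open>i\<close>-th projection of \<open>R\<close> onto \<open>K\<close>, since the
  points \<open>x i\<close> are the roots of \<open>X ^ r - b\<close>.\<close>

definition ev :: "nat \<Rightarrow> 'a list \<Rightarrow> 'k" where "ev i p = K.eval (map f p) (x i)"

lemma r_facts: "Factorial_Ring.prime r" "0 < r" "r dvd K.N" "0 < s"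
  using K.root_stepD[OF step] prime_gt_0_nat N by (auto intro: dvd_mult_right)

lemma x_facts: "x i \<in> carrier K" "x i \<noteq> \<zero>" "x (Suc i) = f b [^] (s div r) \<otimes> x i" "x (i + r) = x i" "x i [^] r = f b"
  "\<one> \<oplus> x i \<noteq> \<zero>"
  unfolding x_def
  using K.x_closed[OF step a] K.x_nonzero[OF step a] K.x_Suc[OF step a] K.x_periodic[OF step a] K.x_pow_r[OF step a]
    K.one_plus_x_nonzero[OF step a] by auto

lemma env_facts: "(n, e) \<in> Env" "env_base e = c" "env_q e = K.N" "env_s e = s" "env_r e = r" "length (snd (fst e)) = r"
  "fst e = (c, snd (fst e))" "(n, (c, snd (fst e))) \<in> ext_C" "f (env_rho e) = f b [^] (s div r)" "env_rho e \<in> V c"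
proof -
  have "s dvd K.N" using N by (rule dvd_mult_left)
  then have "s \<le> K.N" using K.N_pos by (rule dvd_imp_le)
  then have "floorlog 2 s \<le> n" using Nn floorlog_mono[of s K.N 2] by simp
  then show E: "(n, e) \<in> Env" unfolding e_def
    using c b r_facts rn Nn by (intro step_env_closed)
  show "env_base e = c" "env_q e = K.N" "env_s e = s" "env_r e = r" "length (snd (fst e)) = r" "fst e = (c, snd (fst e))"
    using r_facts by (auto simp: e_def step_env_def)
  then show "(n, (c, snd (fst e))) \<in> ext_C" using EnvD[OF E] by simp
  show "f (env_rho e) = f b [^] (s div r)" "env_rho e \<in> V c"
    using b c by (auto simp: e_def step_env_def f_pow intro: pow_closed)
qed

lemma ev_rep: "ext.rep K (fst e) (ev i)"
  and ev_const: "y \<in> V c \<Longrightarrow> ev i (ext_const (fst e) y) = f y"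
  and ev_shift: "p \<in> ext_V (fst e) \<Longrightarrow> ev i (ext_shift (fst e) p) = x i \<otimes> ev i p"
proof -
  have "K.eval (map f (map (\<lambda>_. zero c) l @ [b])) (x i) = f b" for l :: "nat list"
    using f_rep(1)[OF b] x_facts(1) by (induction l) (auto simp: f_rep)
  then have h: "K.eval (map f (snd (fst e))) (x i) = f b"
    by (simp add: e_def step_env_def)
  have "x i [^] length (snd (fst e)) = K.eval (map f (snd (fst e))) (x i)"
    unfolding h env_facts(6) by (rule x_facts)
  note er = ext_rep[OF K.is_cring rep env_facts(8) x_facts(1) this, folded ev_def env_facts(7)]
  show "ext.rep K (fst e) (ev i)" using er(1) by (simp add: ev_def[abs_def])
  show "y \<in> V c \<Longrightarrow> ev i (ext_const (fst e) y) = f y"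
    "p \<in> ext_V (fst e) \<Longrightarrow> ev i (ext_shift (fst e) p) = x i \<otimes> ev i p"
    using er(2,4) by auto
qed

lemmas ev_simps = ext.repD[OF ev_rep]
lemmas eC = EnvD(1)[OF env_facts(1)]

lemma ev_pow: "p \<in> ext_V (fst e) \<Longrightarrow> ev i (ext.pow (fst e) p k) = ev i p [^] k"
  by (rule ext.rep_pow[OF K.is_cring ev_rep eC])

lemma ev_X: "ev i (ext_X (fst e)) = x i"
  unfolding ext_X_def using ev_shift[OF ext.one_closed[OF eC]] x_facts(1) by (simp add: ev_simps)

lemma ev_periodic: "ev (i + r) p = ev i p"
  by (simp add: ev_def x_facts)

text \<open>Conjugation substitutes \<open>rho X\<close> for \<open>X\<close>, and
  \<open>rho\<close> times \<open>x i\<close> is the next point.\<close>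

lemma ev_conj:
  assumes p: "p \<in> ext_V (fst e)"
  shows "ev i (conj e p) = ev (Suc i) p"
proof -
  let ?F = "foldl (\<lambda>p a. (mul (env_base e) (fst p) (env_rho e), mul (env_base e) (fst p) a # snd p))"
  have cl: "ev i ys \<in> carrier K" if "set ys \<subseteq> V c" for i ys
    unfolding ev_def by (rule K.eval_in_carrier) (use that f_rep x_facts in auto)
  \<comment> \<open>In the fold, \<open>ys\<close> holds the finished lower coefficients and
    \<open>w\<close> the power of \<open>rho\<close> for the next one.\<close>
  have main: "ev i (snd (?F (w, ys) xs)) = f w \<otimes> x i [^] length ys \<otimes> ev (Suc i) (rev xs) \<oplus> ev i ys"
    if "set xs \<subseteq> V c" "w \<in> V c" "set ys \<subseteq> V c" for xs w ys
    using that
  proof (induction xs arbitrary: w ys)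
    case Nil
    then show ?case using cl[of ys i] f_rep(1) x_facts(1) by (simp add: ev_def)
  next
    case (Cons y xs)
    note [simp] = x_facts(1) f_rep(1)
    have y: "y \<in> V c" and xs: "set xs \<subseteq> V c" and w: "w \<in> V c" and ys: "set ys \<subseteq> V c" using Cons by auto
    have cls: "ev (Suc i) (rev xs) \<in> carrier K" "ev i ys \<in> carrier K"
      by (rule cl, use xs ys in simp)+
    have m: "mul c w y \<in> V c" "mul c w (env_rho e) \<in> V c"
      using y w env_facts(10) by (auto intro: mul_closed[OF c])
    have "ev i (snd (?F (w, ys) (y # xs))) =
        (f w \<otimes> f (env_rho e)) \<otimes> x i [^] Suc (length ys) \<otimes> ev (Suc i) (rev xs) \<oplus> ev i (mul c w y # ys)"
      using Cons.IH[OF xs m(2), of "mul c w y # ys"] m ys w env_facts(10) by (simp add: env_facts(2) f_rep)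
    also have "ev i (mul c w y # ys) = (f w \<otimes> f y) \<otimes> x i [^] length ys \<oplus> ev i ys"
      using w y by (simp add: ev_def f_rep)
    also have "(f w \<otimes> f (env_rho e)) \<otimes> x i [^] Suc (length ys) \<otimes> ev (Suc i) (rev xs) \<oplus> ((f w \<otimes> f y) \<otimes> x i [^] length ys \<oplus> ev i ys)
      = f w \<otimes> x i [^] length ys \<otimes> (ev (Suc i) (rev xs) \<otimes> (f (env_rho e) \<otimes> x i) \<oplus> f y) \<oplus> ev i ys"
      using cls w y env_facts(10) by (simp add: K.r_distr K.m_ac K.a_ac)
    also have "ev (Suc i) (rev xs) \<otimes> (f (env_rho e) \<otimes> x i) \<oplus> f y = ev (Suc i) (rev (y # xs))"
    proof -
      have "set (map f (rev xs)) \<subseteq> carrier K" using xs by auto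
      from K.eval_append_aux[OF this f_rep(1)[OF y] x_facts(1)[of "Suc i"]] show ?thesis
        by (simp add: ev_def x_facts(3) env_facts(9))
    qed
    finally show ?case .
  qed
  have "set (rev p) \<subseteq> V c" using p by (simp add: ext_V_def env_facts(2))
  from main[OF this one_closed[OF c], of "[]"] show ?thesis
    using p cl[of p "Suc i"] \<open>set (rev p) \<subseteq> V c\<close> unfolding conj_def env_facts(2)
    by (simp add: f_rep env_facts(2)) (simp add: ev_def)
qed

lemma ev_quot:
  assumes p: "p \<in> ext_V (fst e)"
  shows "ev i (quot e p) = ev i p \<otimes> ev (Suc i) p [^] (K.N - 1)"
  unfolding quot_def using p conj_closed[OF env_facts(1) p]
  by (simp add: ev_simps ev_pow ev_conj ext.pow_closed[OF eC] env_facts(3))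

lemma ev_norm:
  assumes p: "p \<in> ext_V (fst e)"
  shows "ev i (norm e p) = K.nprod (\<lambda>k. ev (i + k) p) r"
proof -
  let ?F = "foldl (\<lambda>p _. (ext_mul (fst e) (fst p) (snd p), conj e (snd p)))"
  have main: "fst (?F (ext_one (fst e), p) xs) \<in> ext_V (fst e) \<and> snd (?F (ext_one (fst e), p) xs) \<in> ext_V (fst e) \<and>
     (\<forall>i. ev i (fst (?F (ext_one (fst e), p) xs)) = K.nprod (\<lambda>k. ev (i + k) p) (length xs) \<and>
       ev i (snd (?F (ext_one (fst e), p) xs)) = ev (i + length xs) p)" for xs :: "'a list"
  proof (induction xs rule: rev_induct)
    case Nil
    show ?case using p ext.one_closed[OF eC] by (simp add: ev_simps)
  next
    case (snoc y xs)
    then show ?case using conj_closed[OF env_facts(1)] ext.mul_closed[OF eC] by (simp add: ev_simps ev_conj)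
  qed
  show ?thesis unfolding norm_def using main[of "snd (fst e)"] env_facts(6) by simp
qed

lemma ev_candidate_arg:
  assumes v: "v \<in> ext_V (fst e)" and g: "g \<in> V c"
  shows "ev i (ext_add (fst e)
     (ext_mul (fst e)
       (ext.pow (fst e) (ext_add (fst e) v (ext_const (fst e) (mul (env_base e) (mone (env_base e)) g))) (env_q e))
       (ext_add (fst e) (ext_X (fst e)) (ext_mone (fst e))))
     (ext_one (fst e))) = (if ev i v \<noteq> f g then x i else \<one>)"
proof -
  have g': "g \<in> V (env_base e)" using g env_facts(2) by simp
  note cl = candidate_arg_closed[OF env_facts(1) v g']
  have vi: "ev i v \<in> carrier K" "f g \<in> carrier K" using v g ev_simps f_rep by auto
  have mg: "mul c (mone c) g \<in> V c" using g by (intro mul_closed[OF c] mone_closed[OF c])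
  have d: "ev i (ext_add (fst e) v (ext_const (fst e) (mul (env_base e) (mone (env_base e)) g))) = ev i v \<ominus> f g"
    using cl v vi mg g mone_closed[OF c] by (simp add: ev_simps ev_const env_facts(2) f_rep K.l_minus K.minus_eq)
  have "ev i (ext_add (fst e)
     (ext_mul (fst e)
       (ext.pow (fst e) (ext_add (fst e) v (ext_const (fst e) (mul (env_base e) (mone (env_base e)) g))) (env_q e))
       (ext_add (fst e) (ext_X (fst e)) (ext_mone (fst e))))
     (ext_one (fst e))) = (ev i v \<ominus> f g) [^] K.N \<otimes> (x i \<oplus> \<ominus> \<one>) \<oplus> \<one>"
    using cl d ext.mul_closed[OF eC cl(3,4)] ext.one_closed[OF eC] ext_X_closed[OF eC] ext.mone_closed[OF eC]
    by (simp only: ev_simps(5,6,3,4) ev_pow ev_X env_facts(3))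
  also have "\<dots> = (if ev i v \<noteq> f g then x i else \<one>)"
  proof (cases "ev i v = f g")
    case True
    then show ?thesis using vi x_facts(1) K.zero_pow[OF K.N_pos] by (simp add: K.minus_eq K.r_neg)
  next
    case False
    then have "(ev i v \<ominus> f g) [^] K.N = \<one>" using vi by (intro K.pow_N) auto
    then show ?thesis using False x_facts(1) by (simp add: K.a_assoc K.l_neg)
  qed
  finally show ?thesis .
qed

text \<open>The product runs over a full period, so the norm has the same value at every
  \<open>x i\<close>; by \<open>last_coeff_of_constant\<close> this value is its last
  coefficient.\<close>

lemma f_candidate:
  assumes v: "v \<in> ext_V (fst e)" and g: "g \<in> V c"
  shows "f (candidate e v g) = K.nprod (\<lambda>k. if ev k v \<noteq> f g then x k else \<one>) r"
proof -
  let ?y = "\<lambda>k. if ev k v \<noteq> f g then x k else \<one>"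
  have g': "g \<in> V (env_base e)" using g env_facts(2) by simp
  note cl = candidate_arg_closed(5)[OF env_facts(1) v g']
  define p where "p = norm e (ext_add (fst e)
     (ext_mul (fst e)
       (ext.pow (fst e) (ext_add (fst e) v (ext_const (fst e) (mul (env_base e) (mone (env_base e)) g))) (env_q e))
       (ext_add (fst e) (ext_X (fst e)) (ext_mone (fst e))))
     (ext_one (fst e)))"
  have p: "p \<in> ext_V (fst e)" unfolding p_def by (rule norm_closed[OF env_facts(1) cl])
  have "ev i p = K.nprod (\<lambda>k. ?y (i + k)) r" for i
    unfolding p_def ev_norm[OF cl] ev_candidate_arg[OF v g] ..
  moreover have "K.nprod (\<lambda>k. ?y (i + k)) r = K.nprod ?y r" for i
    using K.nprod_rotate[of ?y r i] x_facts ev_periodic by simp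
  ultimately have evp: "K.eval (map f p) (x i) = K.nprod ?y r" for i by (simp add: ev_def)
  have "p \<noteq> []" by (rule ext_V_nonempty[OF eC p])
  have "last (map f p) = K.nprod ?y r"
  proof (rule K.last_coeff_of_constant[OF step a])
    show "set (map f p) \<subseteq> carrier K" using p f_rep by (auto simp: ext_V_def env_facts(2))
    show "length (map f p) \<le> r" using p env_facts(6) by (simp add: ext_V_def)
  qed (use \<open>p \<noteq> []\<close> evp r_facts in \<open>auto simp: x_def\<close>)
  then show ?thesis using \<open>p \<noteq> []\<close> by (simp add: candidate_def last_map flip: p_def)
qed

lemma raises_iff: "y \<in> V c \<Longrightarrow> raises e y \<longleftrightarrow> f y [^] s \<noteq> \<one> \<and> f y [^] (s * r) = \<one>"
proof -
  assume y: "y \<in> V c"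
  have *: "pow c y k = one c \<longleftrightarrow> f y [^] k = \<one>" for k
    using inj_on_eq_iff[OF inj pow_closed[OF c y] one_closed[OF c]] f_pow[OF y] f_rep(3) by metis
  show ?thesis unfolding raises_def env_facts(2,4,5) using * by simp
qed

lemma trial_keep: "raises e y \<Longrightarrow> raises e (trial e v lz y)"
  unfolding trial_def by (rule foldl_keep) auto

lemma round_keep: "raises e (snd p) \<Longrightarrow> raises e (snd (round e p lz))"
  unfolding round_def by (auto intro: trial_keep)

text \<open>The value of \<open>v\<close> at index 0 is a power \<open>g\<close> of the known root
  of unity. For this \<open>g\<close> index 0 is not selected, while nonconstancy selects another
  one, so the selection is proper and nonempty.\<close>

lemma trial_raises:
  assumes v: "v \<in> ext_V (fst e)" and lz: "snd lz \<in> V c" "f (snd lz) \<in> carrier K.Kx" "K.mult.ord (f (snd lz)) = root_order (fst lz)"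
    and pos: "0 < root_order (fst lz)"
    and mu: "\<And>i. ev i v [^] root_order (fst lz) = \<one>" and nonconst: "ev j v \<noteq> ev 0 v"
  shows "raises e (trial e v lz y)"
proof -
  have evK: "ev i v \<in> carrier K" for i using ev_simps v by simp
  obtain k where k: "k < root_order (fst lz)" "ev 0 v = f (snd lz) [^] k"
    using K.root_of_unity_is_power[OF lz(2,3) pos evK[of 0] mu] by blast
  define g where "g = pow c (snd lz) k"
  have g: "g \<in> V c" "f g = ev 0 v" using lz(1) k(2) by (auto simp: g_def f_pow intro: pow_closed[OF c])
  have j: "j mod r < r" "ev (j mod r) v \<noteq> f g"
    using r_facts nonconst K.periodic_mod[of "\<lambda>i. ev i v" r j] ev_periodic g by auto
  have "raises e (candidate e v g)"
  proof -
    have "candidate e v g \<in> V c"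
      using candidate_closed[OF env_facts(1) v, of g] g env_facts(2) by simp
    moreover note K.selected_product[OF step a, of "j mod r" "\<lambda>k. ev k v \<noteq> f g" 0, folded x_def]
    ultimately show ?thesis using j r_facts g by (simp add: raises_iff f_candidate[OF v g(1)])
  qed
  then show ?thesis unfolding trial_def
    by (rule_tac foldl_reach[of k]) (use k in \<open>auto simp: g_def env_facts(2)\<close>)
qed

text \<open>The decisive round is that of the prime \<open>l\<close> at which the powers become
  constant. Its list \<open>v\<close> depends only on the primes before it, not on the elements
  found so far, and later rounds retain a success.\<close>

lemma raise_correct:
  assumes fs: "\<And>lz. lz \<in> set fs \<Longrightarrow> Factorial_Ring.prime (fst lz) \<and> snd lz \<in> V c \<and> f (snd lz) \<in> carrier K.Kx \<and>
      K.mult.ord (f (snd lz)) = root_order (fst lz)"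
    and prod: "K.N dvd prod_list (map fst fs)"
  shows "raises e (raise e fs y)"
proof -
  define w where "w = ext_add (fst e) (ext_one (fst e)) (ext_X (fst e))"
  define u where "u i = ev i (quot e w)" for i
  have w: "w \<in> ext_V (fst e)" unfolding w_def by (rule raise_start_closed[OF env_facts(1)])
  have qw: "quot e w \<in> ext_V (fst e)" by (rule quot_closed[OF env_facts(1) w])
  have evw: "ev i w = \<one> \<oplus> x i" for i
    using ext.one_closed[OF eC] ext_X_closed[OF eC] by (simp add: w_def ev_simps ev_X)
  have quot: "ev i (quot e p) \<otimes> ev (Suc i) p = ev i p" if "p \<in> ext_V (fst e)" "ev (Suc i) p \<noteq> \<zero>" for i p
    unfolding ev_quot[OF that(1)] using that ev_simps by (intro K.quotient_pow) auto
  have u: "u i \<in> carrier K" "u i \<otimes> (\<one> \<oplus> x (Suc i)) = \<one> \<oplus> x i" for i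
    using quot[OF w, of i] x_facts(6)[of "Suc i"] ev_simps(1)[OF qw] by (simp_all only: u_def evw not_False_eq_True)
  have u0: "u i \<noteq> \<zero>" for i
  proof
    assume "u i = \<zero>"
    then have "\<one> \<oplus> x i = \<zero>"
      using u(2)[of i] x_facts(1)[of "Suc i"] by (metis K.l_null K.a_closed K.one_closed)
    then show False using x_facts(6) by simp
  qed
  \<comment> \<open>\<open>N\<close>-th powers of units are 1 and \<open>N\<close> divides the
    product of the primes in \<open>fs\<close>, so the chain of powers ends at a constant.\<close>
  have uN: "u i [^] prod_list (map fst fs) = \<one>" for i
  proof -
    obtain m where m: "prod_list (map fst fs) = K.N * m" using prod by blast
    have "u i [^] (K.N * m) = (u i [^] K.N) [^] m" using u by (simp add: K.nat_pow_pow)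
    then show ?thesis using K.pow_N[OF u(1) u0] by (simp add: m)
  qed
  have "u 1 \<noteq> u 0"
    by (rule K.quotients_nonconstant[OF step a]) (use u in \<open>auto simp: x_def\<close>)
  then obtain ks l ms where split: "map fst fs = ks @ l # ms"
    and nonconst: "\<exists>i. u i [^] prod_list ks \<noteq> u 0 [^] prod_list ks"
    and const: "\<forall>i. u i [^] prod_list (ks @ [l]) = u 0 [^] prod_list (ks @ [l])"
    using K.power_chain[of u "map fst fs", OF u(1) uN] by blast
  obtain as lz bs where fs': "fs = as @ lz # bs" "ks = map fst as" "l = fst lz"
    using split by (auto simp: map_eq_append_conv map_eq_Cons_conv)
  note lz = fs[of lz, unfolded fs'(1), simplified]
  define p where "p = foldl (round e) (quot e w, y) as"
  \<comment> \<open>The list component runs through the powers of the starting quotient, whatever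
    element \<open>y\<close> accompanies it.\<close>
  have p: "fst (foldl (round e) (quot e w, y) as) \<in> ext_V (fst e) \<and>
      (\<forall>i. ev i (fst (foldl (round e) (quot e w, y) as)) = u i [^] prod_list (map fst as))" for as :: "(nat \<times> 'a) list"
  proof (induction as rule: rev_induct)
    case Nil
    then show ?case using qw u by (simp add: u_def)
  next
    case (snoc z as)
    then show ?case using ext.pow_closed[OF eC] u
      by (simp add: round_def ev_pow K.nat_pow_pow)
  qed
  define v where "v = fst p"
  have v: "v \<in> ext_V (fst e)" "ev i v = u i [^] prod_list ks" for i
    using p[of as] by (auto simp: v_def p_def fs'(2))
  have v0: "ev i v \<noteq> \<zero>" for i using u u0 by (simp add: v)
  have one: "K.nprod (\<lambda>i. ev i v) r = \<one>"
  proof -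
    have "K.nprod u r = \<one>"
      by (rule K.nprod_quotient[of "\<lambda>i. \<one> \<oplus> x i"]) (use x_facts u in auto)
    then show ?thesis using K.nprod_pow[OF u(1)] by (simp add: v)
  qed
  have qv: "quot e v \<in> ext_V (fst e)" by (rule quot_closed[OF env_facts(1) v(1)])
  have pos: "0 < root_order (fst lz)" using lz prime_gt_0_nat by (auto simp: root_order_def)
  obtain i0 where i0: "ev i0 v \<noteq> ev 0 v" using nonconst v by auto
  have dich: "(\<forall>i. ev i (quot e v) [^] l = \<one>) \<and> (\<exists>i. ev i (quot e v) \<noteq> ev 0 (quot e v)) \<or>
      (\<forall>i. ev i v [^] root_order l = \<one>)"
  proof (rule K.nonconstant_roots_of_unity[where r = r])
    show "ev i v [^] l = ev 0 v [^] l" for i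
      using const u by (simp add: v K.nat_pow_pow)
    show "ev i (quot e v) \<otimes> ev (Suc i) v = ev i v" for i by (rule quot[OF v(1) v0])
    show "ev i v \<in> carrier K" "ev (i + r) v = ev i v" "ev i (quot e v) \<in> carrier K" for i
      by (rule ev_simps(1)[OF v(1)], rule ev_periodic, rule ev_simps(1)[OF qv])
    show "Factorial_Ring.prime l" using lz fs' by simp
  qed (fact v0 one r_facts(1) i0)+
  have "raises e (snd (round e p lz))"
  proof (cases "\<forall>i. ev i v [^] root_order l = \<one>")
    case True
    have "raises e (trial e v lz (snd p))"
      by (rule trial_raises[OF v(1)]) (use lz pos True i0 fs' in auto)
    then show ?thesis by (simp add: round_def v_def trial_keep)
  next
    case False
    then obtain j where j: "ev j (quot e v) \<noteq> ev 0 (quot e v)" "\<forall>i. ev i (quot e v) [^] l = \<one>" using dich by blast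
    \<comment> \<open>For \<open>l = 2\<close> the known root of unity has order 4, and square roots
      of unity are fourth roots of unity too.\<close>
    have mu: "ev i (quot e v) [^] root_order l = \<one>" for i
    proof (cases "l = 2")
      case True
      have "ev i (quot e v) [^] (4::nat) = (ev i (quot e v) [^] l) [^] (2::nat)"
        using True ev_simps qv by (simp add: K.nat_pow_pow)
      then show ?thesis using j True by (simp add: root_order_def)
    qed (use j in \<open>simp add: root_order_def\<close>)
    have "raises e (trial e (quot e v) lz y)" for y
      by (rule trial_raises[OF qv]) (use lz pos mu j fs' in auto)
    then show ?thesis by (simp add: round_def v_def)
  qed
  then have "raises e (snd (foldl (round e) (round e p lz) bs))"
    by (rule foldl_keep[where P = "\<lambda>p. raises e (snd p)"]) (rule round_keep)
  then show ?thesis unfolding raise_def by (simp add: fs'(1) p_def flip: w_def)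
qed

end

lemma raise_root_step:
  assumes b: "b \<in> V c" and step: "K.root_step r s (f b)" and N: "s * r dvd K.N"
    and rn: "r \<le> n" and Nn: "floorlog 2 K.N \<le> n"
    and fs: "\<And>lz. lz \<in> set fs \<Longrightarrow> Factorial_Ring.prime (fst lz) \<and> snd lz \<in> V c \<and> f (snd lz) \<in> carrier K.Kx \<and>
      K.mult.ord (f (snd lz)) = root_order (fst lz)"
    and prod: "K.N dvd prod_list (map fst fs)"
  shows "raise (step_env c K.N r b s) fs b \<in> V c \<and> K.root_step r (s * r) (f (raise (step_env c K.N r b s) fs b))"
proof -
  note st = K.root_stepD[OF step]
  \<comment> \<open>This makes the power of \<open>f b\<close> with exponent \<open>N div r\<close>
    trivial, so that \<open>f b\<close> has an \<open>r\<close>-th root.\<close>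
  have "s dvd K.N div r" using N st(2,3) by (auto elim!: dvdE)
  then obtain m where m: "K.N div r = s * m" by blast
  have "f b [^] (K.N div r) = (f b [^] s) [^] m" by (simp only: m K.nat_pow_pow[OF st(4)])
  also have "\<dots> = \<one>" unfolding st(6) by simp
  finally have "f b [^] (K.N div r) = \<one>" .
  then obtain a where a: "a \<in> carrier K" "a [^] r = f b"
    using K.ex_root[OF dvd_mult_right[OF N] st(4,5)] by blast
  note facts = b step N a rn Nn
  have cl: "raise (step_env c K.N r b s) fs b \<in> V c"
    using raise_closed[OF env_facts(1)[OF facts], of b fs] b fs by (simp add: env_facts(2)[OF facts])
  have "raises (step_env c K.N r b s) (raise (step_env c K.N r b s) fs b)"
    by (rule raise_correct[OF facts]) (use fs prod in auto)
  then have "f (raise (step_env c K.N r b s) fs b) [^] s \<noteq> \<one> \<and> f (raise (step_env c K.N r b s) fs b) [^] (s * r) = \<one>"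
    using raises_iff[OF facts cl] by blast
  moreover obtain k where "0 < k" "s = r ^ k" using step by (auto simp: K.root_step_def)
  then have "s * r = r ^ Suc k" by simp
  ultimately show ?thesis using cl f_rep(1)[OF cl] st(1) prime_gt_0_nat[OF st(1)]
    unfolding K.root_step_def by (auto intro!: exI[of _ "Suc k"] simp: mult.commute[of _ r])
qed

lemma sylow_loop_correct:
  assumes rn: "r \<le> n" and Nn: "floorlog 2 K.N \<le> n"
    and fs: "\<And>lz. lz \<in> set fs \<Longrightarrow> Factorial_Ring.prime (fst lz) \<and> snd lz \<in> V c \<and> f (snd lz) \<in> carrier K.Kx \<and>
      K.mult.ord (f (snd lz)) = root_order (fst lz)"
    and prod: "K.N dvd prod_list (map fst fs)"
    and b: "b \<in> V c" "K.root_step r s (f b)" "s dvd K.N"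
  shows "\<exists>y s'. sylow_loop c K.N fs r (b, s) = (y, s') \<and> y \<in> V c \<and> K.root_step r s' (f y) \<and> s' dvd K.N \<and> \<not> s' * r dvd K.N"
  using b
proof (induction "K.N - s" arbitrary: b s rule: less_induct)
  case less
  note st = K.root_stepD[OF less(3)]
  show ?case
  proof (cases "s * r dvd K.N")
    case True
    note rs = raise_root_step[OF less(2,3) True rn Nn fs prod]
    have "s * r \<le> K.N" using True K.N_pos by (rule dvd_imp_le)
    moreover have "s < s * r" using st(3) prime_gt_1_nat[OF st(1)] by simp
    ultimately have "K.N - s * r < K.N - s" by linarith
    from less(1)[OF this] rs True show ?thesis
      by (simp add: sylow_loop_def while_unfold[of _ _ "(b, s)"] mod_eq_0_iff_dvd)
  next
    case False
    then show ?thesis using less by (simp add: sylow_loop_def while_unfold mod_eq_0_iff_dvd)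
  qed
qed

theorem generator_correct:
  assumes Nn: "floorlog 2 K.N \<le> n"
    and fs: "\<And>lz. lz \<in> set fs \<union> set ps \<Longrightarrow> Factorial_Ring.prime (fst lz) \<and> fst lz \<le> n \<and> snd lz \<in> V c \<and> f (snd lz) \<in> carrier K.Kx \<and>
      K.mult.ord (f (snd lz)) = root_order (fst lz)"
    and prod: "K.N dvd prod_list (map fst fs)"
    and ps: "distinct (map fst ps)" "fst ` set ps = {r. Factorial_Ring.prime r \<and> r dvd K.N}"
  shows "generator c K.N fs ps \<in> V c" "primitive_element K (f (generator c K.N fs ps))"
proof -
  have gen: "sylow_generator c K.N fs lz \<in> V c \<and>
      (\<exists>s. K.root_step (fst lz) s (f (sylow_generator c K.N fs lz)) \<and> s dvd K.N \<and> \<not> s * fst lz dvd K.N)"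
    if lz: "lz \<in> set ps" for lz
  proof -
    define z where "z = root_order (fst lz)"
    have l: "Factorial_Ring.prime (fst lz)" "fst lz \<le> n" "snd lz \<in> V c" "f (snd lz) \<in> carrier K.Kx" "K.mult.ord (f (snd lz)) = z"
      using fs[of lz] lz by (auto simp: z_def)
    have l1: "1 < fst lz" using prime_gt_1_nat[OF l(1)] .
    have zl: "z = fst lz ^ (if fst lz = 2 then 2 else 1)" by (simp add: z_def root_order_def)
    have z: "0 < z div fst lz" "z div fst lz < z" using zl l1 by (auto split: if_splits)
    have "K.root_step (fst lz) z (f (snd lz))"
      unfolding K.root_step_def
    proof (intro conjI)
      show "\<exists>k>0. z = fst lz ^ k" unfolding zl by (intro exI[of _ "if fst lz = 2 then 2 else 1"]) simp
      show "f (snd lz) [^] z = \<one>" using K.mult.pow_eq_id[OF l(4)] l(5) by simp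
      show "f (snd lz) [^] (z div fst lz) \<noteq> \<one>" using K.mult.pow_eq_id[OF l(4)] l(5) z by (auto dest: dvd_imp_le)
    qed (use l f_rep(1) in auto)
    moreover have "z dvd K.N" using K.dvd_N_iff_ord[OF l(4)] l(5) by simp
    ultimately obtain y s where "sylow_loop c K.N fs (fst lz) (snd lz, z) = (y, s)" "y \<in> V c" "K.root_step (fst lz) s (f y)"
      "s dvd K.N" "\<not> s * fst lz dvd K.N"
      using sylow_loop_correct[OF l(2) Nn _ prod l(3), of z] fs by blast
    then show ?thesis by (auto simp: sylow_generator_def simp flip: z_def)
  qed
  \<comment> \<open>\<open>primitive_element_product\<close> expects a function of the prime alone,
    so the root of unity is looked up in \<open>ps\<close>; distinctness of the primes makes the
    lookup return the intended entry.\<close>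
  define F where "F r = f (sylow_generator c K.N fs (r, the (map_of ps r)))" for r
  have F: "F (fst lz) = f (sylow_generator c K.N fs lz)" if "lz \<in> set ps" for lz
  proof -
    have "map_of ps (fst lz) = Some (snd lz)" using that ps(1) by (simp add: map_of_is_SomeI)
    then show ?thesis by (simp add: F_def)
  qed
  have fold: "foldl (\<lambda>g rz. mul c g (sylow_generator c K.N fs rz)) g qs \<in> V c \<and>
      f (foldl (\<lambda>g rz. mul c g (sylow_generator c K.N fs rz)) g qs) = foldl (\<lambda>g r. g \<otimes> F r) (f g) (map fst qs)"
    if "set qs \<subseteq> set ps" "g \<in> V c" for qs g
    using that by (induction qs arbitrary: g) (use gen F mul_closed[OF c] in \<open>auto simp: f_rep\<close>)
  show "generator c K.N fs ps \<in> V c"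
    unfolding generator_def using fold[of ps "one c"] one_closed[OF c] by simp
  have "primitive_element K (foldl (\<lambda>g r. g \<otimes> F r) \<one> (map fst ps))"
  proof -
    have "\<forall>r\<in>set (map fst ps). \<exists>s. K.root_step r s (F r) \<and> s dvd K.N \<and> \<not> s * r dvd K.N"
      using gen F by fastforce
    then obtain S where "\<forall>r\<in>set (map fst ps). K.root_step r (S r) (F r) \<and> S r dvd K.N \<and> \<not> S r * r dvd K.N"
      by metis
    then show ?thesis using ps by (intro K.primitive_element_product[of _ S]) auto
  qed
  then show "primitive_element K (f (generator c K.N fs ps))"
    unfolding generator_def using fold[of ps "one c"] one_closed[OF c] by (simp add: f_rep)
qed

end

section \<open>Presented fields\<close>

definition zp_C :: "(nat \<times> nat) set" where
  "zp_C = {(n, p). 1 < p \<and> floorlog 2 p \<le> n}"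

definition zp_V :: "nat \<Rightarrow> nat set" where
  "zp_V p = {..<p}"

lemma bs_zp: "(n, p) \<in> zp_C \<Longrightarrow> x \<in> zp_V p \<Longrightarrow> bs x \<le> 1 + n" "(n, p) \<in> zp_C \<Longrightarrow> bs p \<le> 1 + n"
proof -
  assume p: "(n, p) \<in> zp_C"
  show "bs p \<le> 1 + n" using p by (simp add: zp_C_def enc_nat_def)
  assume "x \<in> zp_V p"
  then have "floorlog 2 x \<le> floorlog 2 p" by (intro floorlog_mono) (simp add: zp_V_def)
  then show "bs x \<le> 1 + n" using p by (simp add: zp_C_def enc_nat_def)
qed

lemma zp_ring_ops: "ring_ops zp_C zp_V (\<lambda>_. 0) (\<lambda>_. 1) (\<lambda>p. p - 1) (\<lambda>p x y. (x + y) mod p) (\<lambda>p x y. x * y mod p)"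
proof
  let ?E = "{(n, (c, x)). (n, c) \<in> zp_C \<and> x \<in> zp_V c}"
  show "bdd ?E"
  proof (rule bddI_prod)
    have n: "polyb ?E (\<lambda>n y. 1 + n)" by (intro polyb_intros)
    show "polyb ?E (\<lambda>n y. bs (fst y))" by (rule polyb_mono[OF n]) (auto dest: bs_zp)
    show "polyb ?E (\<lambda>n y. bs (snd y))" by (rule polyb_mono[OF n]) (auto dest: bs_zp)
  qed
  have bC: "bdd zp_C" unfolding bdd_def
  proof (rule polyb_mono)
    show "polyb zp_C (\<lambda>n y. 1 + n)" by (intro polyb_intros)
  qed (rule bs_zp)
  show "ptime zp_C (\<lambda>_. 0::nat)" "ptime zp_C (\<lambda>_. 1::nat)" "ptime zp_C (\<lambda>p. p - 1)"
    by (intro ptime_nat ptime_minus ptime_id bC)+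
  let ?D = "{(n, (c, x, y)). (n, c) \<in> zp_C \<and> x \<in> zp_V c \<and> y \<in> zp_V c}"
  have bD: "bdd ?D" unfolding bdd_def
  proof (rule polyb_mono)
    show "polyb ?D (\<lambda>n y. 2 + ((1 + n) + ((1 + n) + (1 + n))))" by (intro polyb_intros)
    fix n y assume "(n, y) \<in> ?D"
    then obtain c u v where y: "y = (c, u, v)" "(n, c) \<in> zp_C" "u \<in> zp_V c" "v \<in> zp_V c" by auto
    show "bs y \<le> 2 + ((1 + n) + ((1 + n) + (1 + n)))"
      using bs_zp(1)[OF y(2,3)] bs_zp(1)[OF y(2,4)] bs_zp(2)[OF y(2)] unfolding y(1) by simp
  qed
  show "ptime ?D (\<lambda>z. (fst (snd z) + snd (snd z)) mod fst z)" "ptime ?D (\<lambda>z. fst (snd z) * snd (snd z) mod fst z)"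
    by (intro ptime_mod ptime_plus ptime_times ptime_proj bD)+
qed (auto simp: zp_C_def zp_V_def)

interpretation zp: ring_ops zp_C zp_V "\<lambda>_. 0" "\<lambda>_. 1" "\<lambda>p. p - 1" "\<lambda>p x y. (x + y) mod p" "\<lambda>p x y. x * y mod p"
  by (rule zp_ring_ops)

lemma ptime_eq_list:
  assumes x: "ptime D x" and y: "ptime D y" and len: "\<And>n z. (n, z) \<in> D \<Longrightarrow> length (x z) = length (y z)"
  shows "ptime D (\<lambda>z. x z = (y z :: nat list))"
proof -
  have fold: "foldl (\<lambda>s q. s \<and> fst q = snd q) b (zip u v) \<longleftrightarrow> b \<and> u = v" if "length u = length v" for b and u v :: "nat list"
    using that by (induction u v arbitrary: b rule: list_induct2) auto
  have "ptime D (\<lambda>z. foldl (\<lambda>s q. s \<and> fst q = snd q) True (zip (x z) (y z)))"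
  proof (rule ptime_foldl[where S = "\<lambda>_ _ _. True"])
    show "ptime D (\<lambda>z. True)" by (rule ptime_bool[OF ptime_bdd[OF x]])
    show "ptime D (\<lambda>z. zip (x z) (y z))" by (rule ptime_zip[OF x y len])
    have "bs (b::bool) \<le> 2" for b by (cases b) (auto simp: enc_bool_def floorlog_def)
    then show "polyb {(n, (z, s :: bool)). (n, z) \<in> D \<and> True} (\<lambda>n y. bs (snd y))"
      by (intro polyb_mono[OF polyb_const[of _ 2]])
    let ?L = "{(n, (z, s, a)). (n, z) \<in> D \<and> True \<and> a \<in> set (zip (x z) (y z))} :: (nat \<times> 'a \<times> bool \<times> nat \<times> nat) set"
    show "ptime ?L (\<lambda>y. fst (snd y) \<and> fst (snd (snd y)) = snd (snd (snd y)))" if "bdd ?L"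
      by (intro ptime_conj ptime_eq_nat ptime_proj that)
  qed auto
  then show ?thesis by (rule ptime_cong) (simp add: fold len)
qed

lemma fld_ring_ops: "ring_ops_eq zp.ext_C zp.ext_V zp.ext_zero zp.ext_one zp.ext_mone zp.ext_add zp.ext_mul"
proof (intro ring_ops_eq.intro zp.ext_ring_ops ring_ops_eq_axioms.intro)
  show "ptime {(n, (c, x, y)). (n, c) \<in> zp.ext_C \<and> x \<in> zp.ext_V c \<and> y \<in> zp.ext_V c} (\<lambda>z. fst (snd z) = snd (snd z))"
    by (intro ptime_eq_list ptime_proj zp.bdd_ext2) (auto simp: zp.ext_V_def)
qed

interpretation fld: ring_ops_eq zp.ext_C zp.ext_V zp.ext_zero zp.ext_one zp.ext_mone zp.ext_add zp.ext_mul
  by (rule fld_ring_ops)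

text \<open>Horner's rule at \<open>X\<close>. It turns a reduced polynomial, whose list has no
  leading zeros, into a list of the fixed length demanded by \<open>zp.ext_V\<close>.\<close>

definition embed :: "nat \<times> nat list \<Rightarrow> nat list \<Rightarrow> nat list" where
  "embed c w = foldl (\<lambda>s a. zp.ext_add c (zp.ext_shift c s) (zp.ext_const c a)) (zp.ext_zero c) w"

lemma embed_closed:
  assumes "(n, c) \<in> zp.ext_C" "set w \<subseteq> zp_V (fst c)"
  shows "embed c w \<in> zp.ext_V c"
proof -
  have "foldl (\<lambda>s a. zp.ext_add c (zp.ext_shift c s) (zp.ext_const c a)) s w \<in> zp.ext_V c" if "s \<in> zp.ext_V c" for s
    using assms(2) that
    by (induction w arbitrary: s)
       (auto intro!: zp.ext_add_closed[OF assms(1)] zp.ext_shift_closed[OF assms(1)] zp.ext_const_closed[OF assms(1)])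
  then show ?thesis unfolding embed_def using zp.ext_zero_closed[OF assms(1)] by simp
qed

lemma pt_embed:
  assumes "ptime D c" "ptime D w" "\<And>n z. (n, z) \<in> D \<Longrightarrow> (n, c z) \<in> zp.ext_C \<and> set (w z) \<subseteq> zp_V (fst (c z))"
  shows "ptime D (\<lambda>z. embed (c z) (w z))"
proof -
  let ?f = "\<lambda>z. (c z, w z)"
  have pf: "ptime D ?f" by (intro ptime_Pair assms(1,2))
  define E where "E = {(n, ?f z) | n z. (n, z) \<in> D}"
  have E: "(n, fst y) \<in> zp.ext_C" "set (snd y) \<subseteq> zp_V (fst (fst y))" if "(n, y) \<in> E" for n y
    using that assms(3) unfolding E_def by fastforce+
  have bE: "bdd E"
    unfolding bdd_def by (rule polyb_transfer[OF ptime_bs_le[OF pf]]) (auto simp: E_def)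
  have "ptime E (\<lambda>y. embed (fst y) (snd y))"
    unfolding embed_def
  proof (rule ptime_foldl[where S = "\<lambda>n y s. s \<in> zp.ext_V (fst y)"])
    show "ptime E (\<lambda>y. zp.ext_zero (fst y))" by (intro fld.pt_zero ptime_proj bE E)
    show "ptime E snd" using ptime_snd[OF ptime_id[OF bE]] by simp
    show "polyb {(n, (y, s)). (n, y) \<in> E \<and> s \<in> zp.ext_V (fst y)} (\<lambda>n y. bs (snd y))"
      by (rule zp.ext_polyb_V(2)[where c = "\<lambda>y. fst (fst y)"]) (use E in auto)
    let ?L = "{(n, (y, s, a)). (n, y) \<in> E \<and> s \<in> zp.ext_V (fst y) \<and> a \<in> set (snd y)}"
    have L: "(n, fst (fst z)) \<in> zp.ext_C" "fst (snd z) \<in> zp.ext_V (fst (fst z))" "snd (snd z) \<in> zp_V (fst (fst (fst z)))"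
      if "(n, z) \<in> ?L" for n z
    proof -
      have z: "(n, fst z) \<in> E" "snd (snd z) \<in> set (snd (fst z))" using that by auto
      show "fst (snd z) \<in> zp.ext_V (fst (fst z))" using that by auto
      show "(n, fst (fst z)) \<in> zp.ext_C" "snd (snd z) \<in> zp_V (fst (fst (fst z)))" using E[OF z(1)] z(2) by auto
    qed
    show "ptime ?L (\<lambda>z. zp.ext_add (fst (fst z)) (zp.ext_shift (fst (fst z)) (fst (snd z))) (zp.ext_const (fst (fst z)) (snd (snd z))))"
      if "bdd ?L"
      by (intro zp.pt_ext_add zp.pt_ext_shift zp.pt_ext_const ptime_proj that conjI zp.ext_shift_closed[OF L(1)]
          zp.ext_const_closed[OF L(1)] L)
  next
    show "zp.ext_add (fst y) (zp.ext_shift (fst y) s) (zp.ext_const (fst y) a) \<in> zp.ext_V (fst y)"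
      if "(n, y) \<in> E" "s \<in> zp.ext_V (fst y)" "a \<in> set (snd y)" for n y s a
      using E[OF that(1)] that
      by (intro zp.ext_add_closed[OF E(1)[OF that(1)]] zp.ext_shift_closed[OF E(1)[OF that(1)]] zp.ext_const_closed[OF E(1)[OF that(1)]]) auto
    show "zp.ext_zero (fst y) \<in> zp.ext_V (fst y)" if "(n, y) \<in> E" for n y
      by (rule zp.ext_zero_closed[OF E(1)[OF that]])
  qed
  then have "ptime D (\<lambda>z. embed (fst (?f z)) (snd (?f z)))"
    by (rule ptime_comp[OF pf]) (auto simp: E_def)
  then show ?thesis by simp
qed

text \<open>The conversion back: an answer has to be a polynomial in normal form, without leading
  zeros.\<close>

definition strip :: "nat list \<Rightarrow> nat list" where
  "strip = while (\<lambda>x. x \<noteq> [] \<and> hd x = 0) tl"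

lemma strip_simps: "strip [] = []" "strip (a # x) = (if a = 0 then strip x else a # x)"
  unfolding strip_def by (subst while_unfold, simp)+

lemma pt_strip:
  assumes "ptime D x"
  shows "ptime D (\<lambda>z. strip (x z))"
proof -
  obtain k where k: "\<And>n z. (n, z) \<in> D \<Longrightarrow> bs (x z) \<le> (n + 2) ^ k"
    using ptime_bs_le[OF assms] unfolding polyb_def by blast
  define E where "E = {(n, y :: nat list). bs y \<le> (n + 2) ^ k}"
  have "polyb E (\<lambda>n _. (n + 2) ^ k)" by (intro polyb_intros)
  then have bE: "bdd E" unfolding bdd_def by (rule polyb_mono) (auto simp: E_def)
  have hd: "ptime E (\<lambda>y. if y = [] then False else hd y = 0)"
    by (intro ptime_if ptime_eq_Nil ptime_bool ptime_eq_nat ptime_hd ptime_nat ptime_id bE bdd_subset[OF bE]) auto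
  have "ptime E (\<lambda>y. y \<noteq> [] \<and> hd y = 0)"
    by (rule ptime_cong[OF hd]) auto
  then have "ptime E strip" unfolding strip_def
  proof (rule ptime_while[where m = "\<lambda>_. length", rotated 3])
    show "(n, tl y) \<in> E" if "(n, y) \<in> E" for n y
      using that bs_tl_le[of y] by (simp add: E_def del: add_2_eq_Suc')
    show "polyb E (\<lambda>_. length)"
      using bE unfolding bdd_def by (rule polyb_mono) (rule length_le_bs)
    show "ptime {(n, y) \<in> E. y \<noteq> [] \<and> hd y = 0} tl"
      by (intro ptime_tl[where f = "\<lambda>y. y"] ptime_id bdd_subset[OF bE]) auto
  qed auto
  then show ?thesis
    by (rule ptime_comp[OF assms]) (use k in \<open>simp add: E_def del: add_2_eq_Suc'\<close>)
qed

subsection \<open>Trial division\<close>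

text \<open>A state is \<open>(d, M, fs, ps)\<close>: the next divisor \<open>d\<close>, the cofactor \<open>M\<close>, the prime factors found so far with and
  without multiplicity.\<close>

definition factor_step :: "nat \<times> nat \<times> nat list \<times> nat list \<Rightarrow> nat \<times> nat \<times> nat list \<times> nat list" where
  "factor_step s = (if fst (snd s) mod fst s = 0
     then (fst s, fst (snd s) div fst s, fst s # fst (snd (snd s)),
       if (fst (snd s) div fst s) mod fst s = 0 then snd (snd (snd s)) else fst s # snd (snd (snd s)))
     else (fst s + 1, snd s))"

definition factor :: "nat \<Rightarrow> nat \<times> nat \<times> nat list \<times> nat list" where
  "factor q = while (\<lambda>s. fst (snd s) \<noteq> 1) factor_step (2, q, [], [])"

text \<open>As \<open>d\<close> is at most every prime divisor of \<open>M\<close>, a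
  \<open>d\<close> dividing \<open>M\<close> is itself prime. The list \<open>ps\<close> holds the
  primes that are completely divided out, which keeps it distinct although a prime may divide
  several times.\<close>

definition factor_inv :: "nat \<Rightarrow> nat \<Rightarrow> nat \<times> nat \<times> nat list \<times> nat list \<Rightarrow> bool" where
  "factor_inv n q s \<longleftrightarrow> (case s of (d, M, fs, ps) \<Rightarrow> 2 \<le> d \<and> d \<le> n + 2 \<and> 0 < q \<and> prod_list fs * M = q \<and>
     (\<forall>l. Factorial_Ring.prime l \<longrightarrow> l dvd q \<longrightarrow> l \<le> n) \<and>
     (\<forall>l. Factorial_Ring.prime l \<longrightarrow> l dvd M \<longrightarrow> d \<le> l) \<and> (\<forall>l\<in>set fs. Factorial_Ring.prime l) \<and> distinct ps \<and>
     set ps = {l. Factorial_Ring.prime l \<and> l dvd q \<and> \<not> l dvd M})"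

text \<open>A step either advances \<open>d\<close>, which stays at most \<open>n + 2\<close>, or at
  least halves \<open>M\<close>.\<close>

definition factor_measure :: "nat \<Rightarrow> nat \<times> nat \<times> nat list \<times> nat list \<Rightarrow> nat" where
  "factor_measure n s = (n + 3 - fst s) + floorlog 2 (fst (snd s))"

lemma factor_step:
  assumes inv: "factor_inv n q s" and b: "fst (snd s) \<noteq> 1"
  shows "factor_inv n q (factor_step s)" "factor_measure n (factor_step s) < factor_measure n s"
proof -
  obtain d M fs ps where s: "s = (d, M, fs, ps)" by (cases s)
  have d: "2 \<le> d" "d \<le> n + 2" "0 < q" "prod_list fs * M = q"
    and bound: "\<And>l. Factorial_Ring.prime l \<Longrightarrow> l dvd q \<Longrightarrow> l \<le> n"
    and least: "\<And>l. Factorial_Ring.prime l \<Longrightarrow> l dvd M \<Longrightarrow> d \<le> l"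
    and fs: "\<forall>l\<in>set fs. Factorial_Ring.prime l" "distinct ps" "set ps = {l. Factorial_Ring.prime l \<and> l dvd q \<and> \<not> l dvd M}"
    using inv by (auto simp: factor_inv_def s)
  have M: "0 < M" "M \<noteq> 1" using d b by (auto simp: s intro: Nat.gr0I)
  have Mq: "M dvd q" using d(4) by auto
  have "factor_inv n q (factor_step s) \<and> factor_measure n (factor_step s) < factor_measure n s"
  proof (cases "d dvd M")
    case True
    then obtain k where k: "M = d * k" by blast
    \<comment> \<open>A prime divisor \<open>l\<close> of \<open>d\<close> divides \<open>M\<close>,
      hence is at least \<open>d\<close>; so \<open>d\<close> equals \<open>l\<close> and is
      prime.\<close>
    obtain l where l: "Factorial_Ring.prime l" "l dvd d" using prime_factor_nat[of d] d(1) by auto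
    have "d \<le> l" by (rule least[OF l(1) dvd_trans[OF l(2) True]])
    then have dl: "d = l" using l(2) d(1) by (auto dest!: dvd_imp_le)
    have dp: "Factorial_Ring.prime d" using l dl by simp
    have k0: "0 < k" using k M by (auto intro: Nat.gr0I)
    have st: "factor_step s = (d, k, d # fs, if d dvd k then ps else d # ps)"
      using True d(1) k by (simp add: factor_step_def s mod_eq_0_iff_dvd)
    have dq: "d dvd q" using True Mq by (rule dvd_trans)
    have lk: "l dvd M \<longleftrightarrow> l dvd k \<or> l = d" if "Factorial_Ring.prime l" for l
      unfolding k using that dp by (auto simp: prime_dvd_mult_iff primes_dvd_imp_eq)
    have "set (if d dvd k then ps else d # ps) = {l. Factorial_Ring.prime l \<and> l dvd q \<and> \<not> l dvd k}"
      using fs(3) lk dp dq by auto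
    moreover have "d \<notin> set ps" using fs(3) True by auto
    moreover have "prod_list (d # fs) * k = q" using d(4) k by (simp add: ac_simps)
    ultimately have "factor_inv n q (factor_step s)"
      using d bound least fs(1,2) dp lk unfolding st factor_inv_def by auto
    moreover have "floorlog 2 k < floorlog 2 M"
    proof -
      have "floorlog 2 (k * 2) = Suc (floorlog 2 k)" using k0 by (subst compute_floorlog) simp
      moreover have "floorlog 2 (k * 2) \<le> floorlog 2 M" using k d(1) by (intro floorlog_mono) simp
      ultimately show ?thesis by simp
    qed
    ultimately show ?thesis by (simp add: factor_measure_def st[unfolded s] s)
  next
    case False
    have st: "factor_step s = (d + 1, M, fs, ps)"
      using False by (simp add: factor_step_def s mod_eq_0_iff_dvd)
    obtain l where l: "Factorial_Ring.prime l" "l dvd M" using prime_factor_nat[of M] M by auto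
    have "d \<le> l" "l \<le> n" using least l bound dvd_trans[OF l(2) Mq] by auto
    moreover have "d + 1 \<le> l" if "Factorial_Ring.prime l" "l dvd M" for l
      using least[OF that] that False by (cases "d = l") auto
    ultimately show ?thesis
      using d bound fs by (auto simp: factor_inv_def factor_measure_def st[unfolded s] s)
  qed
  then show "factor_inv n q (factor_step s)" "factor_measure n (factor_step s) < factor_measure n s" by auto
qed

lemma factor_correct:
  assumes q: "0 < q" and bound: "\<And>l. Factorial_Ring.prime l \<Longrightarrow> l dvd q \<Longrightarrow> l \<le> n"
  defines "fs \<equiv> fst (snd (snd (factor q)))" and "ps \<equiv> snd (snd (snd (factor q)))"
  shows "prod_list fs = q" "\<forall>l\<in>set fs. Factorial_Ring.prime l" "distinct ps"
    "set ps = {l. Factorial_Ring.prime l \<and> l dvd q}"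
proof -
  have "factor_inv n q (factor q) \<and> fst (snd (factor q)) = 1"
    unfolding factor_def
  proof (rule while_rule[where P = "factor_inv n q" and r = "measure (factor_measure n)"])
    show "factor_inv n q (2, q, [], [])"
      using q bound by (auto simp: factor_inv_def prime_ge_2_nat)
  qed (use factor_step in auto)
  then show "prod_list fs = q" "\<forall>l\<in>set fs. Factorial_Ring.prime l" "distinct ps"
    "set ps = {l. Factorial_Ring.prime l \<and> l dvd q}"
    unfolding fs_def ps_def factor_inv_def by (auto simp: case_prod_beta)
qed

lemma prime_list_bound:
  assumes "prod_list fs = q" "\<forall>l\<in>set fs. 2 \<le> l"
  shows "length fs < floorlog 2 (q::nat)"
proof -
  have "2 ^ length fs \<le> prod_list fs" using assms(2)
  proof (induction fs)
    case (Cons l fs)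
    then show ?case using mult_mono[of 2 l "2 ^ length fs" "prod_list fs"] by simp
  qed simp
  then have "\<not> q < 2 ^ length fs" using assms(1) by simp
  then show ?thesis by (simp only: not_le flip: floorlog_2_le_iff)
qed

text \<open>Trial division is fast here because all prime factors are at most \<open>n\<close>; the
  successful divisions are paid for by the bit length of the cofactor.\<close>

lemma pt_factor:
  assumes "ptime D q" "\<And>n z. (n, z) \<in> D \<Longrightarrow> 0 < q z \<and> floorlog 2 (q z) \<le> n \<and> (\<forall>l. Factorial_Ring.prime l \<longrightarrow> l dvd q z \<longrightarrow> l \<le> n)"
  shows "ptime D (\<lambda>z. factor (q z))"
proof -
  define E where "E = {(n, s). \<exists>q. floorlog 2 q \<le> n \<and> factor_inv n q s}"
  have M: "floorlog 2 (fst (snd s)) \<le> n" if "(n, s) \<in> E" for n s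
  proof -
    have "\<exists>q. floorlog 2 q \<le> n \<and> factor_inv n q s" using that by (simp add: E_def)
    then obtain q where q: "floorlog 2 q \<le> n" "factor_inv n q s" by blast
    then have "fst (snd s) dvd q" "0 < q" by (auto simp: factor_inv_def)
    then have "fst (snd s) \<le> q" by (rule dvd_imp_le)
    then show ?thesis using q(1) floorlog_mono[of "fst (snd s)" q 2] by simp
  qed
  have bE: "bdd E" unfolding bdd_def
  proof (rule polyb_mono)
    show "polyb E (\<lambda>n s. 3 + ((n + 4) + ((1 + n) + ((1 + n * ((n + 2) + 1)) + (1 + (n + 1) * ((n + 2) + 1))))))"
      by (intro polyb_intros)
    fix n s assume s: "(n, s) \<in> E"
    have "\<exists>q. floorlog 2 q \<le> n \<and> factor_inv n q s" using s by (simp add: E_def)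
    then obtain q where q: "floorlog 2 q \<le> n" "factor_inv n q s" by blast
    obtain d M fs ps where [simp]: "s = (d, M, fs, ps)" by (cases s)
    have i: "d \<le> n + 2" "prod_list fs * M = q" "0 < q" "\<forall>l\<in>set fs. Factorial_Ring.prime l" "distinct ps"
      "set ps = {l. Factorial_Ring.prime l \<and> l dvd q \<and> \<not> l dvd M}" "\<forall>l. Factorial_Ring.prime l \<longrightarrow> l dvd q \<longrightarrow> l \<le> n"
      using q(2) by (auto simp: factor_inv_def)
    have fsq: "l dvd q" if "l \<in> set fs" for l
      using that i(2) by (induction fs arbitrary: q) (auto simp: mult.assoc)
    have "bs d \<le> n + 4" using bs_nat_le[of d] i(1) by simp
    moreover have "bs M \<le> 1 + n" using M[OF s] by (simp add: enc_nat_def)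
    moreover have "bs fs \<le> 1 + n * ((n + 2) + 1)"
    proof -
      have "bs fs \<le> 1 + length fs * ((n + 2) + 1)"
      proof (rule bs_list_le)
        fix l assume "l \<in> set fs"
        then have "l \<le> n" using fsq i(4,7) by blast
        then show "bs l \<le> n + 2" using bs_nat_le[of l] by simp
      qed
      moreover have "length fs \<le> n"
      proof -
        have "length fs < floorlog 2 (prod_list fs)"
          using i(4) prime_ge_2_nat by (intro prime_list_bound) auto
        also have "\<dots> \<le> floorlog 2 q" using i(2,3) by (intro floorlog_mono) (auto intro: dvd_imp_le)
        finally show ?thesis using q(1) by simp
      qed
      ultimately show ?thesis by (meson add_left_mono le_trans mult_le_mono1)
    qed
    moreover have "bs ps \<le> 1 + (n + 1) * ((n + 2) + 1)"
    proof -
      have sub: "set ps \<subseteq> {..n}" using i(6,7) by auto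
      have "bs ps \<le> 1 + length ps * ((n + 2) + 1)"
      proof (rule bs_list_le)
        fix l assume "l \<in> set ps"
        then have "l \<le> n" using sub by blast
        then show "bs l \<le> n + 2" using bs_nat_le[of l] by simp
      qed
      moreover have "length ps \<le> n + 1"
        using card_mono[OF _ sub] distinct_card[OF i(5)] by simp
      ultimately show ?thesis by (meson add_left_mono le_trans mult_le_mono1)
    qed
    ultimately show "bs s \<le> 3 + ((n + 4) + ((1 + n) + ((1 + n * ((n + 2) + 1)) + (1 + (n + 1) * ((n + 2) + 1)))))"
      by simp
  qed
  have w: "ptime E (while (\<lambda>s. fst (snd s) \<noteq> 1) factor_step)"
  proof (rule ptime_while[where m = factor_measure])
    show "(n, factor_step s) \<in> E" "factor_measure n (factor_step s) < factor_measure n s"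
      if "(n, s) \<in> E" "fst (snd s) \<noteq> 1" for n s
    proof -
      have "\<exists>q. floorlog 2 q \<le> n \<and> factor_inv n q s" using that(1) by (simp add: E_def)
      then obtain q where q: "floorlog 2 q \<le> n" "factor_inv n q s" by blast
      then show "(n, factor_step s) \<in> E" "factor_measure n (factor_step s) < factor_measure n s"
        using factor_step[OF q(2) that(2)] by (auto simp: E_def)
    qed
    show "polyb E factor_measure"
    proof (rule polyb_mono)
      show "polyb E (\<lambda>n s. (n + 3) + n)" by (intro polyb_intros)
      show "factor_measure n s \<le> (n + 3) + n" if "(n, s) \<in> E" for n s
        using M[OF that] by (auto simp: factor_measure_def)
    qed
    show "ptime E (\<lambda>s. fst (snd s) \<noteq> 1)" by (intro ptime_not ptime_eq_nat ptime_nat ptime_proj bE)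
    have pr: "ptime E factor_step" unfolding factor_step_def
      by (intro ptime_if ptime_Pair ptime_Cons ptime_eq_nat ptime_mod ptime_div ptime_plus ptime_nat ptime_fst ptime_snd ptime_id
          bE bdd_subset[OF bE]) auto
    show "ptime {(n, s) \<in> E. fst (snd s) \<noteq> 1} factor_step" by (rule ptime_subset[OF pr]) auto
  qed
  have "ptime D (\<lambda>z. (2::nat, q z, [] :: nat list, [] :: nat list))"
    by (intro ptime_Pair ptime_nat ptime_Nil assms(1) ptime_bdd[OF assms(1)])
  then show ?thesis unfolding factor_def
    by (rule ptime_comp[OF _ w]) (use assms(2) in \<open>auto simp: E_def factor_inv_def prime_ge_2_nat\<close>)
qed

locale presentation = residues_prime p R for p and R (structure) +
  fixes q :: nat and F :: "int list"
  assumes pres: "field_presentation q p F"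
begin

abbreviation "P \<equiv> poly_ring R"
abbreviation "L \<equiv> presented_field p F"
abbreviation "S \<equiv> field_elem p F"

text \<open>The negatives of the coefficients of \<open>F\<close> below the leading one: modulo the
  monic \<open>F\<close> this is what \<open>X ^ degree F\<close> reduces to, so it serves as the
  \<open>h\<close> of the extension.\<close>

definition red :: "nat list" where "red = map (\<lambda>a. (p - a) mod p) (tl (map nat F))"

lemma pres_facts: "F \<in> carrier P" "lead_coeff F = \<one>" "pirreducible (carrier R) F" "q = p ^ degree F"
  using pres by (auto simp: field_presentation_def R_def)

lemma L_eq: "L = Rupt (carrier R) F" and S_eq: "S = rupture_surj (carrier R) F"
  by (auto simp: presented_field_def field_elem_def R_def)

lemma sub: "subfield (carrier R) R" "subring (carrier R) R"
  using carrier_is_subfield carrier_is_subring by auto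

lemma deg: "1 \<le> degree F" "F \<noteq> []"
  using pirreducible_degree[OF sub(1) pres_facts(1,3)] by auto

sublocale L: field L
  using rupture_is_field_iff_pirreducible[OF sub(1) pres_facts(1)] pres_facts(3) by (simp add: L_eq)

sublocale hom: ring_hom_ring P L S
  unfolding L_eq S_eq by (rule rupture_surj_hom(2)[OF sub(2) pres_facts(1)])

lemma carrier_L: "bij_betw S {g \<in> carrier P. length g \<le> degree F} (carrier L)"
  unfolding bij_betw_def L_eq S_eq
  using rupture_surj_inj_on[OF sub(1) pres_facts(1)] rupture_carrier_as_pmod_image[OF sub(1) pres_facts(1)]
    pmod_image_characterization[OF sub(1) pres_facts(1) deg(2)] by simp

definition phi0 :: "nat \<Rightarrow> int list set" where "phi0 a = S (poly_of_const (int a))"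

definition xi :: "int list set" where "xi = S X"

definition phi :: "nat list \<Rightarrow> int list set" where "phi x = L.eval (map phi0 x) xi"

lemma carrier_int: "a < p \<Longrightarrow> int a \<in> carrier R"
  by (simp add: res_carrier_eq)

lemma const_closed: "a \<in> carrier R \<Longrightarrow> poly_of_const a \<in> carrier P"
  using ring_hom_memE(1)[OF canonical_embedding_is_hom[OF sub(2)]] by simp

lemma xi: "xi \<in> carrier L"
  unfolding xi_def by (rule hom.hom_closed[OF var_closed(1)[OF sub(2)]])

text \<open>Every polynomial is its own value at \<open>X\<close>, and evaluation commutes with the
  homomorphism \<open>S\<close>; leading zeros contribute nothing. This links the lists of the
  computation to the quotient ring of the problem.\<close>

lemma S_eval:
  assumes "set l \<subseteq> carrier R"
  shows "L.eval (map (\<lambda>a. S (poly_of_const a)) l) xi = S (normalize l)"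
proof -
  have norm: "normalize l \<in> carrier P"
    using normalize_gives_polynomial[OF assms] by (simp add: univ_poly_carrier)
  have set_norm: "set (normalize l) \<subseteq> carrier R" by (rule normalize_in_carrier[OF assms])
  have zero: "S (poly_of_const \<zero>) = \<zero>\<^bsub>L\<^esub>"
    using hom.hom_zero by (simp add: poly_of_const_def univ_poly_zero)
  define k where "k = length l - length (normalize l)"
  have l: "l = replicate k \<zero> @ normalize l"
    using normalize_def'(1)[of l] normalize_def'(2)[of l] by (simp add: k_def)
  have cl: "set (map (\<lambda>a. S (poly_of_const a)) (normalize l)) \<subseteq> carrier L"
    using set_norm const_closed by auto
  have "L.eval (map (\<lambda>a. S (poly_of_const a)) l) xi = L.eval (map (\<lambda>a. S (poly_of_const a)) (normalize l)) xi"
    by (subst l) (simp add: zero L.eval_replicate[OF cl xi, simplified])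
  also have "\<dots> = L.eval (map S (map poly_of_const (normalize l))) (S X)"
    by (simp add: xi_def comp_def)
  also have "\<dots> = S (ring.eval P (map poly_of_const (normalize l)) X)"
    by (rule hom.eval_hom'[symmetric, OF var_closed(1)[OF sub(2)]]) (use set_norm const_closed in auto)
  also have "\<dots> = S (normalize l)"
    using eval_rewrite[OF sub(2) norm] by simp
  finally show ?thesis .
qed

lemma phi_eq: "set x \<subseteq> {..<p} \<Longrightarrow> phi x = S (normalize (map int x))"
proof -
  assume "set x \<subseteq> {..<p}"
  then have "set (map int x) \<subseteq> carrier R" using carrier_int by auto
  from S_eval[OF this] show ?thesis by (simp add: phi_def phi0_def[abs_def] comp_def)
qed

lemma phi0_closed: "a < p \<Longrightarrow> phi0 a \<in> carrier L"
  unfolding phi0_def by (intro hom.hom_closed const_closed carrier_int)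

lemma phi_closed: "set x \<subseteq> {..<p} \<Longrightarrow> phi x \<in> carrier L"
  unfolding phi_def using phi0_closed xi by (intro L.eval_in_carrier) auto

lemma poly_entries: "g \<in> carrier P \<Longrightarrow> set g \<subseteq> {0..int p - 1}"
  using polynomial_incl[of "carrier R" g] by (auto simp: univ_poly_carrier[symmetric] res_carrier_eq)

lemma map_int_nat: "g \<in> carrier P \<Longrightarrow> map int (map nat g) = g"
proof -
  assume g: "g \<in> carrier P"
  have "map int (map nat g) = map id g"
    unfolding map_map by (rule map_cong[OF refl]) (use poly_entries[OF g] in auto)
  then show ?thesis by simp
qed

lemma set_map_nat: "g \<in> carrier P \<Longrightarrow> set (map nat g) \<subseteq> {..<p}"
proof
  fix a assume g: "g \<in> carrier P" and "a \<in> set (map nat g)"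
  then obtain b where b: "b \<in> set g" "a = nat b" by auto
  then have "0 \<le> b" "b \<le> int p - 1" using poly_entries[OF g] by auto
  then show "a \<in> {..<p}" using b by (simp add: nat_less_iff)
qed

lemma length_red: "length red = degree F"
  by (simp add: red_def)

lemma replicate_normalize: "length g \<le> k \<Longrightarrow> g \<in> carrier P \<Longrightarrow> normalize (replicate (k - length g) \<zero> @ g) = g"
  by (simp add: normalize_replicate_zero normalize_polynomial univ_poly_carrier)

text \<open>Stripping and padding leading zeros are mutually inverse between the lists of fixed
  length and the polynomials of length at most the degree, which represent the residue classes.
  Injectivity of \<open>phi\<close> and the cardinality \<open>q\<close> both come from
  here.\<close>

lemma bij_phi: "bij_betw phi {x. set x \<subseteq> {..<p} \<and> length x = degree F} (carrier L)"
proof -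
  let ?V = "{x. set x \<subseteq> {..<p} \<and> length x = degree F}"
  let ?W = "{g \<in> carrier P. length g \<le> degree F}"
  have "bij_betw (\<lambda>x. normalize (map int x)) ?V ?W"
  proof (rule bij_betw_byWitness[where f' = "\<lambda>g. replicate (degree F - length g) 0 @ map nat g"])
    show "\<forall>x\<in>?V. replicate (degree F - length (normalize (map int x))) 0 @ map nat (normalize (map int x)) = x"
    proof
      fix x assume x: "x \<in> ?V"
      have "map int x = replicate (length x - length (normalize (map int x))) \<zero> @ normalize (map int x)"
        using normalize_def'(1)[of "map int x"] normalize_def'(2)[of "map int x"] by simp
      then have "map nat (map int x) = map nat (replicate (length x - length (normalize (map int x))) \<zero> @ normalize (map int x))"
        by (rule arg_cong)
      then show "replicate (degree F - length (normalize (map int x))) 0 @ map nat (normalize (map int x)) = x"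
        using x by (simp add: comp_def res_zero_eq)
    qed
    show "\<forall>g\<in>?W. normalize (map int (replicate (degree F - length g) 0 @ map nat g)) = g"
    proof
      fix g assume g: "g \<in> ?W"
      then have "map int (map nat g) = g" using map_int_nat by blast
      then show "normalize (map int (replicate (degree F - length g) 0 @ map nat g)) = g"
        using g replicate_normalize[of g "degree F"] by (simp add: res_zero_eq)
    qed
    show "(\<lambda>x. normalize (map int x)) ` ?V \<subseteq> ?W"
    proof
      fix g assume "g \<in> (\<lambda>x. normalize (map int x)) ` ?V"
      then obtain x where x: "x \<in> ?V" "g = normalize (map int x)" by auto
      have "set (map int x) \<subseteq> carrier R" using x(1) carrier_int by auto
      then show "g \<in> ?W" using x normalize_gives_polynomial[of "map int x" "carrier R"] normalize_length_le[of "map int x"]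
        by (simp add: univ_poly_carrier)
    qed
    show "(\<lambda>g. replicate (degree F - length g) 0 @ map nat g) ` ?W \<subseteq> ?V"
    proof
      fix x assume "x \<in> (\<lambda>g. replicate (degree F - length g) 0 @ map nat g) ` ?W"
      then obtain g where g: "g \<in> ?W" "x = replicate (degree F - length g) 0 @ map nat g" by blast
      then show "x \<in> ?V" using set_map_nat[of g] prime_gt_0_nat[OF p_prime] by auto
    qed
  qed
  then have "bij_betw (\<lambda>x. S (normalize (map int x))) ?V (carrier L)"
    using bij_betw_trans[OF _ carrier_L] by (simp add: comp_def)
  then show ?thesis by (rule bij_betw_cong[THEN iffD1, rotated]) (simp add: phi_eq)
qed

lemma card_L: "card (carrier L) = q" "finite (carrier L)"
proof -
  have V: "{x. set x \<subseteq> {..<p} \<and> length x = degree F} = {x. set x \<subseteq> {..<p} \<and> length x = degree F}" ..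
  have "finite {x. set x \<subseteq> {..<p} \<and> length x = degree F}" by (rule finite_lists_length_eq) simp
  then show "finite (carrier L)" using bij_betw_finite[OF bij_phi] by simp
  show "card (carrier L) = q"
    using bij_betw_same_card[OF bij_phi] card_lists_length_eq[of "{..<p}" "degree F"] pres_facts(4) by simp
qed

sublocale L: finite_field L
  by unfold_locales (rule card_L)

lemma N_eq: "L.N = q - 1"
  using card_L by (simp add: L.N_def order_def card_Diff_subset)

lemma phi0_rep: "zp.rep L p phi0"
proof -
  interpret h: ring_hom_ring R L "S \<circ> poly_of_const"
    using rupture_surj_norm_is_hom[OF sub(2) pres_facts(1)] ring_axioms L.ring_axioms
    by (intro ring_hom_ringI2) (simp_all add: L_eq S_eq)
  have f: "phi0 a = (S \<circ> poly_of_const) (int a)" for a by (simp add: phi0_def)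
  have p: "1 < p" using p_prime by (rule prime_gt_1_nat)
  show ?thesis unfolding zp.rep_def ring_rep_def
  proof (intro conjI ballI)
    show "phi0 ` zp_V p \<subseteq> carrier L" using phi0_closed by (auto simp: zp_V_def)
    show "phi0 0 = \<zero>\<^bsub>L\<^esub>" unfolding f using h.hom_zero by (simp add: res_zero_eq)
    show "phi0 1 = \<one>\<^bsub>L\<^esub>" unfolding f using h.hom_one by (simp add: res_one_eq)
    have "int (p - 1) = \<ominus> \<one>"
      using p by (simp add: res_neg_eq res_one_eq zmod_minus1 of_nat_diff)
    then show "phi0 (p - 1) = \<ominus>\<^bsub>L\<^esub> \<one>\<^bsub>L\<^esub>" unfolding f using h.hom_a_inv[OF one_closed] h.hom_one by simp
    fix x y assume xy: "x \<in> zp_V p" "y \<in> zp_V p"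
    then have c: "int x \<in> carrier R" "int y \<in> carrier R" using carrier_int by (auto simp: zp_V_def)
    show "phi0 ((x + y) mod p) = phi0 x \<oplus>\<^bsub>L\<^esub> phi0 y"
      unfolding f using h.hom_add[OF c] by (simp add: res_add_eq zmod_int)
    show "phi0 (x * y mod p) = phi0 x \<otimes>\<^bsub>L\<^esub> phi0 y"
      unfolding f using h.hom_mult[OF c] by (simp add: res_mult_eq zmod_int)
  qed
qed

text \<open>\<open>F\<close> is monic and vanishes at the class of \<open>X\<close>; moving all
  terms but the leading one to the other side gives the relation required by
  \<open>ext_rep\<close>.\<close>

lemma xi_pow: "xi [^]\<^bsub>L\<^esub> length red = phi red"
proof -
  obtain t where t: "F = 1 # t" using deg(2) pres_facts(2) by (cases F) (auto simp: res_one_eq)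
  have tR: "set t \<subseteq> carrier R" using poly_entries[OF pres_facts(1)] by (auto simp: t res_carrier_eq)
  let ?c = "\<lambda>a. S (poly_of_const a)"
  note r = zp.repD[OF phi0_rep]
  have cl: "?c a \<in> carrier L" if "a \<in> carrier R" for a using that const_closed by simp
  \<comment> \<open>The outer \<open>mod\<close> serves the case \<open>a = 0\<close>, where
    \<open>p - a\<close> is not a reduced residue.\<close>
  have neg: "phi0 ((p - nat a) mod p) = \<ominus>\<^bsub>L\<^esub> ?c a" if a: "a \<in> carrier R" for a
  proof -
    have ap: "nat a < p" "int (nat a) = a" using a by (auto simp: res_carrier_eq)
    have m: "(p - nat a) mod p < p" using ap by simp
    have "phi0 (((p - nat a) mod p + nat a) mod p) = phi0 ((p - nat a) mod p) \<oplus>\<^bsub>L\<^esub> phi0 (nat a)"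
      using r(5)[of "(p - nat a) mod p" "nat a"] ap m by (simp add: zp_V_def)
    moreover have "((p - nat a) mod p + nat a) mod p = 0" using ap by (simp add: mod_add_left_eq)
    ultimately have "phi0 ((p - nat a) mod p) \<oplus>\<^bsub>L\<^esub> ?c a = \<zero>\<^bsub>L\<^esub>" using r(2) ap by (simp add: phi0_def)
    then show ?thesis using phi0_closed[OF m] cl[OF a] by (metis L.minus_equality)
  qed
  have "L.eval (map phi0 (map (\<lambda>a. (p - a) mod p) (map nat t))) xi = \<ominus>\<^bsub>L\<^esub> L.eval (map ?c t) xi"
    using tR
  proof (induction t)
    case (Cons a t)
    have "L.eval (map ?c t) xi \<in> carrier L" using Cons(2) cl xi by (intro L.eval_in_carrier) auto
    then show ?case using Cons neg[of a] cl[of a] xi by (simp add: L.minus_add L.l_minus)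
  qed simp
  moreover have "red = map (\<lambda>a. (p - a) mod p) (map nat t)"
    unfolding red_def by (simp add: t)
  ultimately have red: "phi red = \<ominus>\<^bsub>L\<^esub> L.eval (map ?c t) xi" by (simp only: phi_def)
  have et: "L.eval (map ?c t) xi \<in> carrier L" using tR cl xi by (intro L.eval_in_carrier) auto
  have one: "?c 1 = \<one>\<^bsub>L\<^esub>" using r(3) by (simp add: phi0_def)
  have "L.eval (map ?c F) xi = \<zero>\<^bsub>L\<^esub>"
    using polynomial_rupture[OF sub(2) pres_facts(1)] by (simp add: L_eq S_eq xi_def comp_def)
  moreover have "map ?c F = ?c 1 # map ?c t" using arg_cong[OF t, of "map ?c"] by (simp only: list.map)
  ultimately have "L.eval (?c 1 # map ?c t) xi = \<zero>\<^bsub>L\<^esub>" by simp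
  then have "xi [^]\<^bsub>L\<^esub> length t \<oplus>\<^bsub>L\<^esub> L.eval (map ?c t) xi = \<zero>\<^bsub>L\<^esub>" using one xi by simp
  then have "xi [^]\<^bsub>L\<^esub> length t = \<ominus>\<^bsub>L\<^esub> L.eval (map ?c t) xi"
    using et xi by (metis L.minus_equality L.nat_pow_closed)
  moreover have "length red = length t" using arg_cong[OF t, of length] by (simp add: length_red)
  ultimately show ?thesis by (simp only: red)
qed

lemma red_C:
  assumes "floorlog 2 q \<le> n"
  shows "(n, (p, red)) \<in> zp.ext_C"
proof -
  have p: "1 < p" using p_prime by (rule prime_gt_1_nat)
  have "p \<le> q" using pres_facts(4) deg p by (metis One_nat_def less_imp_le_nat power_increasing power_one_right)
  then have "floorlog 2 p \<le> n" using floorlog_mono[of p q 2] assms by simp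
  moreover have "degree F \<le> n"
  proof -
    have "2 ^ degree F \<le> q" using pres_facts(4) p by (simp add: power_mono)
    moreover have "q < 2 ^ floorlog 2 q" by (rule less_pow_floorlog)
    ultimately have "2 ^ degree F < (2::nat) ^ floorlog 2 q" by (rule le_less_trans)
    then show ?thesis using assms by simp
  qed
  ultimately show ?thesis
  proof -
    assume "floorlog 2 p \<le> n" "degree F \<le> n"
    moreover have "red \<noteq> []" using length_red deg(1) by auto
    moreover have "set red \<subseteq> zp_V p" using p by (auto simp: zp_V_def red_def)
    ultimately show ?thesis using p length_red unfolding zp.ext_C_def by (simp add: zp_C_def)
  qed
qed

lemma phi_rep: "fld.rep L (p, red) phi"
  using zp.ext_rep(1)[OF L.is_cring phi0_rep red_C[OF order_refl] xi] xi_pow by (simp add: phi_def[abs_def])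

lemma ext_V_eq: "zp.ext_V (p, red) = {x. set x \<subseteq> {..<p} \<and> length x = degree F}"
  by (simp add: zp.ext_V_def zp_V_def length_red)

lemma inj_phi: "inj_on phi (zp.ext_V (p, red))"
  unfolding ext_V_eq by (rule bij_betw_imp_inj_on[OF bij_phi])

lemma solver: "floorlog 2 q \<le> n \<Longrightarrow>
  field_solver zp.ext_C zp.ext_V zp.ext_zero zp.ext_one zp.ext_mone zp.ext_add zp.ext_mul L n (p, red) phi"
  by (intro field_solver.intro fld_ring_ops field_solver_axioms.intro L.finite_field_axioms red_C phi_rep inj_phi)

lemma phi_embed:
  assumes g: "g \<in> carrier P"
  shows "phi (embed (p, red) (map nat g)) = S g"
proof -
  note C = red_C[OF order_refl]
  note e = zp.ext_rep[OF L.is_cring phi0_rep C xi, folded phi_def, OF xi_pow]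
  note r = fld.repD[OF e(1)]
  note w = set_map_nat[OF g]
  have "foldl (\<lambda>s a. zp.ext_add (p, red) (zp.ext_shift (p, red) s) (zp.ext_const (p, red) a)) s w \<in> zp.ext_V (p, red) \<and>
      phi (foldl (\<lambda>s a. zp.ext_add (p, red) (zp.ext_shift (p, red) s) (zp.ext_const (p, red) a)) s w) =
      phi s \<otimes>\<^bsub>L\<^esub> xi [^]\<^bsub>L\<^esub> length w \<oplus>\<^bsub>L\<^esub> phi w"
    if "set w \<subseteq> {..<p}" "s \<in> zp.ext_V (p, red)" for w s
    using that
  proof (induction w arbitrary: s)
    case Nil
    then show ?case using r(1)[of s] xi by (simp add: phi_def)
  next
    case (Cons a w)
    have a: "a \<in> zp_V p" using Cons by (simp add: zp_V_def)
    have sh: "zp.ext_shift (p, red) s \<in> zp.ext_V (p, red)" "zp.ext_const (p, red) a \<in> zp.ext_V (p, red)"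
      using zp.ext_shift_closed[OF C] zp.ext_const_closed[OF C] Cons a by auto
    have "phi w \<in> carrier L" "phi s \<in> carrier L" "phi0 a \<in> carrier L"
      using Cons phi_closed r phi0_closed by auto
    then show ?case using Cons.IH[OF _ zp.ext_add_closed[OF C sh]] Cons(2,3) sh r(5)[OF sh] e(2)[OF a] e(4) xi
      by (simp add: phi_def[of "a # w"] phi_def[of w, symmetric] L.r_distr L.l_distr L.m_ac L.a_ac)
  qed
  from this[OF w zp.ext_zero_closed[OF C]]
  have "phi (embed (p, red) (map nat g)) = phi (map nat g)"
    using r(2) phi_closed[OF w] xi by (simp add: embed_def)
  also have "\<dots> = S (normalize (map int (map nat g)))" by (rule phi_eq[OF w])
  also have "map int (map nat g) = g" by (rule map_int_nat[OF g])
  also have "normalize g = g" using g by (simp add: normalize_polynomial univ_poly_carrier)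
  finally show ?thesis .
qed

lemma strip_correct:
  assumes "x \<in> zp.ext_V (p, red)"
  shows "reduced p F (map int (strip x)) \<and> S (map int (strip x)) = phi x"
proof -
  have x: "set x \<subseteq> {..<p}" "length x = degree F" using assms by (auto simp: ext_V_eq)
  have "map int (strip x) = normalize (map int x)"
    by (induction x) (auto simp: strip_simps res_zero_eq)
  moreover have "normalize (map int x) \<in> carrier P"
    using normalize_gives_polynomial[of "map int x" "carrier R"] x(1) carrier_int by (auto simp: univ_poly_carrier)
  moreover have "length (normalize (map int x)) < length F"
    using normalize_length_le[of "map int x"] x(2) deg by simp
  ultimately show ?thesis using phi_eq[OF x(1)] by (simp add: reduced_def R_def)
qed

end

section \<open>The reduction\<close>

lemma enc_poly_eq: "enc_poly g = enc (map nat g)"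
  by (induction g) (auto simp: enc_nat_def)

lemma enc_nat_list_inj: "enc x = enc y \<Longrightarrow> x = (y :: nat list)"
proof (induction x arbitrary: y)
  case Nil
  then show ?case by (cases y) auto
next
  case (Cons a x)
  then show ?case by (cases y) (auto simp: enc_nat_def)
qed

text \<open>The number \<open>q\<close> is not part of the input. It is recovered as a power of
  \<open>p\<close>, with one factor for every coefficient of the modulus below the leading
  one.\<close>

definition power_length :: "nat \<Rightarrow> nat list \<Rightarrow> nat" where
  "power_length p l = foldl (\<lambda>s _. s * p) 1 l"

lemma power_length: "power_length p l = p ^ length l"
  unfolding power_length_def by (induction l rule: rev_induct) auto

definition reduction :: "nat \<Rightarrow> nat list \<Rightarrow> nat list" where
  "reduction p l = map (\<lambda>a. (p - a) mod p) (tl l)"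

text \<open>\<open>rt\<close> stands for the function computed by the assumed program for roots of
  unity; its answers are polynomials of varying length, which \<open>embed\<close> converts.\<close>

definition root_pair :: "(nat \<times> nat list \<Rightarrow> nat \<Rightarrow> nat list) \<Rightarrow> nat \<times> nat list \<Rightarrow> nat \<Rightarrow> nat \<times> nat list" where
  "root_pair rt z a = (a, embed (fst z, reduction (fst z) (snd z)) (rt z (root_order a)))"

text \<open>The prime factors with multiplicity drive the chains of powers; the distinct primes
  index the product of the elements of prime power order.\<close>

definition compute_generator :: "(nat \<times> nat list \<Rightarrow> nat \<Rightarrow> nat list) \<Rightarrow> nat \<times> nat list \<Rightarrow> nat list" where
  "compute_generator rt z = strip (fld.generator (fst z, reduction (fst z) (snd z)) (power_length (fst z) (tl (snd z)) - 1)
     (map (root_pair rt z) (fst (snd (snd (factor (power_length (fst z) (tl (snd z)) - 1))))))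
     (map (root_pair rt z) (snd (snd (snd (factor (power_length (fst z) (tl (snd z)) - 1)))))))"

context presentation
begin

lemma q_eq: "power_length p (tl (map nat F)) = q" "reduction p (map nat F) = red"
  using pres_facts(4) by (auto simp: power_length reduction_def red_def)

lemma q_gt_1: "1 < q"
proof -
  have "1 < p" using p_prime by (rule prime_gt_1_nat)
  moreover have "0 < degree F" using deg(1) by simp
  ultimately show ?thesis unfolding pres_facts(4) by (rule one_less_power)
qed

context
  fixes n and rt
  assumes n: "floorlog 2 q \<le> n"
    and bound: "\<And>l. Factorial_Ring.prime l \<Longrightarrow> l dvd q - 1 \<Longrightarrow> l \<le> n"
    and rt: "\<And>l. Factorial_Ring.prime l \<Longrightarrow> l dvd q - 1 \<Longrightarrow>
      \<exists>g. reduced p F g \<and> primitive_root_of_unity L (root_order l) (S g) \<and> rt (p, map nat F) (root_order l) = map nat g"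
begin

lemma factors:
  "prod_list (fst (snd (snd (factor (q - 1))))) = q - 1"
  "l \<in> set (fst (snd (snd (factor (q - 1))))) \<Longrightarrow> Factorial_Ring.prime l \<and> l dvd q - 1"
  "distinct (snd (snd (snd (factor (q - 1)))))"
  "set (snd (snd (snd (factor (q - 1))))) = {l. Factorial_Ring.prime l \<and> l dvd q - 1}"
proof -
  have "0 < q - 1" using q_gt_1 by simp
  note f = factor_correct[OF this bound]
  show p: "prod_list (fst (snd (snd (factor (q - 1))))) = q - 1"
    "distinct (snd (snd (snd (factor (q - 1)))))"
    "set (snd (snd (snd (factor (q - 1))))) = {l. Factorial_Ring.prime l \<and> l dvd q - 1}"
    by (rule f, assumption+)+
  have dvd: "l dvd prod_list ls" if "l \<in> set ls" for l :: nat and ls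
    using that by (induction ls) auto
  have "\<forall>l\<in>set (fst (snd (snd (factor (q - 1))))). Factorial_Ring.prime l" by (rule f)
  then show "l \<in> set (fst (snd (snd (factor (q - 1))))) \<Longrightarrow> Factorial_Ring.prime l \<and> l dvd q - 1"
    using dvd[of l "fst (snd (snd (factor (q - 1))))"] p(1) by simp
qed

lemma root_pair:
  assumes "Factorial_Ring.prime l" "l dvd q - 1"
  defines "lz \<equiv> root_pair rt (p, map nat F) l"
  shows "fst lz = l" "1 < l" "l \<le> n" "snd lz \<in> zp.ext_V (p, red)" "phi (snd lz) \<in> carrier L.Kx"
    "L.mult.ord (phi (snd lz)) = root_order l" "root_order l \<le> q - 1"
    "set (rt (p, map nat F) (root_order l)) \<subseteq> zp_V p"
proof -
  obtain g where g: "reduced p F g" "primitive_root_of_unity L (root_order l) (S g)"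
    "rt (p, map nat F) (root_order l) = map nat g"
    using rt[OF assms(1,2)] by blast
  have gP: "g \<in> carrier P" using g(1) by (simp add: reduced_def R_def)
  have lz: "lz = (l, embed (p, red) (map nat g))"
    by (simp add: lz_def root_pair_def q_eq g(3))
  show "fst lz = l" "1 < l" "l \<le> n"
    using lz prime_gt_1_nat[OF assms(1)] bound[OF assms(1,2)] by auto
  show V: "set (rt (p, map nat F) (root_order l)) \<subseteq> zp_V p"
    using set_map_nat[OF gP] by (simp add: g(3) zp_V_def)
  show "snd lz \<in> zp.ext_V (p, red)"
    unfolding lz snd_conv by (rule embed_closed[OF red_C[OF n]]) (use V g(3) in simp)
  have "phi (snd lz) = S g" by (simp add: lz phi_embed[OF gP])
  then show K: "phi (snd lz) \<in> carrier L.Kx" "L.mult.ord (phi (snd lz)) = root_order l"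
    using g(2) by (simp_all only: primitive_root_of_unity_def L.mult_of_eq_Kx)
  have "root_order l dvd q - 1" using L.dvd_N_iff_ord[OF K(1)] K(2) N_eq by simp
  then show "root_order l \<le> q - 1" using q_gt_1 by (intro dvd_imp_le) auto
qed

abbreviation "fz \<equiv> map (root_pair rt (p, map nat F)) (fst (snd (snd (factor (q - 1)))))"
abbreviation "pz \<equiv> map (root_pair rt (p, map nat F)) (snd (snd (snd (factor (q - 1)))))"

lemma floorlog_pred: "floorlog 2 (q - 1) \<le> n"
  using floorlog_mono[of "q - 1" q 2] n by simp

lemma input: "(n, ((p, red), q - 1, fz)) \<in> fld.Input"
  "rz \<in> set pz \<Longrightarrow> 1 < fst rz \<and> fst rz \<le> n \<and> root_order (fst rz) \<le> q - 1 \<and> snd rz \<in> zp.ext_V (p, red)"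
proof -
  show "(n, ((p, red), q - 1, fz)) \<in> fld.Input"
    unfolding fld.Input_def using red_C[OF n] q_gt_1 floorlog_pred factors(2) root_pair by auto
  assume "rz \<in> set pz"
  then obtain l where "Factorial_Ring.prime l" "l dvd q - 1" "rz = root_pair rt (p, map nat F) l"
    using factors(4) by auto
  then show "1 < fst rz \<and> fst rz \<le> n \<and> root_order (fst rz) \<le> q - 1 \<and> snd rz \<in> zp.ext_V (p, red)"
    using root_pair[of l] by simp
qed

lemma compute_generator_correct:
  "\<exists>g. reduced p F g \<and> primitive_element L (S g) \<and> compute_generator rt (p, map nat F) = map nat g"
proof -
  interpret field_solver zp.ext_C zp.ext_V zp.ext_zero zp.ext_one zp.ext_mone zp.ext_add zp.ext_mul L n "(p, red)" phi
    by (rule solver[OF n])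
  let ?x = "fld.generator (p, red) (q - 1) fz pz"
  have fst_pair: "fst (root_pair rt z a) = a" for z a by (simp add: root_pair_def)
  have good: "Factorial_Ring.prime (fst lz) \<and> fst lz \<le> n \<and> snd lz \<in> zp.ext_V (p, red) \<and> phi (snd lz) \<in> carrier L.Kx \<and>
      L.mult.ord (phi (snd lz)) = root_order (fst lz)" if lz: "lz \<in> set fz \<union> set pz" for lz
  proof -
    obtain l where l: "Factorial_Ring.prime l" "l dvd q - 1" "lz = root_pair rt (p, map nat F) l"
      using factors(2,4) lz by auto
    then show ?thesis using root_pair[of l] by simp
  qed
  have "floorlog 2 L.N \<le> n" "L.N dvd prod_list (map fst fz)" "distinct (map fst pz)"
    "fst ` set pz = {r. Factorial_Ring.prime r \<and> r dvd L.N}"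
    using floorlog_pred factors by (simp_all add: N_eq comp_def fst_pair image_image)
  note gc = generator_correct[OF this(1) good this(2-4), unfolded N_eq]
  then have "?x \<in> zp.ext_V (p, red) \<and> primitive_element L (phi ?x)"
    by simp
  then obtain "?x \<in> zp.ext_V (p, red)" "primitive_element L (phi ?x)" by blast
  moreover have "compute_generator rt (p, map nat F) = strip ?x"
    by (simp add: compute_generator_def q_eq)
  moreover have "map nat (map int (strip ?x)) = strip ?x" by (simp add: comp_def)
  ultimately show ?thesis using strip_correct[of ?x] by metis
qed

end

end

lemma prime_dvd_prod_powers:
  fixes l :: nat
  assumes "Factorial_Ring.prime l" "l dvd (\<Prod>j\<in>J. r j ^ e j)" "finite J" "\<And>j. j \<in> J \<Longrightarrow> Factorial_Ring.prime (r j)"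
  shows "l \<in> r ` J"
proof -
  obtain j where "j \<in> J" "l dvd r j ^ e j"
    using assms(1-3) prime_dvd_prod_iff[of J l "\<lambda>j. r j ^ e j"] by auto
  then have "j \<in> J" "l dvd r j" using assms(1) by (auto dest: prime_dvd_power)
  moreover from this have "l = r j" using assms(1) assms(4)[of j] by (simp add: primes_dvd_imp_eq)
  ultimately show ?thesis by simp
qed

lemma log_le_floorlog: "0 < q \<Longrightarrow> log 2 (real q) \<le> real (floorlog 2 q)"
  using log_of_power_less[of q 2 "floorlog 2 q"] less_pow_floorlog[of q] by simp

lemma floorlog_le_log: "1 < q \<Longrightarrow> real (floorlog 2 q) \<le> 2 * log 2 (real q)"
proof -
  assume q: "1 < q"
  have "1 \<le> log 2 (real q)" using q by (simp add: le_log_iff)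
  moreover have "real (floorlog 2 q) = real_of_int \<lfloor>log 2 (real q)\<rfloor> + 1"
    using q by (simp add: floorlog_def)
  ultimately show ?thesis using of_int_floor_le[of "log 2 (real q)"] by linarith
qed

lemma pt_root_pair:
  assumes z: "ptime D z" and a: "ptime D a" and r: "ptime D (\<lambda>y. rt (z y) (root_order (a y)))"
    and red: "ptime D (\<lambda>y. reduction (fst (z y)) (snd (z y)))"
    and V: "\<And>n y. (n, y) \<in> D \<Longrightarrow> (n, (fst (z y), reduction (fst (z y)) (snd (z y)))) \<in> zp.ext_C \<and>
      set (rt (z y) (root_order (a y))) \<subseteq> zp_V (fst (z y))"
  shows "ptime D (\<lambda>y. root_pair rt (z y) (a y))"
  unfolding root_pair_def
  by (intro ptime_Pair pt_embed ptime_fst z a r red) (use V in simp)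

theorem theorem2p2:
  fixes Q :: "nat set"
    and m :: "nat \<Rightarrow> nat"
    and r e :: "nat \<Rightarrow> nat \<Rightarrow> nat"
  assumes "\<forall>q\<in>Q. primepow q"
    and "\<forall>q\<in>Q. q = (\<Prod>j=1..m q. r q j ^ e q j) + 1"
    and "\<forall>q\<in>Q. inj_on (r q) {1..m q}"
    and "\<forall>q\<in>Q. \<forall>j\<in>{1..m q}. Factorial_Ring.prime (r q j) \<and> e q j \<ge> 1"
    and "\<exists>c d :: nat. \<forall>q\<in>Q. real (\<Sum>j=1..m q. r q j) \<le> real c * log 2 (real q) ^ d"
    and "solvable_in_polylog_time
           (root_of_unity_problem Q (\<lambda>q. (\<lambda>j. root_order (r q j)) ` {1..m q}))"
  shows "solvable_in_polylog_time (primitive_element_problem Q)"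
proof -
  obtain c1 d1 :: nat where sum: "\<And>q. q \<in> Q \<Longrightarrow> real (\<Sum>j=1..m q. r q j) \<le> real c1 * log 2 (real q) ^ d1"
    using assms(5) by blast
  obtain P0 c0 d0 where P0: "\<And>q x Y. (q, x, Y) \<in> root_of_unity_problem Q (\<lambda>q. (\<lambda>j. root_order (r q j)) ` {1..m q}) \<Longrightarrow>
      \<exists>y t. runs P0 x y t \<and> y \<in> Y \<and> real t \<le> real c0 * log 2 (real q) ^ d0"
    using assms(6) unfolding solvable_in_polylog_time_def by fast
  \<comment> \<open>\<open>A\<close> and \<open>B\<close> dominate both given bounds; the added 1
    makes \<open>size q\<close> at least the bit length of \<open>q\<close>.\<close>
  define A where "A = c0 + c1 + 1"
  define B where "B = d0 + d1 + 1"
  define size where "size q = A * floorlog 2 q ^ B" for q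
  \<comment> \<open>On instances of the problem the choice is forced, since runs are deterministic
    and lists of numbers have distinct encodings.\<close>
  define rt where "rt z a = (SOME w :: nat list. \<exists>t. runs P0 (enc (z, a)) (enc w) t)" for z :: "nat \<times> nat list" and a :: nat
  define D where "D = {(n, z). \<exists>q p F. n = size q \<and> z = (p, map nat F) \<and> q \<in> Q \<and> field_presentation q p F}"

  have size: "real c * log 2 (real q) ^ d \<le> real (size q)" if "c \<le> A" "d \<le> B" "1 < q" for c d q
  proof -
    have l: "1 \<le> log 2 (real q)" using that(3) by (simp add: le_log_iff)
    have "log 2 (real q) ^ d \<le> log 2 (real q) ^ B" using l that(2) by (rule power_increasing[rotated])
    also have "\<dots> \<le> real (floorlog 2 q) ^ B" using l log_le_floorlog[of q] that(3) by (intro power_mono) auto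
    finally have "real c * log 2 (real q) ^ d \<le> real A * real (floorlog 2 q) ^ B"
      using that(1) l by (intro mult_mono) auto
    then show ?thesis by (simp add: size_def)
  qed
  have flog: "floorlog 2 q \<le> size q" if "1 < q" for q
  proof -
    have "1 \<le> floorlog 2 q" using that by (simp add: floorlog_def)
    then have "floorlog 2 q ^ 1 \<le> floorlog 2 q ^ B" by (intro power_increasing) (simp_all add: B_def)
    then show ?thesis by (simp add: size_def A_def)
  qed
  have inst: "\<exists>p q F. presentation p q F \<and> z = (p, map nat F) \<and> q \<in> Q \<and> n = size q" if "(n, z) \<in> D" for n z
  proof -
    have "\<exists>q p F. n = size q \<and> z = (p, map nat F) \<and> q \<in> Q \<and> field_presentation q p F"
      using that by (simp add: D_def)
    then obtain q p F where D: "n = size q" "z = (p, map nat F)" "q \<in> Q" "field_presentation q p F"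
      by blast
    then have "presentation p q F"
      by (intro presentation.intro presentation_axioms.intro residues_prime.intro) (auto simp: field_presentation_def)
    with D show ?thesis by blast
  qed
  have primes: "l \<in> r q ` {1..m q}" "l \<le> size q" if "q \<in> Q" "1 < q" "Factorial_Ring.prime l" "l dvd q - 1" for q l
  proof -
    have "q - 1 = (\<Prod>j=1..m q. r q j ^ e q j)" using assms(2) that(1) by (metis diff_add_inverse2)
    then show l: "l \<in> r q ` {1..m q}"
      using prime_dvd_prod_powers[OF that(3), where J = "{1..m q}" and r = "r q" and e = "e q"] that(1,4) assms(4) by simp
    then obtain j where "j \<in> {1..m q}" "l = r q j" by blast
    then have "l \<le> (\<Sum>j=1..m q. r q j)" by (simp add: member_le_sum)
    also have "real \<dots> \<le> real c1 * log 2 (real q) ^ d1" by (rule sum[OF that(1)])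
    also have "\<dots> \<le> real (size q)" by (rule size) (use that in \<open>simp_all add: A_def B_def\<close>)
    finally show "l \<le> size q" by simp
  qed
  have root: "\<exists>g t. reduced p F g \<and> primitive_root_of_unity (presented_field p F) a (field_elem p F g) \<and>
      rt (p, map nat F) a = map nat g \<and> runs P0 (enc ((p, map nat F), a)) (enc (rt (p, map nat F) a)) t \<and> t \<le> size q"
    if "q \<in> Q" "1 < q" "field_presentation q p F" "a \<in> (\<lambda>j. root_order (r q j)) ` {1..m q}" for q p F a
  proof -
    have i: "enc ((p, map nat F), a) = Pair (enc_field p F) (Num a)"
      by (simp add: enc_field_def enc_poly_eq enc_nat_def)
    have "(q, Pair (enc_field p F) (Num a), {enc_poly g | g. reduced p F g \<and>
          primitive_root_of_unity (presented_field p F) a (field_elem p F g)}) \<in>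
        root_of_unity_problem Q (\<lambda>q. (\<lambda>j. root_order (r q j)) ` {1..m q})"
      using that unfolding root_of_unity_problem_def by blast
    from P0[OF this] obtain g t where g: "reduced p F g" "primitive_root_of_unity (presented_field p F) a (field_elem p F g)"
      and t: "runs P0 (enc ((p, map nat F), a)) (enc (map nat g)) t" "real t \<le> real c0 * log 2 (real q) ^ d0"
      unfolding i by (auto simp: enc_poly_eq)
    have "rt (p, map nat F) a = map nat g"
      unfolding rt_def
    proof (rule some_equality)
      show "\<exists>t. runs P0 (enc ((p, map nat F), a)) (enc (map nat g)) t" using t(1) by blast
      show "w = map nat g" if "\<exists>t. runs P0 (enc ((p, map nat F), a)) (enc w) t" for w
        using that runs_deterministic[OF t(1)] enc_nat_list_inj by blast
    qed
    moreover have "real t \<le> real (size q)"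
      using t(2) size[of c0 d0 q] that(2) by (simp add: A_def B_def)
    ultimately show ?thesis using g t(1) by auto
  qed

  define Z where "Z = {(n, (z, a)). \<exists>q p F. n = size q \<and> z = (p, map nat F) \<and> q \<in> Q \<and> 1 < q \<and> field_presentation q p F \<and>
      a \<in> (\<lambda>j. root_order (r q j)) ` {1..m q}}"
  \<comment> \<open>The assumed program itself is the witness: the pair is encoded exactly as its
    input, and its running time is at most \<open>size q\<close>, the parameter.\<close>
  have pt_rt: "ptime Z (\<lambda>y. rt (fst y) (snd y))"
    unfolding ptime_def
  proof (intro exI conjI)
    show "polyb Z (\<lambda>n _. n)" by (rule polyb_size)
    show "\<forall>(n, y)\<in>Z. \<exists>t\<le>n. runs P0 (enc y) (enc (rt (fst y) (snd y))) t"
    proof (clarify)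
      fix n p l a assume "(n, ((p, l), a)) \<in> Z"
      then obtain q F where "n = size q" "l = map nat F" "q \<in> Q" "1 < q" "field_presentation q p F"
        "a \<in> (\<lambda>j. root_order (r q j)) ` {1..m q}" unfolding Z_def by blast
      with root[of q p F a] show "\<exists>t\<le>n. runs P0 (enc ((p, l), a)) (enc (rt (fst ((p, l), a)) (snd ((p, l), a)))) t"
        by auto
    qed
  qed
  have correct: "floorlog 2 q \<le> n \<and> (\<forall>l. Factorial_Ring.prime l \<longrightarrow> l dvd q - 1 \<longrightarrow> l \<le> n) \<and>
     (\<forall>l. Factorial_Ring.prime l \<longrightarrow> l dvd q - 1 \<longrightarrow> (\<exists>g. reduced p F g \<and>
       primitive_root_of_unity (presented_field p F) (root_order l) (field_elem p F g) \<and> rt (p, map nat F) (root_order l) = map nat g))"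
    if "presentation p q F" "q \<in> Q" "n = size q" for p q F n
  proof -
    interpret presentation p "residue_ring (int p)" q F by (rule that(1))
    show ?thesis using flog[OF q_gt_1] primes[OF that(2) q_gt_1] root[OF that(2) q_gt_1 pres] that(3) by blast
  qed

  have bD: "bdd D" unfolding bdd_def
  proof (rule polyb_mono)
    show "polyb D (\<lambda>n z. 1 + ((1 + n) + (1 + (n + 1) * ((1 + n) + 1))))" by (intro polyb_intros)
    fix n z assume "(n, z) \<in> D"
    then obtain p q F where pr: "presentation p q F" and z: "z = (p, map nat F)" and q: "q \<in> Q" "n = size q"
      using inst by blast
    interpret presentation p "residue_ring (int p)" q F by (rule pr)
    have C: "(n, (p, red)) \<in> zp.ext_C" using red_C flog[OF q_gt_1] q(2) by simp
    then have zp: "(n, p) \<in> zp_C" and len: "length F \<le> n + 1" using length_red by (auto simp: zp.ext_C_def)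
    have "bs (map nat F) \<le> 1 + length (map nat F) * ((1 + n) + 1)"
      by (rule bs_list_le, rule bs_zp(1)[OF zp]) (use set_map_nat[OF pres_facts(1)] in \<open>auto simp: zp_V_def\<close>)
    also have "\<dots> \<le> 1 + (n + 1) * ((1 + n) + 1)" using len by (intro add_mono mult_mono) auto
    finally show "bs z \<le> 1 + ((1 + n) + (1 + (n + 1) * ((1 + n) + 1)))"
      using bs_zp(2)[OF zp] by (simp add: z)
  qed
  have ne: "snd z \<noteq> []" if "(n, z) \<in> D" for n z
    using inst[OF that] presentation.deg(2) by fastforce
  have pt_q: "ptime D (\<lambda>z. power_length (fst z) (tl (snd z)))"
    unfolding power_length_def
  \<comment> \<open>The partial results are powers of \<open>p\<close> that do not exceed
    \<open>q\<close>, which bounds their size.\<close>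
  proof (rule ptime_foldl_prefix[where S = "\<lambda>n z ys s. s = fst z ^ length ys"])
    show "ptime D (\<lambda>z. 1::nat)" "ptime D (\<lambda>z. tl (snd z))"
      by (intro ptime_nat ptime_tl ptime_proj bD ne; assumption)+
    let ?S = "{(n, (z, ys, s)). (n, z) \<in> D \<and> (\<exists>zs. tl (snd z) = ys @ zs) \<and> s = fst z ^ length ys}"
    show "polyb ?S (\<lambda>n y. bs (snd (snd y)))"
    proof (rule polyb_mono)
      show "polyb ?S (\<lambda>n y. 1 + n)" by (intro polyb_intros)
      fix n y assume "(n, y) \<in> ?S"
      then obtain z ys zs where y: "(n, z) \<in> D" "tl (snd z) = ys @ zs" "snd (snd y) = fst z ^ length ys" by auto
      obtain p q F where pr: "presentation p q F" and z: "z = (p, map nat F)" and q: "q \<in> Q" "n = size q"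
        using inst[OF y(1)] by blast
      interpret presentation p "residue_ring (int p)" q F by (rule pr)
      have "length ys \<le> degree F" using arg_cong[OF y(2), of length] by (simp add: z)
      then have "p ^ length ys \<le> q" unfolding pres_facts(4) using prime_gt_0_nat[OF p_prime] by (intro power_increasing) auto
      then have "floorlog 2 (p ^ length ys) \<le> n" using floorlog_mono[of "p ^ length ys" q 2] flog[OF q_gt_1] q(2) by simp
      then show "bs (snd (snd y)) \<le> 1 + n" by (simp add: y(3) z enc_nat_def)
    qed
    let ?L = "{(n, (z, s, a)). (n, z) \<in> D \<and> (\<exists>ys zs. tl (snd z) = ys @ a # zs \<and> s = fst z ^ length ys)}"
    show "ptime ?L (\<lambda>y. fst (snd y) * fst (fst y))" if "bdd ?L" by (intro ptime_times ptime_proj that)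
  qed auto
  have pt_red: "ptime D (\<lambda>z. reduction (fst z) (snd z))"
    unfolding reduction_def
    by (intro ptime_map ptime_tl ptime_mod ptime_minus ptime_proj bD ne; assumption)
  have pt_N: "ptime D (\<lambda>z. power_length (fst z) (tl (snd z)) - 1)"
    by (intro ptime_minus pt_q ptime_nat bD)
  have pt_fac: "ptime D (\<lambda>z. factor (power_length (fst z) (tl (snd z)) - 1))"
  proof (rule pt_factor[OF pt_N])
    fix n z assume z: "(n, z) \<in> D"
    obtain p q F where pr: "presentation p q F" and z: "z = (p, map nat F)" and q: "q \<in> Q" "n = size q"
      using inst[OF z] by blast
    interpret presentation p "residue_ring (int p)" q F by (rule pr)
    show "0 < power_length (fst z) (tl (snd z)) - 1 \<and> floorlog 2 (power_length (fst z) (tl (snd z)) - 1) \<le> n \<and>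
        (\<forall>l. Factorial_Ring.prime l \<longrightarrow> l dvd power_length (fst z) (tl (snd z)) - 1 \<longrightarrow> l \<le> n)"
      using correct[OF pr q] q_gt_1 floorlog_mono[of "q - 1" q 2] by (simp add: z q_eq)
  qed
  \<comment> \<open>The selector \<open>ls\<close> covers the lists of prime factors with and
    without multiplicity by one argument.\<close>
  have pairs: "ptime D (\<lambda>z. map (root_pair rt z) (ls (factor (power_length (fst z) (tl (snd z)) - 1))))"
    if ls: "ls = (\<lambda>s. fst (snd (snd s))) \<or> ls = (\<lambda>s. snd (snd (snd s)))" for ls :: "nat \<times> nat \<times> nat list \<times> nat list \<Rightarrow> nat list"
  proof (rule ptime_map)
    show "ptime D (\<lambda>z. ls (factor (power_length (fst z) (tl (snd z)) - 1)))"
      using ls by (elim disjE; hypsubst; intro ptime_fst ptime_snd pt_fac)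
    let ?L = "{(n, (z, a)). (n, z) \<in> D \<and> a \<in> set (ls (factor (power_length (fst z) (tl (snd z)) - 1)))}"
    have L: "\<exists>p q F. presentation p q F \<and> fst y = (p, map nat F) \<and> q \<in> Q \<and> n = size q \<and> Factorial_Ring.prime (snd y) \<and> snd y dvd q - 1"
      if "(n, y) \<in> ?L" for n y
    proof -
      have y: "(n, fst y) \<in> D" "snd y \<in> set (ls (factor (power_length (fst (fst y)) (tl (snd (fst y))) - 1)))" using that by auto
      obtain p q F where pr: "presentation p q F" and z: "fst y = (p, map nat F)" and q: "q \<in> Q" "n = size q"
        using inst[OF y(1)] by blast
      interpret presentation p "residue_ring (int p)" q F by (rule pr)
      have "Factorial_Ring.prime (snd y) \<and> snd y dvd q - 1"
        using y(2) ls factors(2,4)[of n rt] correct[OF pr q] by (auto simp: z q_eq)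
      then show ?thesis using pr z q by blast
    qed
    assume b: "bdd ?L"
    show "ptime ?L (\<lambda>y. root_pair rt (fst y) (snd y))"
    proof (rule pt_root_pair)
      show "ptime ?L fst" "ptime ?L snd" using ptime_fst[OF ptime_id[OF b]] ptime_snd[OF ptime_id[OF b]] by simp_all
      show "ptime ?L (\<lambda>y. reduction (fst (fst y)) (snd (fst y)))"
        by (rule ptime_comp[OF ptime_fst[OF ptime_id[OF b]] pt_red]) auto
      have "ptime ?L (\<lambda>y. (fst y, root_order (snd y)))" by (intro ptime_Pair ptime_root_order ptime_proj b)
      moreover have "(n, (fst y, root_order (snd y))) \<in> Z" if y: "(n, y) \<in> ?L" for n y
      proof -
        obtain p q F where pr: "presentation p q F" and z: "fst y = (p, map nat F)" and q: "q \<in> Q" "n = size q"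
          and l: "Factorial_Ring.prime (snd y)" "snd y dvd q - 1" using L[OF y] by blast
        interpret presentation p "residue_ring (int p)" q F by (rule pr)
        have "root_order (snd y) \<in> (\<lambda>j. root_order (r q j)) ` {1..m q}"
          using primes(1)[OF q(1) q_gt_1 l] by auto
        then show ?thesis using z q pres q_gt_1 by (auto simp: Z_def)
      qed
      ultimately show "ptime ?L (\<lambda>y. rt (fst y) (root_order (snd y)))"
        using ptime_comp[OF _ pt_rt, of ?L "\<lambda>y. (fst y, root_order (snd y))"] by simp
      fix n y assume y: "(n, y) \<in> ?L"
      obtain p q F where pr: "presentation p q F" and z: "fst y = (p, map nat F)" and q: "q \<in> Q" "n = size q"
        and l: "Factorial_Ring.prime (snd y)" "snd y dvd q - 1" using L[OF y] by blast
      interpret presentation p "residue_ring (int p)" q F by (rule pr)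
      show "(n, (fst (fst y), reduction (fst (fst y)) (snd (fst y)))) \<in> zp.ext_C \<and>
          set (rt (fst y) (root_order (snd y))) \<subseteq> zp_V (fst (fst y))"
        using red_C[of n] root_pair(8)[of n rt "snd y"] l correct[OF pr q] by (auto simp: z q_eq)
    qed
  qed
  have pt_compute_generator: "ptime D (compute_generator rt)"
    unfolding compute_generator_def[abs_def]
  proof (intro pt_strip fld.pt_generator ptime_Pair ptime_proj bD pt_red pt_N pairs)
    fix n z assume z: "(n, z) \<in> D"
    obtain p q F where pr: "presentation p q F" and z: "z = (p, map nat F)" and q: "q \<in> Q" "n = size q"
      using inst[OF z] by blast
    interpret presentation p "residue_ring (int p)" q F by (rule pr)
    show "(n, ((fst z, reduction (fst z) (snd z)), power_length (fst z) (tl (snd z)) - 1,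
          map (root_pair rt z) (fst (snd (snd (factor (power_length (fst z) (tl (snd z)) - 1))))))) \<in> fld.Input \<and>
        (\<forall>rz\<in>set (map (root_pair rt z) (snd (snd (snd (factor (power_length (fst z) (tl (snd z)) - 1)))))).
          1 < fst rz \<and> fst rz \<le> n \<and> root_order (fst rz) \<le> power_length (fst z) (tl (snd z)) - 1 \<and>
          snd rz \<in> zp.ext_V (fst z, reduction (fst z) (snd z)))"
      using input[of n rt] correct[OF pr q] by (simp add: z q_eq)
  qed auto
  then obtain P T where T: "polyb D T" and P: "\<And>n z. (n, z) \<in> D \<Longrightarrow> runs P (enc z) (enc (compute_generator rt z)) (T n z)"
    by (rule ptimeE) blast
  obtain k where k: "\<And>n z. (n, z) \<in> D \<Longrightarrow> T n z \<le> (n + 2) ^ k"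
    using T unfolding polyb_def by blast
  show ?thesis unfolding solvable_in_polylog_time_def
  \<comment> \<open>The running time is at most \<open>(size q + 2) ^ k\<close>. The summand 2 is
    absorbed into \<open>A + 2\<close>, and \<open>2 ^ B\<close> comes from the bit length being at
    most twice the logarithm.\<close>
  proof (rule exI[of _ P], rule exI[of _ "((A + 2) * 2 ^ B) ^ k"], rule exI[of _ "B * k"], clarify)
    fix q x Y assume "(q, x, Y) \<in> primitive_element_problem Q"
    then obtain p F where q: "q \<in> Q" "field_presentation q p F" and x: "x = enc_field p F"
      and Y: "Y = {enc_poly g | g. reduced p F g \<and> primitive_element (presented_field p F) (field_elem p F g)}"
      unfolding primitive_element_problem_def by blast
    have z: "(size q, (p, map nat F)) \<in> D" using q by (auto simp: D_def)
    have pr: "presentation p q F"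
      using q(2) by (intro presentation.intro presentation_axioms.intro residues_prime.intro) (auto simp: field_presentation_def)
    interpret presentation p "residue_ring (int p)" q F by (rule pr)
    have "\<exists>g. reduced p F g \<and> primitive_element L (S g) \<and> compute_generator rt (p, map nat F) = map nat g"
      using correct[OF pr q(1) refl] by (intro compute_generator_correct[of "size q"]) blast+
    then have "enc (compute_generator rt (p, map nat F)) \<in> Y" by (auto simp: Y enc_poly_eq)
    moreover have "runs P x (enc (compute_generator rt (p, map nat F))) (T (size q) (p, map nat F))"
      using P[OF z] by (simp add: x enc_field_def enc_poly_eq enc_nat_def)
    moreover have "real (T (size q) (p, map nat F)) \<le> real (((A + 2) * 2 ^ B) ^ k) * log 2 (real q) ^ (B * k)"
    proof -
      have l: "1 \<le> floorlog 2 q" using q_gt_1 by (simp add: floorlog_def)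
      then have "1 \<le> floorlog 2 q ^ B" by (rule one_le_power)
      then have "size q + 2 \<le> (A + 2) * floorlog 2 q ^ B" by (simp add: size_def)
      then have "real (size q + 2) \<le> real ((A + 2) * floorlog 2 q ^ B)" by (rule of_nat_mono)
      also have "\<dots> = real (A + 2) * real (floorlog 2 q) ^ B" by (simp only: of_nat_mult of_nat_power)
      also have "\<dots> \<le> real (A + 2) * (2 * log 2 (real q)) ^ B"
        by (intro mult_left_mono power_mono floorlog_le_log q_gt_1) auto
      finally have le: "real (size q + 2) \<le> real ((A + 2) * 2 ^ B) * log 2 (real q) ^ B"
        by (simp only: power_mult_distrib of_nat_mult of_nat_power of_nat_numeral mult.assoc)
      have "real (T (size q) (p, map nat F)) \<le> real ((size q + 2) ^ k)" using k[OF z] by (rule of_nat_mono)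
      also have "\<dots> = real (size q + 2) ^ k" by simp
      also have "\<dots> \<le> (real ((A + 2) * 2 ^ B) * log 2 (real q) ^ B) ^ k" by (rule power_mono[OF le]) simp
      also have "\<dots> = real (((A + 2) * 2 ^ B) ^ k) * log 2 (real q) ^ (B * k)"
        by (simp only: power_mult_distrib[of _ _ k] power_mult[of _ B k] of_nat_power[of _ k, symmetric])
      finally show ?thesis .
    qed
    ultimately show "\<exists>y t. runs P x y t \<and> y \<in> Y \<and> real t \<le> real (((A + 2) * 2 ^ B) ^ k) * log 2 (real q) ^ (B * k)"
      by blast
  qed
qed

end
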